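(* Let $\mathbf{A}:\mathbb{R}^2\to\mathbb{R}^2$ be smooth, $H(q,p)=\|p-\mathbf{A}(q)\|^2$ on $T^*\mathbb{R}^2$, and $B=\partial_{q_1}A_2-\partial_{q_2}A_1$. Assume that the magnetic field $B>0$ is confining: there exist $C>0$ and $M>0$ such that $B(q)\ge C$ if $\|q\|\ge M$. Let $C_0<C$, and let $J\subset(0,C_0)$ be a closed interval such that $dB$ does not vanish on $B^{-1}(J)$. Let $K$ be the normal form of $H$ described in the context, and let $\varphi_H^t,\varphi_K^t$ be the Hamiltonian flows of $H$ and $K$. Then up to a time of order $T=\mathcal{O}(1/\epsilon^N)$, for an arbitrary $N>0$, we have $$\|\varphi_H^t(q,p)-\varphi_K^t(q,p)\|=\mathcal{O}(\epsilon^\infty)$$ for all starting points $(q,p)$ such that $B(q)\in J$ and $H(q,p)=\mathcal{O}(\epsilon)$.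
   Context: $T^*\mathbb{R}^2$ carries the symplectic form $dp_1\wedge dq_1+dp_2\wedge dq_2$. Normal form: with $\Omega=\mathbb{R}^2$ (where $B$ does not vanish), let $\Phi$ be a symplectic diffeomorphism from an open set $\tilde\Omega\subset\mathbb{C}_{z_1}\times\mathbb{R}^2_{z_2}$ (with symplectic form $d\xi_1\wedge dx_1+d\xi_2\wedge dx_2$, $z_1=x_1+i\xi_1$, $z_2=(x_2,\xi_2)$) into $T^*\mathbb{R}^2$, sending $\{z_1=0\}$ to $\{H=0\}$, and $f:\mathbb{R}^2\times\mathbb{R}\to\mathbb{R}$ smooth, such that $H\circ\Phi=|z_1|^2f(z_2,|z_1|^2)+\mathcal{O}(|z_1|^\infty)$, such that $\varphi(q):=\Phi^{-1}(q,\mathbf{A}(q))\in\{0\}\times\mathbb{R}^2_{z_2}$ is defined for all $q\in\Omega$ and is a local diffeomorphism, and $f(\varphi(q),0)=|B(q)|$. Then $K:=\big(|z_1|^2f(z_2,|z_1|^2)\big)\circ\Phi^{-1}$. Asymptotic statements are as $\epsilon\to0^+$ and are uniform in the starting points considered: "$H(q,p)=\mathcal{O}(\epsilon)$" and "times of order $\mathcal{O}(\epsilon^{-N})$" mean $H(q,p)\le a\epsilon$ and $|t|\le b\epsilon^{-N}$ for fixed constants $a,b$ and all small $\epsilon$. $\mathcal{O}(\epsilon^\infty)$ means $\mathcal{O}(\epsilon^k)$ for every $k$. *)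

theory Defs
  imports "HOL-Analysis.Analysis" "HOL-Library.Landau_Symbols"
begin

section \<open>Smooth maps and diffeomorphisms\<close>

text \<open>Meant for open \<open>S\<close> only: \<open>frechet_derivative f (at x)\<close> is the full derivative.\<close>

primrec C_k_on :: "nat \<Rightarrow> ('a::euclidean_space \<Rightarrow> 'b::euclidean_space) \<Rightarrow> 'a set \<Rightarrow> bool" where
  "C_k_on 0 f S \<longleftrightarrow> continuous_on S f"
| "C_k_on (Suc k) f S \<longleftrightarrow>
     (\<forall>x\<in>S. f differentiable (at x)) \<and>
     (\<forall>v. C_k_on k (\<lambda>x. frechet_derivative f (at x) v) S)"

definition smooth_on :: "'a::euclidean_space set \<Rightarrow> ('a \<Rightarrow> 'b::euclidean_space) \<Rightarrow> bool" where
  "smooth_on S f \<longleftrightarrow> (\<forall>k. C_k_on k f S)"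

definition diffeo_on ::
    "'a::euclidean_space set \<Rightarrow> 'b::euclidean_space set \<Rightarrow> ('a \<Rightarrow> 'b) \<Rightarrow> bool" where
  "diffeo_on S T f \<longleftrightarrow> open S \<and> open T \<and> bij_betw f S T \<and>
     smooth_on S f \<and> smooth_on T (inv_into S f)"

definition local_diffeo :: "('a::euclidean_space \<Rightarrow> 'b::euclidean_space) \<Rightarrow> bool" where
  "local_diffeo f \<longleftrightarrow> (\<forall>x. \<exists>U V. x \<in> U \<and> diffeo_on U V f)"

section \<open>Phase spaces, symplectic forms, Hamiltonian flows\<close>

text \<open>Points of \<open>T\<^sup>*\<real>\<^sup>2\<close> are pairs \<open>(q, p)\<close>. Points of the model space are pairs \<open>(z\<^sub>1, z\<^sub>2)\<close> with
  \<open>z\<^sub>1 = x\<^sub>1 + i \<xi>\<^sub>1\<close> and \<open>z\<^sub>2 = (x\<^sub>2, \<xi>\<^sub>2)\<close>.\<close>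

type_synonym phase = "(real^2) \<times> (real^2)"
type_synonym model = "complex \<times> (real^2)"

text \<open>\<open>dp\<^sub>1 \<and> dq\<^sub>1 + dp\<^sub>2 \<and> dq\<^sub>2\<close>\<close>

definition omega_phase :: "phase \<Rightarrow> phase \<Rightarrow> real" where
  "omega_phase u v = snd u \<bullet> fst v - snd v \<bullet> fst u"

text \<open>\<open>d\<xi>\<^sub>1 \<and> dx\<^sub>1 + d\<xi>\<^sub>2 \<and> dx\<^sub>2\<close>\<close>

definition omega_model :: "model \<Rightarrow> model \<Rightarrow> real" where
  "omega_model u v =
     (Im (fst u) * Re (fst v) - Im (fst v) * Re (fst u)) +
     (snd u $ 2 * snd v $ 1 - snd v $ 2 * snd u $ 1)"

definition symplectic_on :: "model set \<Rightarrow> (model \<Rightarrow> phase) \<Rightarrow> bool" where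
  "symplectic_on S F \<longleftrightarrow> (\<forall>z\<in>S. \<forall>u v.
     omega_phase (frechet_derivative F (at z) u) (frechet_derivative F (at z) v) = omega_model u v)"

text \<open>Hamilton's equations \<open>q' = \<partial>H/\<partial>p\<close>, \<open>p' = - \<partial>H/\<partial>q\<close>.\<close>

definition ham_field :: "(phase \<Rightarrow> real) \<Rightarrow> phase \<Rightarrow> phase" where
  "ham_field H x =
     ((\<chi> j. frechet_derivative H (at x) (0, axis j 1)),
      (\<chi> j. - frechet_derivative H (at x) (axis j 1, 0)))"

text \<open>\<open>flow_rel D H t x y\<close>: a trajectory of \<open>H\<close>, staying in the open set \<open>D\<close> on which \<open>H\<close> is
  defined, leads from \<open>x\<close> at time 0 to \<open>y\<close> at time \<open>t\<close>; \<open>t\<close> may be negative.\<close>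

definition flow_rel :: "phase set \<Rightarrow> (phase \<Rightarrow> real) \<Rightarrow> real \<Rightarrow> phase \<Rightarrow> phase \<Rightarrow> bool" where
  "flow_rel D H t x y \<longleftrightarrow> (\<exists>\<gamma>. \<gamma> 0 = x \<and> \<gamma> t = y \<and>
     (\<forall>s\<in>closed_segment 0 t. \<gamma> s \<in> D \<and>
        (\<gamma> has_vector_derivative ham_field H (\<gamma> s)) (at s within closed_segment 0 t)))"

definition flow_defined :: "phase set \<Rightarrow> (phase \<Rightarrow> real) \<Rightarrow> real \<Rightarrow> phase \<Rightarrow> bool" where
  "flow_defined D H t x \<longleftrightarrow> (\<exists>y. flow_rel D H t x y)"

text \<open>For \<open>H\<close> smooth on the open set \<open>D\<close>, the point \<open>y\<close> is unique when it exists.\<close>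

definition ham_flow :: "phase set \<Rightarrow> (phase \<Rightarrow> real) \<Rightarrow> real \<Rightarrow> phase \<Rightarrow> phase" where
  "ham_flow D H t x = (THE y. flow_rel D H t x y)"

section \<open>The magnetic Hamiltonian and its normal form\<close>

definition mag_ham :: "(real^2 \<Rightarrow> real^2) \<Rightarrow> phase \<Rightarrow> real" where
  "mag_ham A x = (norm (snd x - A (fst x)))\<^sup>2"

text \<open>\<open>B = \<partial>\<^bsub>q1\<^esub> A\<^sub>2 - \<partial>\<^bsub>q2\<^esub> A\<^sub>1\<close>\<close>

definition mag_field :: "(real^2 \<Rightarrow> real^2) \<Rightarrow> real^2 \<Rightarrow> real" where
  "mag_field A q =
     frechet_derivative A (at q) (axis 1 1) $ 2 - frechet_derivative A (at q) (axis 2 1) $ 1"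

definition model_ham :: "((real^2) \<times> real \<Rightarrow> real) \<Rightarrow> model \<Rightarrow> real" where
  "model_ham f z = (cmod (fst z))\<^sup>2 * f (snd z, (cmod (fst z))\<^sup>2)"

text \<open>The remainder \<open>O(|z\<^sub>1|\<^sup>\<infinity>)\<close> is understood locally uniformly near the points of \<open>{z\<^sub>1 = 0}\<close>,
  hence the filter \<open>nhds z\<close>. The map \<open>\<phi>\<close> below takes its values in \<open>{0} \<times> \<real>\<^sup>2\<close>, which is
  identified with \<open>\<real>\<^sup>2\<close> by \<open>snd\<close>.\<close>

definition normal_form ::
    "(real^2 \<Rightarrow> real^2) \<Rightarrow> model set \<Rightarrow> (model \<Rightarrow> phase) \<Rightarrow> ((real^2) \<times> real \<Rightarrow> real) \<Rightarrow> bool" where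
  "normal_form A S \<Phi> f \<longleftrightarrow>
     diffeo_on S (\<Phi> ` S) \<Phi> \<and> symplectic_on S \<Phi> \<and>
     \<Phi> ` {z \<in> S. fst z = 0} = {x. mag_ham A x = 0} \<and>
     smooth_on UNIV f \<and>
     (\<forall>z\<in>S. fst z = 0 \<longrightarrow> (\<forall>k::nat.
        (\<lambda>w. mag_ham A (\<Phi> w) - model_ham f w) \<in> O[nhds z](\<lambda>w. (cmod (fst w)) ^ k))) \<and>
     (let \<phi> = (\<lambda>q. inv_into S \<Phi> (q, A q)) in
        (\<forall>q. (q, A q) \<in> \<Phi> ` S \<and> fst (\<phi> q) = 0 \<and> f (snd (\<phi> q), 0) = \<bar>mag_field A q\<bar>) \<and>
        local_diffeo (\<lambda>q. snd (\<phi> q)))"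

text \<open>\<open>K\<close> is only meaningful on \<open>\<Phi> ` S\<close>.\<close>

definition normal_ham ::
    "model set \<Rightarrow> (model \<Rightarrow> phase) \<Rightarrow> ((real^2) \<times> real \<Rightarrow> real) \<Rightarrow> phase \<Rightarrow> real" where
  "normal_ham S \<Phi> f x = model_ham f (inv_into S \<Phi> x)"

end

theory Submission
  imports Defs
begin

text \<open>In the coordinates \<open>(z\<^sub>1, z\<^sub>2)\<close> of the normal form the flow of \<open>K\<close> is explicit: \<open>I = |z\<^sub>1|\<^sup>2\<close> is
  conserved, \<open>z\<^sub>1\<close> rotates, and \<open>z\<^sub>2\<close> follows a level curve of \<open>f (\<cdot>, I)\<close> with speed proportional
  to \<open>I\<close>. The Hamiltonian \<open>H\<close> differs from \<open>K\<close> by a remainder that is flat on \<open>z\<^sub>1 = 0\<close>. Its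
  derivatives are flat too, so a trajectory of \<open>H\<close> that stays over a compact set solves the equation
  of \<open>K\<close> with a forcing term of size \<open>\<kappa> = O(|z\<^sub>1|\<^sup>\<infinity>)\<close> (\<open>pulled_back_field_flat\<close>).

  Both flows are confined. The quantities \<open>I\<close> and \<open>f (z\<^sub>2, I)\<close> are constant for \<open>K\<close> and drift by
  \<open>O(\<kappa> T)\<close> for \<open>H\<close> (\<open>forced_sol_drift\<close>). As \<open>f (z\<^sub>2, 0)\<close> is the magnetic field at the
  corresponding point, the set where it is close to \<open>J\<close> is compact because \<open>B \<ge> C > C0\<close> far out
  (\<open>confining_region\<close>), and neither trajectory can leave it before the drift becomes visible
  (\<open>forced_sol_confined\<close>).

  A Gronwall estimate over times \<open>\<epsilon>\<^sup>-\<^sup>N\<close> would lose an exponential factor. What saves the comparison is that the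
  flow of \<open>K\<close> spreads nearby points only linearly in time: \<open>dB\<close> does not vanish over \<open>J\<close>, so a
  displacement splits into a part across the level curves, which the values of \<open>f\<close> control, and a
  time lag along the curve. In the equation for the time lag the linear term vanishes, because a
  time shift of a trajectory is again a trajectory (\<open>time_lag_estimates\<close>). The lag therefore grows
  at the rate \<open>O(\<kappa> (1 + T) + \<mu>\<^sup>2)\<close> while the displacement is at most \<open>\<mu>\<close>, and with \<open>\<mu>\<close> a high power
  of \<open>\<epsilon>\<close> and \<open>\<kappa>\<close> a much higher one the bound \<open>\<mu>\<close> perpetuates itself over the whole time interval
  (\<open>forced_sol_comparison\<close>). The bound on \<open>z\<^sub>2\<close> controls the
  rotation angle of \<open>z\<^sub>1\<close>, and \<open>flows_close\<close> assembles the estimates.\<close>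

section \<open>Calculus of smooth maps\<close>

lemma linear_basis_expansion:
  fixes L :: "'a::euclidean_space \<Rightarrow> 'b::real_vector"
  assumes "linear L" shows "L v = (\<Sum>b\<in>Basis. (v \<bullet> b) *\<^sub>R L b)"
proof -
  have "L (\<Sum>b\<in>Basis. (v \<bullet> b) *\<^sub>R b) = (\<Sum>b\<in>Basis. (v \<bullet> b) *\<^sub>R L b)"
    using assms by (simp add: linear_sum linear_scale)
  then show ?thesis by (simp add: euclidean_representation)
qed

lemma compact_norm_bound:
  assumes "compact K" obtains r where "r > 0" "\<And>x. x \<in> K \<Longrightarrow> norm x \<le> r"
  using compact_imp_bounded[OF assms] unfolding bounded_pos by blast

lemma C_k_on_SucD:
  assumes "C_k_on (Suc k) f S" "x \<in> S"
  shows "(f has_derivative frechet_derivative f (at x)) (at x)"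
  using assms frechet_derivative_works by auto

lemma C_k_on_cong:
  assumes "open S" "\<And>x. x \<in> S \<Longrightarrow> f x = g x" "C_k_on k f S"
  shows "C_k_on k g S"
  using assms(2,3)
proof (induction k arbitrary: f g)
  case 0
  then show ?case by (simp cong: continuous_on_cong)
next
  case (Suc k)
  have d: "(g has_derivative frechet_derivative f (at x)) (at x)" if "x \<in> S" for x
    using has_derivative_transform_within_open[OF C_k_on_SucD[OF Suc.prems(2) that] assms(1) that]
      Suc.prems(1) by blast
  have e: "frechet_derivative f (at x) = frechet_derivative g (at x)" if "x \<in> S" for x
    using frechet_derivative_at[OF d[OF that]] .
  show ?case
    unfolding C_k_on.simps
  proof (intro conjI ballI allI)
    show "g differentiable at x" if "x \<in> S" for x
      using d[OF that] by (auto simp: differentiable_def)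
    show "C_k_on k (\<lambda>x. frechet_derivative g (at x) v) S" for v
      by (rule Suc.IH[of "\<lambda>x. frechet_derivative f (at x) v"]) (use e Suc.prems in auto)
  qed
qed

lemma C_k_on_SucI:
  assumes "open S" "\<And>x. x \<in> S \<Longrightarrow> (f has_derivative f' x) (at x)"
    "\<And>v. C_k_on k (\<lambda>x. f' x v) S"
  shows "C_k_on (Suc k) f S"
  unfolding C_k_on.simps
proof (intro conjI ballI allI)
  show "f differentiable at x" if "x \<in> S" for x
    using assms(2)[OF that] by (auto simp: differentiable_def)
  show "C_k_on k (\<lambda>x. frechet_derivative f (at x) v) S" for v
    by (rule C_k_on_cong[OF assms(1) _ assms(3)[of v]])
      (use frechet_derivative_at[OF assms(2)] in auto)
qed

lemma C_k_on_Suc_imp: "C_k_on (Suc k) f S \<Longrightarrow> C_k_on k f S"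
proof (induction k arbitrary: f)
  case 0
  then have "f differentiable_on S"
    by (simp add: differentiable_on_def differentiable_at_withinI)
  then show ?case by (simp add: differentiable_imp_continuous_on)
next
  case (Suc k)
  then show ?case by (metis C_k_on.simps(2))
qed

lemma C_k_on_const: "open S \<Longrightarrow> C_k_on k (\<lambda>x. c) S"
proof (induction k arbitrary: c)
  case (Suc k)
  show ?case by (rule C_k_on_SucI[where f'="\<lambda>x v. 0"]) (use Suc in auto)
qed auto

lemma C_k_on_linear: "open S \<Longrightarrow> bounded_linear L \<Longrightarrow> C_k_on k L S"
proof (cases k)
  case 0
  then show "bounded_linear L \<Longrightarrow> C_k_on k L S"
    by (simp add: linear_continuous_on)
next
  case (Suc l)
  then show "open S \<Longrightarrow> bounded_linear L \<Longrightarrow> C_k_on k L S"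
    by (auto intro!: C_k_on_SucI[where f'="\<lambda>x. L"] C_k_on_const simp del: C_k_on.simps
        intro: bounded_linear_imp_has_derivative)
qed

lemma C_k_on_add:
  assumes "open S" "C_k_on k f S" "C_k_on k g S"
  shows "C_k_on k (\<lambda>x. f x + g x) S"
  using assms(2,3)
proof (induction k arbitrary: f g)
  case 0
  then show ?case by (auto intro: continuous_on_add)
next
  case (Suc k)
  show ?case
  proof (rule C_k_on_SucI[OF assms(1)])
    show "((\<lambda>x. f x + g x) has_derivative
        (\<lambda>v. frechet_derivative f (at x) v + frechet_derivative g (at x) v)) (at x)"
      if "x \<in> S" for x
      by (rule has_derivative_add[OF C_k_on_SucD[OF Suc.prems(1) that] C_k_on_SucD[OF Suc.prems(2) that]])
    show "C_k_on k (\<lambda>x. frechet_derivative f (at x) v + frechet_derivative g (at x) v) S" for v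
      using Suc by auto
  qed
qed

lemma C_k_on_sum:
  assumes "open S" "finite I" "\<And>i. i \<in> I \<Longrightarrow> C_k_on k (f i) S"
  shows "C_k_on k (\<lambda>x. \<Sum>i\<in>I. f i x) S"
  using assms(2,3)
  by (induction I rule: finite_induct) (auto intro!: C_k_on_const C_k_on_add assms(1))

lemma C_k_on_bilinear:
  assumes "open S" "bounded_bilinear h" "C_k_on k f S" "C_k_on k g S"
  shows "C_k_on k (\<lambda>x. h (f x) (g x)) S"
  using assms(3,4)
proof (induction k arbitrary: f g)
  case 0
  then show ?case by (auto intro: bounded_bilinear.continuous_on[OF assms(2)])
next
  case (Suc k)
  show ?case
  proof (rule C_k_on_SucI[OF assms(1)])
    show "((\<lambda>x. h (f x) (g x)) has_derivative
        (\<lambda>v. h (f x) (frechet_derivative g (at x) v) + h (frechet_derivative f (at x) v) (g x)))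
        (at x)" if "x \<in> S" for x
      by (rule bounded_bilinear.FDERIV[OF assms(2) C_k_on_SucD[OF Suc.prems(1) that]
            C_k_on_SucD[OF Suc.prems(2) that]])
    have d: "C_k_on k (\<lambda>x. frechet_derivative f (at x) v) S"
        "C_k_on k (\<lambda>x. frechet_derivative g (at x) v) S" for v
      using Suc.prems by simp_all
    show "C_k_on k (\<lambda>x. h (f x) (frechet_derivative g (at x) v)
        + h (frechet_derivative f (at x) v) (g x)) S" for v
      by (rule C_k_on_add[OF assms(1) Suc.IH[OF C_k_on_Suc_imp[OF Suc.prems(1)] d(2)]
            Suc.IH[OF d(1) C_k_on_Suc_imp[OF Suc.prems(2)]]])
  qed
qed

text \<open>By the chain rule a directional derivative of a composition is a sum, over the basis, of
  products of derivatives of the inner map with derivatives of the outer one along basis vectors;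
  this brings the Leibniz rule and induction into play.\<close>

lemma C_k_on_compose:
  fixes f :: "'b::euclidean_space \<Rightarrow> 'c::euclidean_space"
  assumes "open S" "open T" "g ` S \<subseteq> T" "C_k_on k f T" "C_k_on k g S"
  shows "C_k_on k (\<lambda>x. f (g x)) S"
  using assms(4,5)
proof (induction k arbitrary: f)
  case 0
  then show ?case
    using continuous_on_compose2 assms(3) by auto
next
  case (Suc k)
  let ?f' = "\<lambda>y. frechet_derivative f (at y)" and ?g' = "\<lambda>x. frechet_derivative g (at x)"
  have gT: "g x \<in> T" if "x \<in> S" for x using assms(3) that by auto
  have expand: "?f' (g x) (?g' x v) = (\<Sum>b\<in>Basis. (?g' x v \<bullet> b) *\<^sub>R ?f' (g x) b)"
    if "x \<in> S" for x v
  proof -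
    have "linear (?f' (g x))"
      using C_k_on_SucD[OF Suc.prems(1) gT[OF that]] has_derivative_linear by blast
    then show ?thesis by (rule linear_basis_expansion)
  qed
  show ?case
  proof (rule C_k_on_SucI[OF assms(1)])
    show "((\<lambda>x. f (g x)) has_derivative (\<lambda>v. ?f' (g x) (?g' x v))) (at x)" if "x \<in> S" for x
      using has_derivative_compose[OF C_k_on_SucD[OF Suc.prems(2) that]
          C_k_on_SucD[OF Suc.prems(1) gT[OF that]]] .
    show "C_k_on k (\<lambda>x. ?f' (g x) (?g' x v)) S" for v
    proof -
      have "C_k_on k (\<lambda>x. ?g' x v) S" using Suc.prems(2) by simp
      then have 1: "C_k_on k (\<lambda>x. ?g' x v \<bullet> b) S" for b
        by (rule C_k_on_bilinear[OF assms(1) bounded_bilinear_inner _ C_k_on_const[OF assms(1)]])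
      have "C_k_on k (\<lambda>y. ?f' y b) T" for b using Suc.prems(1) by simp
      then have 2: "C_k_on k (\<lambda>x. ?f' (g x) b) S" for b
        by (rule Suc.IH[OF _ C_k_on_Suc_imp[OF Suc.prems(2)]])
      have "C_k_on k (\<lambda>x. (?g' x v \<bullet> b) *\<^sub>R ?f' (g x) b) S" for b
        by (rule C_k_on_bilinear[OF assms(1) bounded_bilinear_scaleR 1 2])
      then have "C_k_on k (\<lambda>x. \<Sum>b\<in>Basis. (?g' x v \<bullet> b) *\<^sub>R ?f' (g x) b) S"
        by (rule C_k_on_sum[OF assms(1) finite_Basis])
      then show ?thesis
        by (rule C_k_on_cong[OF assms(1), rotated]) (simp add: expand)
    qed
  qed
qed

lemma C_k_on_linear_comp:
  "open S \<Longrightarrow> bounded_linear L \<Longrightarrow> C_k_on k f S \<Longrightarrow> C_k_on k (\<lambda>x. L (f x)) S"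
  by (rule C_k_on_compose[OF _ open_UNIV _ C_k_on_linear[OF open_UNIV]]) auto

lemma C_k_on_inverse:
  fixes f :: "'a::euclidean_space \<Rightarrow> real"
  assumes "open S" "\<And>x. x \<in> S \<Longrightarrow> f x \<noteq> 0" "C_k_on k f S"
  shows "C_k_on k (\<lambda>x. inverse (f x)) S"
  using assms(3)
proof (induction k)
  case 0
  then show ?case using assms(2) by (auto intro: continuous_on_inverse)
next
  case (Suc k)
  show ?case
  proof (rule C_k_on_SucI[OF assms(1)])
    show "((\<lambda>x. inverse (f x)) has_derivative
        (\<lambda>v. - (inverse (f x) * frechet_derivative f (at x) v * inverse (f x)))) (at x)"
      if "x \<in> S" for x
      using Deriv.has_derivative_inverse[OF assms(2)[OF that] C_k_on_SucD[OF Suc.prems that]] .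
    have i: "C_k_on k (\<lambda>x. inverse (f x)) S" by (rule Suc.IH[OF C_k_on_Suc_imp[OF Suc.prems]])
    have d: "C_k_on k (\<lambda>x. frechet_derivative f (at x) v) S" for v using Suc.prems by simp
    have 1: "C_k_on k (\<lambda>x. inverse (f x) * frechet_derivative f (at x) v) S" for v
      by (rule C_k_on_bilinear[OF assms(1) bounded_bilinear_mult i d])
    have "C_k_on k (\<lambda>x. inverse (f x) * frechet_derivative f (at x) v * inverse (f x)) S" for v
      by (rule C_k_on_bilinear[OF assms(1) bounded_bilinear_mult 1 i])
    then show "C_k_on k (\<lambda>x. - (inverse (f x) * frechet_derivative f (at x) v * inverse (f x))) S"
      for v
      by (rule C_k_on_linear_comp[OF assms(1) bounded_linear_minus[OF bounded_linear_ident]])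
  qed
qed

lemma C_k_on_subset: "S \<subseteq> T \<Longrightarrow> C_k_on k f T \<Longrightarrow> C_k_on k f S"
  by (induction k arbitrary: f) (auto intro: continuous_on_subset)

lemma smooth_on_subset: "S \<subseteq> T \<Longrightarrow> smooth_on T f \<Longrightarrow> smooth_on S f"
  unfolding smooth_on_def using C_k_on_subset by blast

lemma smooth_on_const: "open S \<Longrightarrow> smooth_on S (\<lambda>x. c)"
  unfolding smooth_on_def using C_k_on_const by blast

lemma smooth_on_linear: "open S \<Longrightarrow> bounded_linear L \<Longrightarrow> smooth_on S L"
  unfolding smooth_on_def using C_k_on_linear by blast

lemma smooth_on_linear_comp:
  "open S \<Longrightarrow> bounded_linear L \<Longrightarrow> smooth_on S f \<Longrightarrow> smooth_on S (\<lambda>x. L (f x))"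
  unfolding smooth_on_def using C_k_on_linear_comp by blast

lemma smooth_on_add:
  "open S \<Longrightarrow> smooth_on S f \<Longrightarrow> smooth_on S g \<Longrightarrow> smooth_on S (\<lambda>x. f x + g x)"
  unfolding smooth_on_def using C_k_on_add by blast

lemma smooth_on_uminus: "open S \<Longrightarrow> smooth_on S f \<Longrightarrow> smooth_on S (\<lambda>x. - f x)"
  by (rule smooth_on_linear_comp) (auto intro: bounded_linear_minus bounded_linear_ident)

lemma smooth_on_diff:
  "open S \<Longrightarrow> smooth_on S f \<Longrightarrow> smooth_on S g \<Longrightarrow> smooth_on S (\<lambda>x. f x - g x)"
  using smooth_on_add[of S f "\<lambda>x. - g x"] smooth_on_uminus[of S g] by simp

lemma smooth_on_bilinear:
  "open S \<Longrightarrow> bounded_bilinear h \<Longrightarrow> smooth_on S f \<Longrightarrow> smooth_on S g \<Longrightarrow> smooth_on S (\<lambda>x. h (f x) (g x))"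
  unfolding smooth_on_def using C_k_on_bilinear by blast

lemmas smooth_on_mult = smooth_on_bilinear[OF _ bounded_bilinear_mult]
lemmas smooth_on_scaleR = smooth_on_bilinear[OF _ bounded_bilinear_scaleR]
lemmas smooth_on_inner = smooth_on_bilinear[OF _ bounded_bilinear_inner]

lemma smooth_on_compose:
  "open S \<Longrightarrow> open T \<Longrightarrow> g ` S \<subseteq> T \<Longrightarrow> smooth_on T f \<Longrightarrow> smooth_on S g \<Longrightarrow> smooth_on S (\<lambda>x. f (g x))"
  unfolding smooth_on_def using C_k_on_compose by blast

lemma smooth_on_inverse:
  fixes f :: "'a::euclidean_space \<Rightarrow> real"
  shows "open S \<Longrightarrow> (\<And>x. x \<in> S \<Longrightarrow> f x \<noteq> 0) \<Longrightarrow> smooth_on S f \<Longrightarrow> smooth_on S (\<lambda>x. inverse (f x))"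
  unfolding smooth_on_def using C_k_on_inverse by blast

lemma smooth_on_Pair:
  assumes "open S" "smooth_on S f" "smooth_on S g"
  shows "smooth_on S (\<lambda>x. (f x, g x))"
proof -
  have l: "bounded_linear (\<lambda>y. (y, 0))" "bounded_linear (\<lambda>y. (0, y))"
    by (auto intro: bounded_linear_Pair bounded_linear_ident bounded_linear_zero)
  have "smooth_on S (\<lambda>x. (f x, 0) + (0, g x))"
    by (intro smooth_on_add assms(1) smooth_on_linear_comp[OF assms(1) l(1) assms(2)]
        smooth_on_linear_comp[OF assms(1) l(2) assms(3)])
  then show ?thesis by simp
qed

lemma smooth_on_has_derivative:
  "smooth_on S f \<Longrightarrow> x \<in> S \<Longrightarrow> (f has_derivative frechet_derivative f (at x)) (at x)"
  unfolding smooth_on_def using C_k_on_SucD by blast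

lemma smooth_on_derivative: "smooth_on S f \<Longrightarrow> smooth_on S (\<lambda>x. frechet_derivative f (at x) v)"
  unfolding smooth_on_def using C_k_on.simps(2) by blast

lemma smooth_on_continuous: "smooth_on S f \<Longrightarrow> continuous_on S f"
  unfolding smooth_on_def using C_k_on.simps(1) by blast

text \<open>Smoothness is a statement about directional derivatives; those along the finitely many basis
  vectors bound the whole derivative.\<close>

lemma smooth_on_derivative_bound:
  fixes f :: "'a::euclidean_space \<Rightarrow> 'b::euclidean_space"
  assumes "smooth_on S f" "compact K" "K \<subseteq> S"
  shows "\<exists>L\<ge>0. \<forall>x\<in>K. \<forall>v. norm (frechet_derivative f (at x) v) \<le> L * norm v"
proof -
  let ?D = "\<lambda>x. frechet_derivative f (at x)"
  have "\<exists>M\<ge>0. \<forall>x\<in>K. norm (?D x b) \<le> M" for b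
  proof -
    have "compact ((\<lambda>x. ?D x b) ` K)"
      using smooth_on_continuous[OF smooth_on_derivative[OF assms(1)]] assms(2,3)
      by (meson compact_continuous_image continuous_on_subset)
    then show ?thesis by (rule compact_norm_bound) (meson imageI less_imp_le)
  qed
  then obtain M where M: "\<And>b. M b \<ge> 0" "\<And>b x. x \<in> K \<Longrightarrow> norm (?D x b) \<le> M b" by metis
  show ?thesis
  proof (intro exI[of _ "\<Sum>b\<in>Basis. M b"] conjI ballI allI)
    show "0 \<le> (\<Sum>b\<in>Basis. M b)" by (simp add: M sum_nonneg)
    fix x v assume x: "x \<in> K"
    have "linear (?D x)"
      using smooth_on_has_derivative[OF assms(1)] x assms(3) has_derivative_linear by blast
    then have "?D x v = (\<Sum>b\<in>Basis. (v \<bullet> b) *\<^sub>R ?D x b)" by (rule linear_basis_expansion)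
    also have "norm \<dots> \<le> (\<Sum>b\<in>Basis. norm v * M b)"
      by (intro sum_norm_le) (auto intro!: mult_mono M x Basis_le_norm)
    finally show "norm (?D x v) \<le> (\<Sum>b\<in>Basis. M b) * norm v"
      by (simp add: sum_distrib_left mult.commute)
  qed
qed

text \<open>The compact set need not be convex: only the segment between the two points must lie in it.\<close>

lemma smooth_on_lipschitz_segment:
  fixes f :: "'a::euclidean_space \<Rightarrow> 'b::euclidean_space"
  assumes "smooth_on S f" "compact K" "K \<subseteq> S"
  shows "\<exists>L\<ge>0. \<forall>x y. closed_segment x y \<subseteq> K \<longrightarrow> norm (f y - f x) \<le> L * norm (y - x)"
proof -
  obtain L where L: "L \<ge> 0" "\<And>x v. x \<in> K \<Longrightarrow> norm (frechet_derivative f (at x) v) \<le> L * norm v"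
    using smooth_on_derivative_bound[OF assms] by blast
  have "norm (f y - f x) \<le> L * norm (y - x)" if "closed_segment x y \<subseteq> K" for x y
  proof (rule differentiable_bound[OF convex_closed_segment])
    show "(f has_derivative frechet_derivative f (at z)) (at z within closed_segment x y)"
      if "z \<in> closed_segment x y" for z
      using smooth_on_has_derivative[OF assms(1)] that \<open>closed_segment x y \<subseteq> K\<close> assms(3)
      by (meson has_derivative_at_withinI subsetD)
    show "onorm (frechet_derivative f (at z)) \<le> L" if "z \<in> closed_segment x y" for z
      using L that \<open>closed_segment x y \<subseteq> K\<close> by (intro onorm_le) auto
  qed auto
  then show ?thesis using L(1) by blast
qed

lemma smooth_on_taylor_segment:
  fixes f :: "'a::euclidean_space \<Rightarrow> 'b::euclidean_space"
  assumes "smooth_on S f" "compact K" "K \<subseteq> S"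
  shows "\<exists>L\<ge>0. \<forall>x y. closed_segment x y \<subseteq> K \<longrightarrow>
    norm (f y - f x - frechet_derivative f (at x) (y - x)) \<le> L * (norm (y - x))\<^sup>2"
proof -
  let ?D = "\<lambda>x. frechet_derivative f (at x)"
  have "\<exists>L\<ge>0. \<forall>x y. closed_segment x y \<subseteq> K \<longrightarrow> norm (?D y b - ?D x b) \<le> L * norm (y - x)" for b
    by (rule smooth_on_lipschitz_segment[OF smooth_on_derivative[OF assms(1)] assms(2,3)])
  then obtain M where M: "\<And>b. M b \<ge> 0" "\<And>b x y. closed_segment x y \<subseteq> K \<Longrightarrow>
      norm (?D y b - ?D x b) \<le> M b * norm (y - x)" by metis
  let ?L = "\<Sum>b\<in>Basis. M b"
  have L0: "?L \<ge> 0" by (simp add: M sum_nonneg)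
  have lin: "linear (?D x)" if "x \<in> K" for x
    using smooth_on_has_derivative[OF assms(1)] that assms(3) has_derivative_linear by blast
  have D: "norm (?D y v - ?D x v) \<le> ?L * norm (y - x) * norm v"
    if sub: "closed_segment x y \<subseteq> K" for x y v
  proof -
    note e = linear_basis_expansion[OF lin]
    have xK: "x \<in> K" and yK: "y \<in> K" using sub by auto
    have "?D y v - ?D x v = (\<Sum>b\<in>Basis. (v \<bullet> b) *\<^sub>R (?D y b - ?D x b))"
      using e[OF xK, of v] e[OF yK, of v]
      by (simp add: sum_subtractf scaleR_diff_right)
    also have "norm \<dots> \<le> (\<Sum>b\<in>Basis. norm v * (M b * norm (y - x)))"
      by (intro sum_norm_le) (auto intro!: mult_mono M sub Basis_le_norm)
    also have "\<dots> = ?L * norm (y - x) * norm v"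
      by (simp add: sum_distrib_left sum_distrib_right mult_ac)
    finally show ?thesis .
  qed
  have "norm (f y - f x - ?D x (y - x)) \<le> ?L * (norm (y - x))\<^sup>2"
    if sub: "closed_segment x y \<subseteq> K" for x y
  proof -
    let ?g = "\<lambda>z. f z - ?D x z"
    have "norm (?g y - ?g x) \<le> (?L * norm (y - x)) * norm (y - x)"
    proof (rule differentiable_bound[OF convex_closed_segment])
      fix z assume z: "z \<in> closed_segment x y"
      have xK: "x \<in> K" using sub by auto
      have zK: "z \<in> S" using sub z assms(3) by auto
      show "(?g has_derivative (\<lambda>v. ?D z v - ?D x v)) (at z within closed_segment x y)"
        by (intro has_derivative_diff has_derivative_at_withinI[OF smooth_on_has_derivative[OF assms(1) zK]]
            bounded_linear_imp_has_derivative linear_conv_bounded_linear[THEN iffD1] lin xK)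
      have szy: "closed_segment x z \<subseteq> K"
        using z sub by (meson ends_in_segment(1) order_trans subset_closed_segment)
      have nz: "norm (z - x) \<le> norm (y - x)"
        using z by (metis norm_minus_commute segment_bound(1) )
      show "onorm (\<lambda>v. ?D z v - ?D x v) \<le> ?L * norm (y - x)"
        using L0 nz by (intro onorm_le order_trans[OF D[OF szy]] mult_right_mono mult_left_mono) auto
    qed auto
    moreover have "?g y - ?g x = f y - f x - ?D x (y - x)"
      using linear_diff[OF lin, of x y x] sub by auto
    ultimately show ?thesis by (simp add: power2_eq_square mult.assoc)
  qed
  then show ?thesis using L0 by blast
qed

section \<open>Ordinary differential equations\<close>

definition ode_sol :: "('a::euclidean_space \<Rightarrow> 'a) \<Rightarrow> (real \<Rightarrow> 'a) \<Rightarrow> real \<Rightarrow> bool" where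
  "ode_sol V u T \<longleftrightarrow>
     (\<forall>s\<in>{0..T}. (u has_vector_derivative V (u s)) (at s within {0..T}))"

definition lipschitz_on_balls :: "('a::euclidean_space \<Rightarrow> 'b::euclidean_space) \<Rightarrow> bool" where
  "lipschitz_on_balls V \<longleftrightarrow>
     (\<forall>r. \<exists>L. \<forall>x\<in>cball 0 r. \<forall>y\<in>cball 0 r. norm (V x - V y) \<le> L * norm (x - y))"

lemma ode_sol_restrict: "ode_sol V u T \<Longrightarrow> T' \<le> T \<Longrightarrow> ode_sol V u T'"
  unfolding ode_sol_def
  by (intro ballI has_vector_derivative_within_subset[where S="{0..T}" and T="{0..T'}"]) auto

lemma ode_sol_continuous: "ode_sol V u T \<Longrightarrow> continuous_on {0..T} u"
  unfolding ode_sol_def continuous_on_eq_continuous_within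
  using has_vector_derivative_continuous by blast

lemma smooth_imp_lipschitz_on_balls: "smooth_on UNIV V \<Longrightarrow> lipschitz_on_balls V"
  unfolding lipschitz_on_balls_def
proof
  fix r assume "smooth_on UNIV V"
  then obtain L where L: "\<forall>x y. closed_segment x y \<subseteq> cball 0 r \<longrightarrow> norm (V y - V x) \<le> L * norm (y - x)"
    using smooth_on_lipschitz_segment[of UNIV V "cball 0 r"] by auto
  have "norm (V x - V y) \<le> L * norm (x - y)" if "x \<in> cball 0 r" "y \<in> cball 0 r" for x y
    using L[rule_format, of y x] closed_segment_subset[OF that(2,1) convex_cball] by simp
  then show "\<exists>L. \<forall>x\<in>cball 0 r. \<forall>y\<in>cball 0 r. norm (V x - V y) \<le> L * norm (x - y)" by blast
qed

text \<open>This turns an a priori estimate into confinement: at the first time at which the curve could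
  leave \<open>D\<close> the estimate still applies and puts it into the open set \<open>D'\<close>.\<close>

lemma curve_confined:
  fixes u :: "real \<Rightarrow> 'a::metric_space"
  assumes cont: "continuous_on {0..T} u" and u0: "u 0 \<in> D" and D: "closed D" "open D'" "D' \<subseteq> D"
    and step: "\<And>t. t \<in> {0..T} \<Longrightarrow> \<forall>s\<in>{0..t}. u s \<in> D \<Longrightarrow> u t \<in> D'"
  shows "\<forall>t\<in>{0..T}. u t \<in> D"
proof (rule ccontr)
  assume neg: "\<not> ?thesis"
  define A where "A = {t \<in> {0..T}. u t \<notin> D}"
  then have "A \<noteq> {}" using neg by auto
  have bdd: "bdd_below A" by (rule bdd_belowI[of _ 0]) (auto simp: A_def)
  define i where "i = Inf A"
  have "0 \<le> i"
    unfolding i_def by (rule cInf_greatest[OF \<open>A \<noteq> {}\<close>]) (auto simp: A_def)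
  moreover obtain a where a: "a \<in> A" using \<open>A \<noteq> {}\<close> by blast
  then have "i \<le> a" unfolding i_def by (rule cInf_lower[OF _ bdd])
  ultimately have iT: "0 \<le> i" "i \<le> T" using a unfolding A_def by auto
  have low: "u s \<in> D" if "s \<in> {0..T}" "s < i" for s
    using cInf_lower[OF _ bdd, of s] that unfolding i_def A_def by fastforce
  have pre: "\<exists>e>0. \<forall>s\<in>{0..T}. \<bar>s - i\<bar> < e \<longrightarrow> u s \<in> W" if "open W" "u i \<in> W" for W
  proof -
    obtain e where "e > 0" "ball (u i) e \<subseteq> W" using openE[OF \<open>open W\<close> \<open>u i \<in> W\<close>] by blast
    moreover obtain d where "d > 0" "\<forall>s\<in>{0..T}. dist s i < d \<longrightarrow> dist (u s) (u i) < e"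
      using cont iT \<open>e > 0\<close> unfolding continuous_on_iff by (meson atLeastAtMost_iff)
    ultimately show ?thesis
      by (intro exI[of _ d]) (auto simp: dist_real_def dist_commute subset_iff)
  qed
  have "u i \<in> D"
  proof (rule ccontr)
    assume "u i \<notin> D"
    then obtain e where e: "e > 0" "\<forall>s\<in>{0..T}. \<bar>s - i\<bar> < e \<longrightarrow> u s \<in> - D"
      using pre[of "- D"] D(1) by auto
    have "i > 0" using iT u0 \<open>u i \<notin> D\<close> by (cases "i = 0") auto
    then have "max 0 (i - e / 2) \<in> {0..T}" "max 0 (i - e / 2) < i" "\<bar>max 0 (i - e / 2) - i\<bar> < e"
      using e(1) iT by auto
    then show False using low e(2) by blast
  qed
  then have "u i \<in> D'" using step[of i] low iT by (metis atLeastAtMost_iff order_le_less order_trans)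
  then obtain e where e: "e > 0" "\<forall>s\<in>{0..T}. \<bar>s - i\<bar> < e \<longrightarrow> u s \<in> D'"
    using pre[of D'] D(2) by auto
  obtain t where t: "t \<in> A" "t < i + e"
    using cInf_less_iff[OF \<open>A \<noteq> {}\<close> bdd, of "i + e"] e(1) unfolding i_def by auto
  then have "i \<le> t" using cInf_lower[OF _ bdd] unfolding i_def by auto
  then have "u t \<in> D'" using t e(2) unfolding A_def by auto
  then show False using t(1) D(3) unfolding A_def by auto
qed

text \<open>Picard iteration; the weight \<open>exp (2 * L * t)\<close> makes the iteration map a contraction with
  factor \<open>1/2\<close> on a time interval of any length.\<close>

lemma global_lipschitz_ode_sol:
  fixes V :: "'a::euclidean_space \<Rightarrow> 'a"
  assumes "L > 0" and lip: "\<And>x y. norm (V x - V y) \<le> L * norm (x - y)" and "T \<ge> 0"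
  shows "\<exists>u. u 0 = x0 \<and> ode_sol V u T"
proof -
  have contV: "continuous_on UNIV V"
    unfolding continuous_on_iff
  proof (intro ballI allI impI)
    fix x e assume "e > (0::real)"
    show "\<exists>d>0. \<forall>x'\<in>UNIV. dist x' x < d \<longrightarrow> dist (V x') (V x) < e"
    proof (intro exI[of _ "e / L"] conjI ballI impI)
      show "e / L > 0" using assms(1) \<open>e > 0\<close> by simp
      fix x' assume "dist x' x < e / L"
      then have "L * norm (x' - x) < e" using assms(1) by (simp add: dist_norm field_simps)
      then show "dist (V x') (V x) < e" using lip[of x' x] by (simp add: dist_norm)
    qed
  qed
  define U :: "nat \<Rightarrow> real \<Rightarrow> 'a" where "U = rec_nat (\<lambda>t. x0) (\<lambda>n v t. x0 + integral {0..t} (\<lambda>s. V (v s)))"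
  have U0: "U 0 t = x0" and US: "U (Suc n) t = x0 + integral {0..t} (\<lambda>s. V (U n s))" for n t
    unfolding U_def by simp_all
  have contU: "continuous_on {0..T} (U n)" for n
  proof (induction n)
    case 0
    have "U 0 = (\<lambda>t. x0)" using U0 by auto
    then show ?case by simp
  next
    case (Suc n)
    have "(\<lambda>s. V (U n s)) integrable_on {0..T}"
      by (intro integrable_continuous_real continuous_on_compose2[OF contV Suc]) auto
    then have "continuous_on {0..T} (\<lambda>t. x0 + integral {0..t} (\<lambda>s. V (U n s)))"
      by (intro continuous_intros indefinite_integral_continuous_1)
    moreover have "U (Suc n) = (\<lambda>t. x0 + integral {0..t} (\<lambda>s. V (U n s)))" using US by auto
    ultimately show ?case by simp
  qed
  have contVU: "continuous_on {0..T} (\<lambda>s. V (U n s))" for n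
    by (intro continuous_on_compose2[OF contV contU]) auto
  have intVU: "(\<lambda>s. V (U n s)) integrable_on {0..t}" if "t \<le> T" for n t
    by (intro integrable_continuous_real continuous_on_subset[OF contVU]) (use that in auto)
  obtain c where c: "c > 0" "\<And>t. t \<in> {0..T} \<Longrightarrow> norm (U 1 t - U 0 t) \<le> c"
  proof -
    have "compact ((\<lambda>t. U 1 t - U 0 t) ` {0..T})"
      by (intro compact_continuous_image continuous_intros contU compact_Icc)
    then show ?thesis by (rule compact_norm_bound) (use that in blast)
  qed
  have expint: "((\<lambda>s. L * (k * exp (2 * L * s))) has_integral (k / 2 * exp (2 * L * t) - k / 2)) {0..t}"
    if "t \<ge> 0" for k t
  proof -
    have "((\<lambda>s. k / 2 * exp (2 * L * s)) has_vector_derivative L * (k * exp (2 * L * s))) (at s within {0..t})"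
      for s unfolding has_real_derivative_iff_has_vector_derivative[symmetric]
      by (auto intro!: derivative_eq_intros)
    from fundamental_theorem_of_calculus[OF that this] show ?thesis by simp
  qed
  have step: "norm (U (Suc n) t - U n t) \<le> c * (1/2)^n * exp (2 * L * t)" if "t \<in> {0..T}" for n t
    using that
  proof (induction n arbitrary: t)
    case 0
    have "norm (U 1 t - U 0 t) \<le> c * 1" using c(2) 0 by auto
    also have "\<dots> \<le> c * exp (2 * L * t)"
      using c(1) 0 assms(1) by (intro mult_left_mono) auto
    finally show ?case by simp
  next
    case (Suc n)
    let ?k = "c * (1/2)^n"
    have tT: "t \<le> T" using Suc.prems by simp
    have "U (Suc (Suc n)) t - U (Suc n) t = integral {0..t} (\<lambda>s. V (U (Suc n) s) - V (U n s))"
      unfolding US[of "Suc n" t] US[of n t]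
      using Henstock_Kurzweil_Integration.integral_diff[OF intVU[OF tT, of "Suc n"] intVU[OF tT, of n]]
      by simp
    also have "norm \<dots> \<le> integral {0..t} (\<lambda>s. L * (?k * exp (2 * L * s)))"
    proof (rule Henstock_Kurzweil_Integration.integral_norm_bound_integral)
      show "(\<lambda>s. V (U (Suc n) s) - V (U n s)) integrable_on {0..t}"
        using intVU Suc.prems by (intro integrable_diff) auto
      show "(\<lambda>s. L * (?k * exp (2 * L * s))) integrable_on {0..t}"
        using expint[of t ?k] Suc.prems by auto
      fix s assume s: "s \<in> {0..t}"
      have "norm (V (U (Suc n) s) - V (U n s)) \<le> L * norm (U (Suc n) s - U n s)" by (rule lip)
      also have "\<dots> \<le> L * (?k * exp (2 * L * s))"
        using Suc s assms(1) by (intro mult_left_mono) auto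
      finally show "norm (V (U (Suc n) s) - V (U n s)) \<le> L * (?k * exp (2 * L * s))" .
    qed
    also have "\<dots> = ?k / 2 * exp (2 * L * t) - ?k / 2"
      by (rule integral_unique[OF expint]) (use Suc.prems in simp)
    also have "\<dots> \<le> c * (1/2)^(Suc n) * exp (2 * L * t)" using c(1) by simp
    finally show ?case .
  qed
  define u where "u t = x0 + (\<Sum>n. U (Suc n) t - U n t)" for t
  have tele: "(\<Sum>i<n. U (Suc i) t - U i t) = U n t - x0" for n t
    by (induction n) (auto simp: U0)
  have lim: "uniform_limit {0..T} U u sequentially"
  proof -
    have "uniform_limit {0..T} (\<lambda>n t. \<Sum>i<n. U (Suc i) t - U i t) (\<lambda>t. \<Sum>i. U (Suc i) t - U i t) sequentially"
    proof (rule Weierstrass_m_test)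
      show "norm (U (Suc n) t - U n t) \<le> c * exp (2 * L * T) * (1/2)^n" if "t \<in> {0..T}" for n t
      proof -
        have "c * (1/2)^n * exp (2 * L * t) \<le> c * (1/2)^n * exp (2 * L * T)"
          using that assms(1) c(1) by (intro mult_left_mono) auto
        then show ?thesis using step[OF that, of n] by (simp add: mult_ac)
      qed
      show "summable (\<lambda>n. c * exp (2 * L * T) * (1/2)^n)"
        by (intro summable_mult summable_geometric) auto
    qed
    then have "uniform_limit {0..T} (\<lambda>n t. x0 + (\<Sum>i<n. U (Suc i) t - U i t)) u sequentially"
      unfolding u_def by (intro uniform_limit_intros)
    then show ?thesis by (simp add: tele)
  qed
  have contu: "continuous_on {0..T} u"
    by (rule uniform_limit_theorem[OF _ lim]) (auto simp: contU)
  have limV: "uniform_limit {0..t} (\<lambda>n s. V (U n s)) (\<lambda>s. V (u s)) sequentially" if "t \<in> {0..T}" for t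
  proof (rule uniform_limitI)
    fix e :: real assume "e > 0"
    have "\<forall>\<^sub>F n in sequentially. \<forall>s\<in>{0..T}. dist (U n s) (u s) < e / L"
      using lim assms(1) \<open>e > 0\<close> by (intro uniform_limitD) auto
    then show "\<forall>\<^sub>F n in sequentially. \<forall>s\<in>{0..t}. dist (V (U n s)) (V (u s)) < e"
    proof (rule eventually_mono, intro ballI)
      fix n s assume a: "\<forall>s\<in>{0..T}. dist (U n s) (u s) < e / L" and "s \<in> {0..t}"
      then have "L * dist (U n s) (u s) < e" using \<open>t \<in> {0..T}\<close> assms(1)
        by (auto simp: field_simps)
      then show "dist (V (U n s)) (V (u s)) < e" using lip[of "U n s" "u s"] by (simp add: dist_norm)
    qed
  qed
  have contVu: "continuous_on {0..T} (\<lambda>s. V (u s))"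
    by (intro continuous_on_compose2[OF contV contu]) auto
  have fix_pt: "u t = x0 + integral {0..t} (\<lambda>s. V (u s))" if "t \<in> {0..T}" for t
  proof (rule LIMSEQ_unique)
    show "(\<lambda>n. U (Suc n) t) \<longlonglongrightarrow> u t"
      using tendsto_uniform_limitI[OF lim that] by (rule LIMSEQ_Suc)
    have "(\<lambda>n. integral {0..t} (\<lambda>s. V (U n s))) \<longlonglongrightarrow> integral {0..t} (\<lambda>s. V (u s))"
    proof -
      have c: "continuous_on (cbox 0 t) (\<lambda>s. V (U n s))" for n
        using continuous_on_subset[OF contVU] that by simp
      have l: "uniform_limit (cbox 0 t) (\<lambda>n s. V (U n s)) (\<lambda>s. V (u s)) sequentially"
        using limV[OF that] by simp
      obtain I J where I: "\<And>n. ((\<lambda>s. V (U n s)) has_integral I n) (cbox 0 t)"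
        "((\<lambda>s. V (u s)) has_integral J) (cbox 0 t)" "I \<longlonglongrightarrow> J"
        by (rule uniform_limit_integral_cbox[OF l c trivial_limit_sequentially]) blast
      have "I n = integral {0..t} (\<lambda>s. V (U n s))" for n
        using integral_unique[OF I(1)[of n]] by simp
      moreover have "J = integral {0..t} (\<lambda>s. V (u s))"
        using integral_unique[OF I(2)] by simp
      ultimately show ?thesis using I(3) by presburger
    qed
    then show "(\<lambda>n. U (Suc n) t) \<longlonglongrightarrow> x0 + integral {0..t} (\<lambda>s. V (u s))"
      unfolding US by (intro tendsto_intros)
  qed
  have "ode_sol V u T"
    unfolding ode_sol_def
  proof
    fix s assume s: "s \<in> {0..T}"
    have "((\<lambda>t. x0 + integral {0..t} (\<lambda>s. V (u s))) has_vector_derivative 0 + V (u s)) (at s within {0..T})"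
      by (intro has_vector_derivative_add has_vector_derivative_const
          integral_has_vector_derivative[OF contVu s])
    then show "(u has_vector_derivative V (u s)) (at s within {0..T})"
      using has_vector_derivative_transform[OF s fix_pt] by simp
  qed
  moreover have "u 0 = x0" using fix_pt[of 0] assms(3) by simp
  ultimately show ?thesis by blast
qed

text \<open>Outside a ball containing \<open>D\<close> the field is replaced by its value at the nearest point of the
  ball. This makes it globally Lipschitz, and a confined solution never notices the change.\<close>

lemma confined_ode_sol:
  fixes V :: "'a::euclidean_space \<Rightarrow> 'a"
  assumes lip: "lipschitz_on_balls V" and "T \<ge> 0"
    and D: "compact D" "open D'" "D' \<subseteq> D" and x0: "x0 \<in> D"
    and step: "\<And>u t. u 0 = x0 \<Longrightarrow> t \<in> {0..T} \<Longrightarrow> ode_sol V u t \<Longrightarrow> \<forall>s\<in>{0..t}. u s \<in> D \<Longrightarrow> u t \<in> D'"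
  shows "\<exists>u. u 0 = x0 \<and> ode_sol V u T \<and> (\<forall>s\<in>{0..T}. u s \<in> D)"
proof -
  obtain r where "r > 0" "\<And>x. x \<in> D \<Longrightarrow> norm x \<le> r" using compact_norm_bound[OF D(1)] by blast
  then have r: "r > 0" "D \<subseteq> cball 0 r" by auto
  obtain L0 where L0: "\<And>x y. x \<in> cball 0 r \<Longrightarrow> y \<in> cball 0 r \<Longrightarrow> norm (V x - V y) \<le> L0 * norm (x - y)"
    using lip unfolding lipschitz_on_balls_def by meson
  define L where "L = max L0 1"
  define P where "P = closest_point (cball (0::'a) r)"
  have ne: "cball (0::'a) r \<noteq> {}" using r by auto
  have P: "P x \<in> cball 0 r" for x
    unfolding P_def by (rule closest_point_in_set[OF closed_cball ne])
  have "norm (V (P x) - V (P y)) \<le> L * norm (x - y)" for x y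
  proof -
    have "norm (V (P x) - V (P y)) \<le> L0 * norm (P x - P y)" by (rule L0[OF P P])
    also have "\<dots> \<le> L * norm (P x - P y)" unfolding L_def by (intro mult_right_mono) auto
    also have "\<dots> \<le> L * norm (x - y)"
      using closest_point_lipschitz[OF convex_cball closed_cball ne, of x y]
      unfolding P_def L_def dist_norm by (intro mult_left_mono) auto
    finally show ?thesis .
  qed
  moreover have "L > 0" unfolding L_def by simp
  ultimately obtain u where u: "u 0 = x0" "ode_sol (\<lambda>x. V (P x)) u T"
    using global_lipschitz_ode_sol[of L "\<lambda>x. V (P x)" T x0] assms(2) by blast
  have agree: "ode_sol V u t" if "t \<le> T" "\<forall>s\<in>{0..t}. u s \<in> D" for t
  proof -
    have "P (u s) = u s" if "s \<in> {0..t}" for s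
      unfolding P_def by (rule closest_point_self) (use that \<open>\<forall>s\<in>{0..t}. u s \<in> D\<close> r(2) in blast)
    then show ?thesis using ode_sol_restrict[OF u(2) \<open>t \<le> T\<close>] unfolding ode_sol_def by auto
  qed
  have "\<forall>t\<in>{0..T}. u t \<in> D"
  proof (rule curve_confined[OF ode_sol_continuous[OF u(2)] _ compact_imp_closed[OF D(1)] D(2,3)])
    show "u 0 \<in> D" using u x0 by simp
    show "u t \<in> D'" if "t \<in> {0..T}" "\<forall>s\<in>{0..t}. u s \<in> D" for t
      using step[OF u(1) that(1) agree that(2)] that by auto
  qed
  then show ?thesis using u(1) agree[of T] by auto
qed

lemma real_mvt:
  fixes g :: "real \<Rightarrow> real"
  assumes "T \<ge> 0" "\<And>s. s \<in> {0..T} \<Longrightarrow> (g has_vector_derivative g' s) (at s within {0..T})"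
  obtains s where "s \<in> {0..T}" "g T - g 0 = T * g' s"
proof (cases "T = 0")
  case True
  then show ?thesis using that[of 0] by simp
next
  case False
  have "\<exists>s\<in>{0<..<T}. g T - g 0 = (\<lambda>h. h *\<^sub>R g' s) (T - 0)"
    using mvt_simple[of 0 T g "\<lambda>s h. h *\<^sub>R g' s"] False assms
    unfolding has_vector_derivative_def by auto
  then obtain s where "s \<in> {0<..<T}" "g T - g 0 = T * g' s" by auto
  then show ?thesis by (intro that[of s]) auto
qed

lemma real_mvt_increment:
  fixes g :: "real \<Rightarrow> real"
  assumes T: "T \<ge> 0" and g: "\<And>s. s \<in> {0..T} \<Longrightarrow> (g has_vector_derivative g' s) (at s within {0..T})"
    and g': "\<And>s. s \<in> {0..T} \<Longrightarrow> \<bar>g' s\<bar> \<le> c"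
  shows "\<bar>g T - g 0\<bar> \<le> c * T"
proof -
  obtain s where s: "s \<in> {0..T}" "g T - g 0 = T * g' s" using real_mvt[OF T g] by blast
  then show ?thesis using mult_left_mono[OF g'[OF s(1)] T] T by (simp add: abs_mult mult.commute)
qed

text \<open>The weight \<open>exp (- 2 * L * s)\<close> makes the squared distance of two solutions non-increasing.\<close>

lemma ode_sol_unique:
  fixes V :: "'a::euclidean_space \<Rightarrow> 'a"
  assumes lip: "lipschitz_on_balls V" and u: "ode_sol V u T" and v: "ode_sol V v T"
    and eq: "u 0 = v 0" and "T \<ge> 0"
  shows "u T = v T"
proof -
  have "compact (u ` {0..T} \<union> v ` {0..T})"
    by (intro compact_Un compact_continuous_image ode_sol_continuous[OF u]
        ode_sol_continuous[OF v] compact_Icc)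
  then obtain r where "\<And>y. y \<in> u ` {0..T} \<union> v ` {0..T} \<Longrightarrow> norm y \<le> r"
    by (rule compact_norm_bound) blast
  then have r: "u ` {0..T} \<union> v ` {0..T} \<subseteq> cball 0 r" by auto
  obtain L where L: "\<And>x y. x \<in> cball 0 r \<Longrightarrow> y \<in> cball 0 r \<Longrightarrow> norm (V x - V y) \<le> L * norm (x - y)"
    using lip unfolding lipschitz_on_balls_def by meson
  define d where "d s = u s - v s" for s
  define g where "g s = exp (- (2 * L * s)) * (d s \<bullet> d s)" for s
  define g' where "g' s = exp (- (2 * L * s)) * (2 * (d s \<bullet> (V (u s) - V (v s)))) +
      (- (2 * L)) * exp (- (2 * L * s)) * (d s \<bullet> d s)" for s
  have der: "(g has_vector_derivative g' s) (at s within {0..T})" if "s \<in> {0..T}" for s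
  proof -
    have 1: "(d has_vector_derivative V (u s) - V (v s)) (at s within {0..T})"
      unfolding d_def using u v that unfolding ode_sol_def by (intro has_vector_derivative_diff) auto
    have 2: "((\<lambda>s. d s \<bullet> d s) has_vector_derivative
        d s \<bullet> (V (u s) - V (v s)) + (V (u s) - V (v s)) \<bullet> d s) (at s within {0..T})"
      by (rule bounded_bilinear.has_vector_derivative[OF bounded_bilinear_inner 1 1])
    have 3: "((\<lambda>s. exp (- (2 * L * s))) has_vector_derivative (- (2 * L)) * exp (- (2 * L * s)))
        (at s within {0..T})"
      unfolding has_real_derivative_iff_has_vector_derivative[symmetric]
      by (auto intro!: derivative_eq_intros)
    show ?thesis
      using has_vector_derivative_mult[OF 3 2] unfolding g_def g'_def
      by (simp add: inner_commute)
  qed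
  have nonpos: "g' s \<le> 0" if "s \<in> {0..T}" for s
  proof -
    have uv: "u s \<in> cball 0 r" "v s \<in> cball 0 r" using r that by blast+
    have "d s \<bullet> (V (u s) - V (v s)) \<le> norm (d s) * norm (V (u s) - V (v s))"
      by (rule norm_cauchy_schwarz)
    also have "\<dots> \<le> norm (d s) * (L * norm (d s))"
      unfolding d_def by (intro mult_left_mono L uv norm_ge_zero)
    also have "\<dots> = L * (d s \<bullet> d s)" by (simp add: dot_square_norm power2_eq_square)
    finally have "exp (- (2 * L * s)) * (2 * (d s \<bullet> (V (u s) - V (v s)))) \<le>
      exp (- (2 * L * s)) * (2 * (L * (d s \<bullet> d s)))" by (intro mult_left_mono) auto
    then show ?thesis unfolding g'_def by (simp add: mult_ac)
  qed
  obtain s where s: "s \<in> {0..T}" "g T - g 0 = T * g' s" using real_mvt[OF \<open>T \<ge> 0\<close> der] by blast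
  then have "g T \<le> g 0" using nonpos[OF s(1)] \<open>T \<ge> 0\<close> mult_nonneg_nonpos[of T "g' s"] by simp
  also have "g 0 = 0" unfolding g_def d_def using eq by simp
  finally have "d T \<bullet> d T \<le> 0" unfolding g_def by (simp add: mult_le_0_iff)
  then have "d T = 0" using inner_ge_zero[of "d T"] by (simp add: order_antisym_conv)
  then show ?thesis unfolding d_def by simp
qed

section \<open>Hamiltonian vector fields in phase space and in the model\<close>

lemma vec2_eq: "v = (v $ 1) *\<^sub>R axis 1 1 + (v $ 2) *\<^sub>R axis 2 (1::real)" for v :: "real^2"
  by (simp add: vec_eq_iff forall_2 axis_def)

text \<open>The symplectic form characterises the Hamiltonian field, and this description, unlike the
  one in coordinates, can be carried through a symplectic map.\<close>

lemma omega_ham_field: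
  assumes "(H has_derivative D) (at x)"
  shows "omega_phase (ham_field H x) u = - D u"
proof -
  have D: "frechet_derivative H (at x) = D" using frechet_derivative_at[OF assms] by simp
  have lin: "linear D" using assms has_derivative_linear by blast
  have "u = (fst u $ 1) *\<^sub>R (axis 1 1, 0) + (fst u $ 2) *\<^sub>R (axis 2 1, 0) +
      ((snd u $ 1) *\<^sub>R (0, axis 1 1) + (snd u $ 2) *\<^sub>R (0, axis 2 1))"
    using vec2_eq[of "fst u"] vec2_eq[of "snd u"] by (simp add: prod_eq_iff)
  then have "D u = D ((fst u $ 1) *\<^sub>R (axis 1 1, 0) + (fst u $ 2) *\<^sub>R (axis 2 1, 0) +
      ((snd u $ 1) *\<^sub>R (0, axis 1 1) + (snd u $ 2) *\<^sub>R (0, axis 2 1)))" by (rule arg_cong)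
  also have "\<dots> = fst u $ 1 * D (axis 1 1, 0) + fst u $ 2 * D (axis 2 1, 0) +
      (snd u $ 1 * D (0, axis 1 1) + snd u $ 2 * D (0, axis 2 1))"
    by (simp only: linear_add[OF lin] linear_scale[OF lin] real_scaleR_def)
  finally show ?thesis
    unfolding omega_phase_def ham_field_def D by (simp add: inner_vec_def sum_2 algebra_simps)
qed

lemma omega_phase_diff: "omega_phase (u - u') v = omega_phase u v - omega_phase u' v"
  by (simp add: omega_phase_def algebra_simps inner_diff_left inner_diff_right)

lemma omega_model_diff: "omega_model (u - u') v = omega_model u v - omega_model u' v"
  by (simp add: omega_model_def algebra_simps)

lemma omega_phase_nondegenerate:
  assumes "\<And>u. omega_phase X u = omega_phase Y u"
  shows "X = Y"
proof -
  define d where "d = X - Y"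
  have "omega_phase d (snd d, - fst d) = 0" using assms by (simp add: d_def omega_phase_diff)
  then have "d \<bullet> d = 0" by (simp add: omega_phase_def inner_prod_def add.commute)
  then show ?thesis by (simp add: d_def)
qed

text \<open>The form pairs a vector \<open>d\<close> with a rotated copy of it, of the same length, to the square of
  its length; hence a vector is no longer than the functional that it represents.\<close>

lemma norm_le_omega_model:
  assumes "\<And>u. \<bar>omega_model d u\<bar> \<le> c * norm u"
  shows "norm d \<le> c"
proof -
  define u :: model where
    "u = (Complex (Im (fst d)) (- Re (fst d)), (\<chi> j. if j = 1 then snd d $ 2 else - (snd d $ 1)))"
  have sq: "d \<bullet> d = (Re (fst d))\<^sup>2 + (Im (fst d))\<^sup>2 + ((snd d $ 1)\<^sup>2 + (snd d $ 2)\<^sup>2)"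
    by (simp add: inner_prod_def inner_complex_def inner_vec_def sum_2 power2_eq_square)
  have "u \<bullet> u = d \<bullet> d"
    by (simp add: u_def inner_prod_def inner_complex_def inner_vec_def sum_2)
  then have nu: "norm u = norm d" by (simp add: norm_eq_sqrt_inner)
  have "omega_model d u = d \<bullet> d"
    unfolding sq by (simp add: omega_model_def u_def power2_eq_square)
  then have "norm d * norm d \<le> c * norm d"
    using assms[of u] nu by (simp add: dot_square_norm power2_eq_square)
  moreover have "0 \<le> c"
  proof -
    have "0 \<le> c * norm (1::complex, 0::real^2)"
      using assms[of "(1, 0)"] order_trans[OF abs_ge_zero] by blast
    then show ?thesis by (simp add: norm_prod_def)
  qed
  ultimately show ?thesis by (cases "norm d = 0") auto
qed

definition rot :: "real^2 \<Rightarrow> real^2" where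
  "rot v = (\<chi> j. if j = 1 then v $ 2 else - (v $ 1))"

definition grad_z :: "((real^2) \<times> real \<Rightarrow> real) \<Rightarrow> (real^2) \<times> real \<Rightarrow> real^2" where
  "grad_z f y = (\<chi> j. frechet_derivative f (at y) (axis j 1, 0))"

definition deriv_I :: "((real^2) \<times> real \<Rightarrow> real) \<Rightarrow> (real^2) \<times> real \<Rightarrow> real" where
  "deriv_I f y = frechet_derivative f (at y) (0, 1)"

text \<open>The frequency of the rotation of \<open>z\<^sub>1\<close>, up to the factor \<open>-2\<close>: the derivative of
  \<open>I * f (z\<^sub>2, I)\<close> in \<open>I\<close>.\<close>

definition freq :: "((real^2) \<times> real \<Rightarrow> real) \<Rightarrow> (real^2) \<times> real \<Rightarrow> real" where
  "freq f y = f y + snd y * deriv_I f y"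

text \<open>The arguments of \<open>f\<close>. In the model they move with a speed of order \<open>|z\<^sub>1|\<^sup>2\<close>, while \<open>z\<^sub>1\<close> rotates
  with a frequency of order one.\<close>

definition slow :: "model \<Rightarrow> (real^2) \<times> real" where
  "slow z = (snd z, (cmod (fst z))\<^sup>2)"

text \<open>The Hamiltonian field of \<open>model_ham f\<close>, written out.\<close>

definition model_field :: "((real^2) \<times> real \<Rightarrow> real) \<Rightarrow> model \<Rightarrow> model" where
  "model_field f z =
     (complex_of_real (freq f (slow z)) * (- 2 * \<i> * fst z), snd (slow z) *\<^sub>R rot (grad_z f (slow z)))"

lemma rot_inner_self: "v \<bullet> rot v = 0" "rot v \<bullet> v = 0"
  by (simp_all add: rot_def inner_vec_def sum_2)

lemma norm_rot: "norm (rot v) = norm v"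
  by (simp add: norm_eq_sqrt_inner rot_def inner_vec_def sum_2)

lemma bounded_linear_rot: "bounded_linear rot"
  by (intro linear_conv_bounded_linear[THEN iffD1] linearI)
    (simp_all add: rot_def vec_eq_iff)

text \<open>Multiplied by \<open>\<parallel>g\<parallel>\<^sup>2\<close>, this is the decomposition in the orthogonal basis \<open>rot g\<close>, \<open>g\<close>.\<close>

lemma rot_decomposition:
  "(norm g)\<^sup>2 *\<^sub>R d = (d \<bullet> rot g) *\<^sub>R rot g + (d \<bullet> g) *\<^sub>R g"
proof -
  have "(norm g)\<^sup>2 = g $ 1 * g $ 1 + g $ 2 * g $ 2"
    by (simp add: power2_norm_eq_inner inner_vec_def sum_2)
  then show ?thesis
    by (simp add: vec_eq_iff forall_2 rot_def inner_vec_def sum_2 algebra_simps)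
qed

lemma slow_model_field: "fst z \<bullet> fst (model_field f z) = 0"
  by (simp add: model_field_def inner_complex_def algebra_simps)

lemma frechet_grad_z:
  assumes "smooth_on UNIV f"
  shows "frechet_derivative f (at y) v = grad_z f y \<bullet> fst v + snd v * deriv_I f y"
proof -
  let ?D = "frechet_derivative f (at y)"
  have lin: "linear ?D"
    using smooth_on_has_derivative[OF assms] has_derivative_linear by blast
  have "v = (fst v $ 1) *\<^sub>R (axis 1 1, 0) + (fst v $ 2) *\<^sub>R (axis 2 1, 0) + snd v *\<^sub>R (0, 1)"
    using vec2_eq[of "fst v"] by (simp add: prod_eq_iff)
  then have "?D v = ?D ((fst v $ 1) *\<^sub>R (axis 1 1, 0) + (fst v $ 2) *\<^sub>R (axis 2 1, 0) + snd v *\<^sub>R (0, 1))"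
    by (rule arg_cong)
  also have "\<dots> = fst v $ 1 * ?D (axis 1 1, 0) + fst v $ 2 * ?D (axis 2 1, 0) + snd v * ?D (0, 1)"
    by (simp only: linear_add[OF lin] linear_scale[OF lin] real_scaleR_def)
  finally show ?thesis
    by (simp add: grad_z_def deriv_I_def inner_vec_def sum_2)
qed

lemma slow_eq: "slow = (\<lambda>z. (snd z, fst z \<bullet> fst z))"
  by (auto simp: slow_def power2_norm_eq_inner)

lemma slow_has_derivative:
  "(slow has_derivative (\<lambda>v. (snd v, 2 * (fst z \<bullet> fst v)))) (at z)"
  unfolding slow_eq by (auto intro!: derivative_eq_intros simp: inner_commute fun_eq_iff)

lemma model_ham_slow: "model_ham f z = snd (slow z) * f (slow z)"
  by (simp add: model_ham_def slow_def)

lemma model_ham_has_derivative: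
  assumes "smooth_on UNIV f"
  shows "(model_ham f has_derivative (\<lambda>v. - omega_model (model_field f z) v)) (at z)"
proof -
  let ?D = "frechet_derivative f (at (slow z))"
  have 1: "((\<lambda>z. f (slow z)) has_derivative (\<lambda>v. ?D (snd v, 2 * (fst z \<bullet> fst v)))) (at z)"
    by (rule has_derivative_compose[OF slow_has_derivative smooth_on_has_derivative[OF assms]]) simp
  have 2: "((\<lambda>z. snd (slow z)) has_derivative (\<lambda>v. 2 * (fst z \<bullet> fst v))) (at z)"
    using has_derivative_snd[OF slow_has_derivative] by simp
  have 3: "(\<lambda>v. snd (slow z) * ?D (snd v, 2 * (fst z \<bullet> fst v)) + 2 * (fst z \<bullet> fst v) * f (slow z))
      = (\<lambda>v. - omega_model (model_field f z) v)"
    by (rule ext) (simp add: frechet_grad_z[OF assms] omega_model_def model_field_def freq_def rot_def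
        inner_complex_def inner_vec_def sum_2 algebra_simps)
  show ?thesis
    using has_derivative_mult[OF 2 1] unfolding 3 model_ham_slow[abs_def] by simp
qed

lemma smooth_grad_z:
  assumes "smooth_on UNIV f" shows "smooth_on UNIV (grad_z f)"
proof -
  have "grad_z f = (\<lambda>y. frechet_derivative f (at y) (axis 1 1, 0) *\<^sub>R axis 1 1 +
      frechet_derivative f (at y) (axis 2 1, 0) *\<^sub>R axis 2 1)"
    by (simp add: fun_eq_iff vec_eq_iff forall_2 grad_z_def axis_def)
  moreover have "smooth_on UNIV \<dots>"
    by (intro smooth_on_add open_UNIV smooth_on_scaleR smooth_on_derivative[OF assms] smooth_on_const)
  ultimately show ?thesis by simp
qed

lemma smooth_slow: "smooth_on UNIV slow"
  unfolding slow_eq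
  by (intro smooth_on_Pair smooth_on_inner open_UNIV
        smooth_on_linear[OF open_UNIV bounded_linear_fst] smooth_on_linear[OF open_UNIV bounded_linear_snd])

lemma smooth_freq:
  assumes "smooth_on UNIV f" shows "smooth_on UNIV (freq f)"
proof -
  have "freq f = (\<lambda>y. f y + snd y * frechet_derivative f (at y) (0, 1))"
    by (auto simp: freq_def deriv_I_def)
  then show ?thesis
    by (simp only:) (intro smooth_on_add smooth_on_mult open_UNIV assms smooth_on_derivative
        smooth_on_linear[OF open_UNIV bounded_linear_snd])
qed

lemma smooth_model_field:
  assumes "smooth_on UNIV f" shows "smooth_on UNIV (model_field f)"
proof -
  have c: "smooth_on UNIV (\<lambda>z. g (slow z))" if "smooth_on UNIV g" for g :: "_ \<Rightarrow> 'b::euclidean_space"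
    by (rule smooth_on_compose[OF open_UNIV open_UNIV _ that smooth_slow]) simp
  have 1: "smooth_on UNIV (\<lambda>z. complex_of_real (freq f (slow z)))"
    by (rule smooth_on_linear_comp[OF open_UNIV bounded_linear_of_real c[OF smooth_freq[OF assms]]])
  have "bounded_linear (\<lambda>z::model. - 2 * \<i> * fst z)"
    by (intro bounded_linear_const_mult bounded_linear_fst)
  then have 2: "smooth_on UNIV (\<lambda>z::model. - 2 * \<i> * fst z)"
    by (rule smooth_on_linear[OF open_UNIV])
  have 3: "smooth_on UNIV (\<lambda>z. snd (slow z))"
    by (rule smooth_on_linear_comp[OF open_UNIV bounded_linear_snd smooth_slow])
  have 4: "smooth_on UNIV (\<lambda>z. rot (grad_z f (slow z)))"
    by (rule smooth_on_linear_comp[OF open_UNIV bounded_linear_rot c[OF smooth_grad_z[OF assms]]])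
  show ?thesis
    unfolding model_field_def[abs_def]
    by (rule smooth_on_Pair[OF open_UNIV smooth_on_mult[OF open_UNIV 1 2] smooth_on_scaleR[OF open_UNIV 3 4]])
qed

lemma smooth_model_ham:
  assumes "smooth_on UNIV f" shows "smooth_on UNIV (model_ham f)"
proof -
  have "smooth_on UNIV (\<lambda>z. f (slow z))"
    by (rule smooth_on_compose[OF open_UNIV open_UNIV _ assms smooth_slow]) simp
  then have "smooth_on UNIV (\<lambda>z. snd (slow z) * f (slow z))"
    by (rule smooth_on_mult[OF open_UNIV smooth_on_linear_comp[OF open_UNIV bounded_linear_snd smooth_slow]])
  then show ?thesis by (simp add: model_ham_slow[abs_def])
qed

lemma smooth_mag_ham:
  assumes "smooth_on UNIV A" shows "smooth_on UNIV (mag_ham A)"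
proof -
  have "mag_ham A = (\<lambda>x. (snd x - A (fst x)) \<bullet> (snd x - A (fst x)))"
    by (auto simp: mag_ham_def power2_norm_eq_inner)
  moreover have "smooth_on UNIV (\<lambda>x::phase. A (fst x))"
    by (rule smooth_on_compose[OF open_UNIV open_UNIV _ assms smooth_on_linear[OF open_UNIV bounded_linear_fst]])
      simp
  then have "smooth_on UNIV (\<lambda>x. snd x - A (fst x))"
    by (rule smooth_on_diff[OF open_UNIV smooth_on_linear[OF open_UNIV bounded_linear_snd]])
  ultimately show ?thesis using smooth_on_inner[OF open_UNIV] by simp
qed

lemma smooth_ham_field:
  assumes "smooth_on UNIV H" shows "smooth_on UNIV (ham_field H)"
proof -
  let ?D = "\<lambda>x. frechet_derivative H (at x)"
  have "ham_field H = (\<lambda>x. (?D x (0, axis 1 1) *\<^sub>R axis 1 1 + ?D x (0, axis 2 1) *\<^sub>R axis 2 1,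
      - ?D x (axis 1 1, 0) *\<^sub>R axis 1 1 + - ?D x (axis 2 1, 0) *\<^sub>R axis 2 1))"
    by (simp add: fun_eq_iff vec_eq_iff forall_2 ham_field_def axis_def)
  then show ?thesis
    by (simp only:) (intro smooth_on_Pair smooth_on_add smooth_on_scaleR smooth_on_uminus open_UNIV
        smooth_on_derivative assms smooth_on_const)
qed

section \<open>Local estimates near compact sets\<close>

text \<open>Monotonicity in the constant lets the finitely many constants of a subcover be merged.\<close>

lemma compact_local_bound:
  fixes D :: "'a::topological_space set"
  assumes D: "compact D" and loc: "\<And>z. z \<in> D \<Longrightarrow> \<exists>C. \<forall>\<^sub>F w in nhds z. P C w"
    and mono: "\<And>C C' w. C \<le> C' \<Longrightarrow> P C w \<Longrightarrow> P C' w"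
  shows "\<exists>C\<ge>0. \<forall>w\<in>D. P (C::real) w"
proof -
  have "\<forall>z\<in>D. \<exists>C W. open W \<and> z \<in> W \<and> (\<forall>w\<in>W. P C w)"
    using loc unfolding eventually_nhds by meson
  then obtain C W where CW: "\<And>z. z \<in> D \<Longrightarrow> open (W z) \<and> z \<in> W z \<and> (\<forall>w\<in>W z. P (C z) w)"
    by metis
  obtain F where F: "F \<subseteq> D" "finite F" "D \<subseteq> (\<Union>z\<in>F. W z)"
    by (rule compactE_image[OF D, of D W]) (use CW in auto)
  show ?thesis
  proof (intro exI[of _ "\<Sum>z\<in>F. \<bar>C z\<bar>"] conjI ballI)
    fix w assume "w \<in> D"
    then obtain z where z: "z \<in> F" "w \<in> W z" using F(3) by auto
    have "C z \<le> \<bar>C z\<bar>" by simp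
    also have "\<dots> \<le> (\<Sum>z\<in>F. \<bar>C z\<bar>)" using z F(2) by (intro member_le_sum) auto
    finally show "P (\<Sum>z\<in>F. \<bar>C z\<bar>) w" using mono CW z F(1) by blast
  qed (simp add: sum_nonneg)
qed

lemma smooth_on_lipschitz_near_compact:
  fixes g :: "'a::euclidean_space \<Rightarrow> 'b::euclidean_space"
  assumes g: "smooth_on S g" and S: "open S" and G: "compact G" "G \<subseteq> S"
  shows "\<exists>e>0. \<exists>L\<ge>0. \<forall>x\<in>G. \<forall>y. norm (y - x) \<le> e \<longrightarrow> y \<in> S \<and> norm (g y - g x) \<le> L * norm (y - x)"
proof -
  obtain e where e: "e > 0" "(\<Union>x\<in>G. cball x e) \<subseteq> S"
    using compact_subset_open_imp_cball_epsilon_subset[OF G(1) S G(2)] by auto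
  let ?K = "{x + y | x y. x \<in> G \<and> y \<in> cball 0 e}"
  have K: "compact ?K" by (rule compact_sums[OF G(1) compact_cball])
  have KS: "cball x e \<subseteq> ?K" if "x \<in> G" for x
  proof
    fix y assume "y \<in> cball x e"
    then have "y = x + (y - x)" "y - x \<in> cball 0 e" by (auto simp: dist_norm norm_minus_commute)
    then show "y \<in> ?K" using that by blast
  qed
  have "?K \<subseteq> S"
  proof
    fix u assume "u \<in> ?K"
    then obtain x y where "u = x + y" "x \<in> G" "y \<in> cball 0 e" by blast
    then have "u \<in> cball x e" by (simp add: dist_norm)
    then show "u \<in> S" using e(2) \<open>x \<in> G\<close> by blast
  qed
  then obtain L where L: "L \<ge> 0" "\<And>x y. closed_segment x y \<subseteq> ?K \<Longrightarrow> norm (g y - g x) \<le> L * norm (y - x)"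
    using smooth_on_lipschitz_segment[OF g K] by blast
  have "y \<in> S \<and> norm (g y - g x) \<le> L * norm (y - x)" if "x \<in> G" "norm (y - x) \<le> e" for x y
  proof -
    have y: "y \<in> cball x e" using that by (simp add: dist_norm norm_minus_commute)
    have x: "x \<in> cball x e" using e(1) by simp
    have "closed_segment x y \<subseteq> ?K"
      using closed_segment_subset[OF x y convex_cball] KS[OF that(1)] by blast
    then show ?thesis using L(2) y e(2) that(1) by blast
  qed
  then show ?thesis using e(1) L(1) by blast
qed

text \<open>Compare the values at two points at the distance \<open>h = |z\<^sub>1|\<^sup>k\<close>: both are of order \<open>h\<^sup>2\<close>, and so is
  the Taylor error, so that dividing by \<open>h\<close> leaves a derivative of order \<open>h\<close>.\<close>

lemma derivative_flat:
  fixes R :: "complex \<times> 'a::euclidean_space \<Rightarrow> real"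
  assumes R: "smooth_on S R" and S: "open S" and z: "z \<in> S" "fst z = 0" and k: "k \<ge> 1"
    and flat: "R \<in> O[nhds z](\<lambda>w. cmod (fst w) ^ (2 * k))"
  shows "\<exists>C. \<forall>\<^sub>F w in nhds z. \<forall>v. \<bar>frechet_derivative R (at w) v\<bar> \<le> C * cmod (fst w) ^ k * norm v"
proof -
  obtain c where c: "c > 0" "\<forall>\<^sub>F w in nhds z. norm (R w) \<le> c * norm (cmod (fst w) ^ (2 * k))"
    using flat landau_o.bigE by blast
  have "\<forall>\<^sub>F w in nhds z. w \<in> S" using S z(1) by (rule eventually_nhds_in_open)
  with c(2) have "\<forall>\<^sub>F w in nhds z. w \<in> S \<and> norm (R w) \<le> c * norm (cmod (fst w) ^ (2 * k))"
    by (rule eventually_conj[rotated])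
  then obtain e0 where e0: "e0 > 0" "\<And>w. dist w z < e0 \<Longrightarrow>
      w \<in> S \<and> norm (R w) \<le> c * norm (cmod (fst w) ^ (2 * k))"
    unfolding eventually_nhds_metric by blast
  define e where "e = min 1 (e0 / 3)"
  have e: "e > 0" "e \<le> 1" "2 * e < e0" unfolding e_def using e0(1) by auto
  have K: "cball z (2 * e) \<subseteq> S"
    using e0(2) e(3) by (force simp: dist_commute)
  have Rb: "\<bar>R w\<bar> \<le> c * cmod (fst w) ^ (2 * k)" if "w \<in> cball z (2 * e)" for w
    using e0(2)[of w] that e(3) by (simp add: dist_commute)
  obtain L where L: "L \<ge> 0" "\<And>x y. closed_segment x y \<subseteq> cball z (2 * e) \<Longrightarrow>
      norm (R y - R x - frechet_derivative R (at x) (y - x)) \<le> L * (norm (y - x))\<^sup>2"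
    using smooth_on_taylor_segment[OF R compact_cball K] by blast
  define C where "C = c * 4 ^ k + c + L"
  have C0: "C \<ge> 0" unfolding C_def using c(1) L(1) by simp
  have unit: "\<bar>frechet_derivative R (at w) v\<bar> \<le> C * cmod (fst w) ^ k"
    if w: "w \<in> ball z e" and v: "norm v = 1" for w v
  proof -
    let ?D = "frechet_derivative R (at w)" and ?r = "cmod (fst w)"
    have "cmod (fst (w - z)) \<le> norm (w - z)" by (cases "w - z") (simp add: norm_fst_le)
    then have r: "?r < e" using w z(2) by (simp add: dist_norm norm_minus_commute)
    have w2: "w \<in> cball z (2 * e)" using w e(1) by simp
    have lin: "linear ?D"
      using smooth_on_has_derivative[OF R] K w2 has_derivative_linear by blast
    have h: "\<bar>?D v\<bar> \<le> C * h" if h: "0 < h" "h \<le> e" "?r ^ k \<le> h" for h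
    proof -
      let ?y = "w + h *\<^sub>R v"
      have ny: "norm (?y - w) = h" using v h(1) by simp
      have "dist z ?y \<le> dist z w + norm (h *\<^sub>R v)" 
        using dist_triangle[of z ?y w] by (simp add: dist_norm)
      then have y2: "?y \<in> cball z (2 * e)" using w h v by simp
      have "\<bar>R ?y - R w - ?D (?y - w)\<bar> \<le> L * h\<^sup>2"
        using L(2)[OF closed_segment_subset[OF w2 y2 convex_cball]] ny by simp
      then have 1: "h * \<bar>?D v\<bar> \<le> \<bar>R ?y\<bar> + \<bar>R w\<bar> + L * h\<^sup>2"
        using linear_scale[OF lin, of h v] h(1) by (simp add: abs_mult)
      \<comment> \<open>both \<open>|z\<^sub>1|\<close> and \<open>h\<close> have a \<open>2 * k\<close>-th power below \<open>h\<^sup>2\<close>, hence so has their sum up to a constant\<close>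
      have rk: "?r ^ (2 * k) \<le> h\<^sup>2"
        using power_mono[OF h(3), of 2] by (simp add: power_mult[symmetric] mult.commute)
      have hk: "h ^ (2 * k) \<le> h\<^sup>2"
        using h e(2) k by (intro power_decreasing) auto
      have "cmod (fst ?y) \<le> ?r + cmod (fst (h *\<^sub>R v))"
        using norm_triangle_ineq[of "fst w" "h *\<^sub>R fst v"] by simp
      also have "cmod (fst (h *\<^sub>R v)) \<le> norm (h *\<^sub>R v)" by (cases "h *\<^sub>R v") (simp add: norm_fst_le)
      also have "norm (h *\<^sub>R v) = h" using v h(1) by simp
      finally have "cmod (fst ?y) \<le> 2 * max ?r h" by simp
      then have "cmod (fst ?y) ^ (2 * k) \<le> (2 * max ?r h) ^ (2 * k)" by (intro power_mono) auto
      also have "\<dots> = 4 ^ k * max ?r h ^ (2 * k)" by (simp add: power_mult_distrib power_mult)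
      also have "max ?r h ^ (2 * k) \<le> h\<^sup>2" using rk hk by (simp add: max_def)
      finally have yk: "cmod (fst ?y) ^ (2 * k) \<le> 4 ^ k * h\<^sup>2" by simp
      have "\<bar>R ?y\<bar> \<le> c * (4 ^ k * h\<^sup>2)"
        using Rb[OF y2] mult_left_mono[OF yk, of c] c(1) by linarith
      moreover have "\<bar>R w\<bar> \<le> c * h\<^sup>2"
        using Rb[OF w2] mult_left_mono[OF rk, of c] c(1) by linarith
      ultimately have "h * \<bar>?D v\<bar> \<le> h * (C * h)"
        using 1 unfolding C_def by (simp add: algebra_simps power2_eq_square)
      then show ?thesis using h(1) by simp
    qed
    show ?thesis
    proof (cases "?r = 0")
      case True
      \<comment> \<open>on \<open>z\<^sub>1 = 0\<close> no positive \<open>h = |z\<^sub>1|\<^sup>k\<close> is available, but every small \<open>h\<close> is admissible\<close>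
      have "\<bar>?D v\<bar> \<le> 0 + x" if "x > 0" for x
      proof -
        define h where "h = min e (x / (C + 1))"
        have "0 < h" "h \<le> e" unfolding h_def using that e(1) C0 by auto
        have "?r ^ k = 0" using True k by simp
        then have "?r ^ k \<le> h" using \<open>0 < h\<close> by linarith
        then have "\<bar>?D v\<bar> \<le> C * h" by (rule h[OF \<open>0 < h\<close> \<open>h \<le> e\<close>])
        also have "\<dots> \<le> (C + 1) * (x / (C + 1))"
          unfolding h_def using C0 e(1) that by (intro mult_mono) auto
        finally show ?thesis using C0 by simp
      qed
      then have "\<bar>?D v\<bar> \<le> 0" by (rule field_le_epsilon)
      then show ?thesis using C0 by (simp add: order_trans)
    next
      case False
      have "?r ^ k \<le> ?r ^ 1" using r e(2) k by (intro power_decreasing) auto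
      then show ?thesis using h[of "?r ^ k"] False r by simp
    qed
  qed
  have "\<bar>frechet_derivative R (at w) v\<bar> \<le> C * cmod (fst w) ^ k * norm v" if w: "w \<in> ball z e" for w v
  proof (cases "v = 0")
    case True
    have "w \<in> cball z (2 * e)" using w e(1) by simp
    then have "w \<in> S" using K by blast
    then have "linear (frechet_derivative R (at w))"
      using smooth_on_has_derivative[OF R] has_derivative_linear by blast
    then show ?thesis using True linear_0 by fastforce
  next
    case False
    have "w \<in> cball z (2 * e)" using w e(1) by simp
    then have "w \<in> S" using K by blast
    then have lin: "linear (frechet_derivative R (at w))"
      using smooth_on_has_derivative[OF R] has_derivative_linear by blast
    have "frechet_derivative R (at w) v = norm v * frechet_derivative R (at w) (inverse (norm v) *\<^sub>R v)"
      using linear_scale[OF lin, of "inverse (norm v)" v] False by simp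
    then have "\<bar>frechet_derivative R (at w) v\<bar> = norm v * \<bar>frechet_derivative R (at w) (inverse (norm v) *\<^sub>R v)\<bar>"
      by (simp add: abs_mult)
    also have "\<dots> \<le> norm v * (C * cmod (fst w) ^ k)"
      using False by (intro mult_left_mono unit[OF w]) auto
    finally show ?thesis by (simp add: mult_ac)
  qed
  then have "\<forall>\<^sub>F w in nhds z. \<forall>v. \<bar>frechet_derivative R (at w) v\<bar> \<le> C * cmod (fst w) ^ k * norm v"
    unfolding eventually_nhds using e(1) by (intro exI[of _ "ball z e"]) auto
  then show ?thesis by blast
qed

lemma derivative_flat_on_compact:
  fixes R :: "complex \<times> 'a::euclidean_space \<Rightarrow> real"
  assumes R: "smooth_on S R" and S: "open S" and D: "compact D" "D \<subseteq> S" and k: "k \<ge> 1"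
    and flat: "\<And>z. z \<in> S \<Longrightarrow> fst z = 0 \<Longrightarrow> R \<in> O[nhds z](\<lambda>w. cmod (fst w) ^ (2 * k))"
  shows "\<exists>C\<ge>0. \<forall>w\<in>D. \<forall>v. \<bar>frechet_derivative R (at w) v\<bar> \<le> C * cmod (fst w) ^ k * norm v"
proof (rule compact_local_bound[OF D(1)])
  show "\<forall>v. \<bar>frechet_derivative R (at w) v\<bar> \<le> C' * cmod (fst w) ^ k * norm v"
    if "C \<le> C'" "\<forall>v. \<bar>frechet_derivative R (at w) v\<bar> \<le> C * cmod (fst w) ^ k * norm v" for C C' w
  proof
    fix v :: "complex \<times> 'a"
    have "C * cmod (fst w) ^ k * norm v \<le> C' * cmod (fst w) ^ k * norm v"
      using that(1) by (intro mult_right_mono) auto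
    then show "\<bar>frechet_derivative R (at w) v\<bar> \<le> C' * cmod (fst w) ^ k * norm v"
      using that(2) order_trans by blast
  qed
  fix z assume "z \<in> D"
  then have zS: "z \<in> S" using D(2) by blast
  show "\<exists>C. \<forall>\<^sub>F w in nhds z. \<forall>v. \<bar>frechet_derivative R (at w) v\<bar> \<le> C * cmod (fst w) ^ k * norm v"
  proof (cases "fst z = 0")
    case True
    show ?thesis by (rule derivative_flat[OF R S zS True k flat[OF zS True]])
  next
    case False
    obtain e where e: "e > 0" "cball z e \<subseteq> S" using S zS open_contains_cball by metis
    obtain L where L: "L \<ge> 0" "\<And>x v. x \<in> cball z e \<Longrightarrow> norm (frechet_derivative R (at x) v) \<le> L * norm v"
      using smooth_on_derivative_bound[OF R compact_cball e(2)] by blast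
    define m where "m = cmod (fst z) / 2"
    have m: "m > 0" unfolding m_def using False by simp
    have "open {w::complex \<times> 'a. m < cmod (fst w)}" by (intro open_Collect_less continuous_intros)
    moreover have "z \<in> {w. m < cmod (fst w)}" unfolding m_def using False by simp
    ultimately have "\<forall>\<^sub>F w in nhds z. m < cmod (fst w)"
      using eventually_nhds_in_open by fastforce
    moreover have "\<forall>\<^sub>F w in nhds z. w \<in> ball z e"
      using e(1) by (intro eventually_nhds_in_open) auto
    ultimately have "\<forall>\<^sub>F w in nhds z. \<forall>v. \<bar>frechet_derivative R (at w) v\<bar> \<le> (L / m ^ k) * cmod (fst w) ^ k * norm v"
    proof eventually_elim
      case (elim w)
      have "m ^ k \<le> cmod (fst w) ^ k" using elim(1) m by (intro power_mono) auto
      then have "1 \<le> cmod (fst w) ^ k / m ^ k" using m by simp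
      then have "L * 1 \<le> L * (cmod (fst w) ^ k / m ^ k)" using L(1) by (rule mult_left_mono)
      then have le: "L \<le> (L / m ^ k) * cmod (fst w) ^ k" by simp
      show ?case
      proof
        fix v :: "complex \<times> 'a"
        have "norm (frechet_derivative R (at w) v) \<le> L * norm v" using L(2)[of w v] elim(2) by auto
        also have "\<dots> \<le> (L / m ^ k) * cmod (fst w) ^ k * norm v" by (rule mult_right_mono[OF le norm_ge_zero])
        finally show "\<bar>frechet_derivative R (at w) v\<bar> \<le> (L / m ^ k) * cmod (fst w) ^ k * norm v" by simp
      qed
    qed
    then show ?thesis by blast
  qed
qed

section \<open>Perturbed trajectories in the model\<close>

lemma has_vector_derivative_compose_at:
  assumes "(g has_derivative g') (at (u s))" "(u has_vector_derivative u') (at s within X)"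
  shows "((\<lambda>s. g (u s)) has_vector_derivative g' u') (at s within X)"
proof -
  have "((\<lambda>s. g (u s)) has_derivative (\<lambda>h. g' (h *\<^sub>R u'))) (at s within X)"
    using has_derivative_compose[OF assms(2)[unfolded has_vector_derivative_def] assms(1)] .
  moreover have "g' (h *\<^sub>R u') = h *\<^sub>R g' u'" for h
    using assms(1) has_derivative_linear linear_scale by blast
  ultimately show ?thesis unfolding has_vector_derivative_def by simp
qed

text \<open>Trajectories in \<open>D\<close> of the model field, run forward (\<open>\<sigma> = 1\<close>) or backward (\<open>\<sigma> = - 1\<close>), with a
  force of size at most \<open>\<kappa>\<close> that may depend on time.\<close>

definition forced_sol ::
    "((real^2) \<times> real \<Rightarrow> real) \<Rightarrow> model set \<Rightarrow> real \<Rightarrow> real \<Rightarrow> real \<Rightarrow> (real \<Rightarrow> model) \<Rightarrow> bool" where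
  "forced_sol f D \<sigma> \<kappa> T w \<longleftrightarrow> \<bar>\<sigma>\<bar> = 1 \<and> (\<forall>s\<in>{0..T}. w s \<in> D \<and>
     (\<exists>\<rho>. norm \<rho> \<le> \<kappa> \<and>
       (w has_vector_derivative \<sigma> *\<^sub>R model_field f (w s) + \<rho>) (at s within {0..T})))"

definition slab :: "real \<Rightarrow> (real^2) set \<Rightarrow> model set" where
  "slab \<delta> Z = {z. cmod (fst z) \<le> \<delta> \<and> snd z \<in> Z}"

lemma forced_sol_restrict:
  assumes "forced_sol f D \<sigma> \<kappa> T w" "T' \<le> T" shows "forced_sol f D \<sigma> \<kappa> T' w"
  unfolding forced_sol_def
proof (intro conjI ballI)
  show "\<bar>\<sigma>\<bar> = 1" using assms(1) unfolding forced_sol_def by simp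
  fix s assume s: "s \<in> {0..T'}"
  then have "s \<in> {0..T}" using assms(2) by simp
  then obtain \<rho> where "w s \<in> D" "norm \<rho> \<le> \<kappa>"
      "(w has_vector_derivative \<sigma> *\<^sub>R model_field f (w s) + \<rho>) (at s within {0..T})"
    using assms(1) unfolding forced_sol_def by meson
  moreover have "{0..T'} \<subseteq> {0..T}" using assms(2) by simp
  ultimately show "w s \<in> D" "\<exists>\<rho>. norm \<rho> \<le> \<kappa> \<and>
      (w has_vector_derivative \<sigma> *\<^sub>R model_field f (w s) + \<rho>) (at s within {0..T'})"
    using has_vector_derivative_within_subset by blast+
qed

lemma forced_sol_continuous:
  assumes "forced_sol f D \<sigma> \<kappa> T w" shows "continuous_on {0..T} w"
  unfolding continuous_on_eq_continuous_within
proof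
  fix s assume "s \<in> {0..T}"
  then obtain w' where "(w has_vector_derivative w') (at s within {0..T})"
    using assms unfolding forced_sol_def by meson
  then show "continuous (at s within {0..T}) w" by (rule has_vector_derivative_continuous)
qed

lemma forced_solD:
  assumes "forced_sol f D \<sigma> \<kappa> T w"
  obtains \<rho> where "\<And>s. s \<in> {0..T} \<Longrightarrow> w s \<in> D" "\<And>s. s \<in> {0..T} \<Longrightarrow> norm (\<rho> s) \<le> \<kappa>"
    "\<And>s. s \<in> {0..T} \<Longrightarrow>
      (w has_vector_derivative \<sigma> *\<^sub>R model_field f (w s) + \<rho> s) (at s within {0..T})"
proof -
  have "\<exists>\<rho>. \<forall>s\<in>{0..T}. w s \<in> D \<and> norm (\<rho> s) \<le> \<kappa> \<and>
     (w has_vector_derivative \<sigma> *\<^sub>R model_field f (w s) + \<rho> s) (at s within {0..T})"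
    using assms unfolding forced_sol_def by metis
  then show ?thesis using that by blast
qed

lemma norm_fst_snd_le: "norm (fst x) \<le> norm x" "norm (snd x) \<le> norm x"
  by (cases x; simp add: norm_fst_le norm_snd_le)+

lemma slow_in_box:
  fixes Z :: "(real^2) set"
  assumes "compact Z"
  shows "\<exists>r\<ge>0. \<forall>z\<in>Z. \<forall>I\<in>{0..1::real}. (z, I) \<in> cball 0 r"
proof -
  have "compact (Z \<times> {0..1::real})" using assms by (intro compact_Times compact_Icc)
  then obtain r where "r > 0" "\<And>y. y \<in> Z \<times> {0..1::real} \<Longrightarrow> norm y \<le> r"
    by (rule compact_norm_bound) blast
  then have "0 \<le> r" "\<And>z I. z \<in> Z \<Longrightarrow> I \<in> {0..1::real} \<Longrightarrow> norm (z, I) \<le> r" by auto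
  then show ?thesis unfolding mem_cball_0 by blast
qed

lemma slab_slow:
  assumes "w \<in> slab \<delta> Z" "0 < \<delta>" "\<delta> \<le> 1"
  shows "(cmod (fst w))\<^sup>2 \<in> {0..\<delta>\<^sup>2}" "(cmod (fst w))\<^sup>2 \<in> {0..1}" "snd w \<in> Z" "cmod (fst w) \<le> 1"
proof -
  have c: "cmod (fst w) \<le> \<delta>" "snd w \<in> Z" using assms unfolding slab_def by auto
  then show "snd w \<in> Z" "cmod (fst w) \<le> 1" using assms by auto
  have "(cmod (fst w))\<^sup>2 \<le> \<delta>\<^sup>2" using c by (intro power_mono) auto
  then show "(cmod (fst w))\<^sup>2 \<in> {0..\<delta>\<^sup>2}" by simp
  have "(cmod (fst w))\<^sup>2 \<le> 1" using c assms by (intro power_le_one) auto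
  then show "(cmod (fst w))\<^sup>2 \<in> {0..1}" by simp
qed

text \<open>The flow of the model conserves \<open>|z\<^sub>1|\<^sup>2\<close> and \<open>f (z\<^sub>2, |z\<^sub>1|\<^sup>2)\<close>, so under forcing both
  drift at a speed proportional to the force.\<close>

lemma forced_sol_drift:
  assumes f: "smooth_on UNIV f" and Z: "compact Z" and \<delta>: "0 < \<delta>" "\<delta> \<le> 1"
  shows "\<exists>C\<ge>1. \<forall>\<sigma> \<kappa> T w. 0 \<le> T \<longrightarrow> forced_sol f (slab \<delta> Z) \<sigma> \<kappa> T w \<longrightarrow>
    \<bar>(cmod (fst (w T)))\<^sup>2 - (cmod (fst (w 0)))\<^sup>2\<bar> \<le> C * \<kappa> * T \<and>
    \<bar>f (slow (w T)) - f (slow (w 0))\<bar> \<le> C * \<kappa> * T"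
proof -
  obtain r where r: "r \<ge> 0" "\<And>z (I::real). z \<in> Z \<Longrightarrow> I \<in> {0..1} \<Longrightarrow> (z, I) \<in> cball 0 r"
    using slow_in_box[OF Z] by blast
  obtain L where L: "L \<ge> 0" "\<And>y v. y \<in> cball 0 r \<Longrightarrow> norm (frechet_derivative f (at y) v) \<le> L * norm v"
    using smooth_on_derivative_bound[OF f compact_cball, of 0 r] by auto
  have "\<bar>(cmod (fst (w T)))\<^sup>2 - (cmod (fst (w 0)))\<^sup>2\<bar> \<le> (2 + 3 * L) * \<kappa> * T \<and>
    \<bar>f (slow (w T)) - f (slow (w 0))\<bar> \<le> (2 + 3 * L) * \<kappa> * T"
    if T: "0 \<le> T" and w: "forced_sol f (slab \<delta> Z) \<sigma> \<kappa> T w" for \<sigma> \<kappa> T w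
  proof -
    obtain \<rho> where \<rho>: "\<And>s. s \<in> {0..T} \<Longrightarrow> w s \<in> slab \<delta> Z" "\<And>s. s \<in> {0..T} \<Longrightarrow> norm (\<rho> s) \<le> \<kappa>"
       "\<And>s. s \<in> {0..T} \<Longrightarrow>
          (w has_vector_derivative \<sigma> *\<^sub>R model_field f (w s) + \<rho> s) (at s within {0..T})"
      using forced_solD[OF w] by blast
    have \<kappa>: "\<kappa> \<ge> 0" using \<rho>(2)[of 0] T norm_ge_zero order_trans by (meson atLeastAtMost_iff order.refl)
    let ?I' = "\<lambda>s. 2 * (fst (w s) \<bullet> fst (\<rho> s))"
    let ?v = "\<lambda>s. (snd (\<sigma> *\<^sub>R model_field f (w s) + \<rho> s), ?I' s)"
    have fr: "fst (w s) \<bullet> fst (\<sigma> *\<^sub>R model_field f (w s) + \<rho> s) = fst (w s) \<bullet> fst (\<rho> s)" for s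
      by (simp add: inner_add_right slow_model_field)
    have dslow: "((\<lambda>s. slow (w s)) has_vector_derivative ?v s) (at s within {0..T})"
      if "s \<in> {0..T}" for s
      using has_vector_derivative_compose_at[OF slow_has_derivative \<rho>(3)[OF that]] unfolding fr .
    have I': "\<bar>?I' s\<bar> \<le> 2 * \<kappa>" if "s \<in> {0..T}" for s
    proof -
      have "\<bar>fst (w s) \<bullet> fst (\<rho> s)\<bar> \<le> cmod (fst (w s)) * cmod (fst (\<rho> s))"
        by (rule Cauchy_Schwarz_ineq2)
      also have "\<dots> \<le> 1 * \<kappa>"
        using slab_slow(4)[OF \<rho>(1)[OF that] \<delta>] order_trans[OF norm_fst_snd_le(1) \<rho>(2)[OF that]]
        by (intro mult_mono) auto
      finally show ?thesis by simp
    qed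
    have "\<bar>snd (slow (w T)) - snd (slow (w 0))\<bar> \<le> (2 * \<kappa>) * T"
    proof (rule real_mvt_increment[OF T _ I'])
      show "((\<lambda>s. snd (slow (w s))) has_vector_derivative ?I' s) (at s within {0..T})"
        if "s \<in> {0..T}" for s
        using bounded_linear.has_vector_derivative[OF bounded_linear_snd dslow[OF that]] by simp
    qed
    moreover have "\<bar>f (slow (w T)) - f (slow (w 0))\<bar> \<le> (3 * L * \<kappa>) * T"
    proof (rule real_mvt_increment[OF T])
      fix s assume s: "s \<in> {0..T}"
      show "((\<lambda>s. f (slow (w s))) has_vector_derivative frechet_derivative f (at (slow (w s))) (?v s))
          (at s within {0..T})"
        by (rule has_vector_derivative_compose_at[OF smooth_on_has_derivative[OF f] dslow[OF s]]) simp
      \<comment> \<open>the field itself is tangent to the level sets of \<open>f\<close>, only the force contributes\<close>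
      have "frechet_derivative f (at (slow (w s))) (?v s)
          = frechet_derivative f (at (slow (w s))) (snd (\<rho> s), ?I' s)"
        unfolding frechet_grad_z[OF f]
        by (simp add: model_field_def inner_add_right rot_inner_self)
      also have "norm \<dots> \<le> L * norm (snd (\<rho> s), ?I' s)"
        unfolding slow_def using slab_slow[OF \<rho>(1)[OF s] \<delta>] by (intro L(2) r(2)) auto
      also have "\<dots> \<le> L * (3 * \<kappa>)"
      proof (rule mult_left_mono[OF _ L(1)])
        have "norm (snd (\<rho> s), ?I' s) \<le> norm (snd (\<rho> s)) + norm (?I' s)" by (rule norm_Pair_le)
        also have "\<dots> \<le> \<kappa> + 2 * \<kappa>"
          using I'[OF s] order_trans[OF norm_fst_snd_le(2) \<rho>(2)[OF s]] by simp
        finally show "norm (snd (\<rho> s), ?I' s) \<le> 3 * \<kappa>" by simp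
      qed
      finally show "\<bar>frechet_derivative f (at (slow (w s))) (?v s)\<bar> \<le> 3 * L * \<kappa>" by simp
    qed
    moreover have "2 * \<kappa> * T \<le> (2 + 3 * L) * \<kappa> * T" "3 * L * \<kappa> * T \<le> (2 + 3 * L) * \<kappa> * T"
      using L(1) \<kappa> T by (auto intro!: mult_right_mono)
    ultimately show ?thesis by (auto simp: slow_def)
  qed
  then show ?thesis using L(1) by (intro exI[of _ "2 + 3 * L"]) auto
qed

text \<open>The velocity of \<open>z\<^sub>2\<close> per unit of \<open>I\<close>, tangent to the level curves of \<open>f (\<cdot>, I)\<close>. Pairing with
  \<open>clock f\<close> reads a displacement along a level curve as a lapse of time.\<close>

definition slope_field :: "((real^2) \<times> real \<Rightarrow> real) \<Rightarrow> (real^2) \<times> real \<Rightarrow> real^2" where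
  "slope_field f y = rot (grad_z f y)"

definition clock :: "((real^2) \<times> real \<Rightarrow> real) \<Rightarrow> (real^2) \<times> real \<Rightarrow> real^2" where
  "clock f y = inverse (slope_field f y \<bullet> slope_field f y) *\<^sub>R slope_field f y"

lemma smooth_slope_field: "smooth_on UNIV f \<Longrightarrow> smooth_on UNIV (slope_field f)"
  unfolding slope_field_def[abs_def]
  by (rule smooth_on_linear_comp[OF open_UNIV bounded_linear_rot smooth_grad_z])

lemma open_regular: "smooth_on UNIV f \<Longrightarrow> open {y. grad_z f y \<noteq> 0}"
  using smooth_on_continuous[OF smooth_grad_z] open_Collect_neq[of "grad_z f" "\<lambda>_. 0"] by simp

lemma smooth_clock:
  assumes "smooth_on UNIV f" shows "smooth_on {y. grad_z f y \<noteq> 0} (clock f)"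
proof -
  let ?R = "{y. grad_z f y \<noteq> 0}"
  have o: "open ?R" by (rule open_regular[OF assms])
  have s: "smooth_on ?R (slope_field f)"
    by (rule smooth_on_subset[OF _ smooth_slope_field[OF assms]]) simp
  have "slope_field f y \<bullet> slope_field f y \<noteq> 0" if "y \<in> ?R" for y
    using that norm_rot[of "grad_z f y"] unfolding slope_field_def by auto
  then show ?thesis
    unfolding clock_def[abs_def]
    by (intro smooth_on_scaleR[OF o smooth_on_inverse[OF o _ smooth_on_inner[OF o s s]] s])
qed


text \<open>Let \<open>I\<close> be fixed, let \<open>z\<close> move with velocity \<open>T = slope_field f\<close> along a level curve and let \<open>w\<close> move likewise
  nearby. The left-hand side of the first estimate is the rate of change of the time lag
  \<open>(w - z) \<bullet> clock f\<close>. Its linear part vanishes on displacements along \<open>T\<close>, since \<open>T \<bullet> clock f = 1\<close>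
  everywhere: differentiate this identity along \<open>T\<close>. What is left is the component along the
  gradient, which the difference of the values of \<open>f\<close> controls up to a quadratic error.\<close>

lemma time_lag_estimates:
  assumes f: "smooth_on UNIV f" and Z: "compact Z" and \<delta>: "0 < \<delta>" "\<delta> \<le> 1"
    and reg: "\<forall>z\<in>Z. \<forall>I\<in>{0..\<delta>\<^sup>2}. grad_z f (z, I) \<noteq> 0"
  shows "\<exists>C\<ge>1. \<forall>z\<in>Z. \<forall>I\<in>{0..\<delta>\<^sup>2}. \<forall>w\<in>Z.
    \<bar>(slope_field f (w, I) - slope_field f (z, I)) \<bullet> clock f (z, I)
      + (w - z) \<bullet> frechet_derivative (clock f) (at (z, I)) (slope_field f (z, I), 0)\<bar>
      \<le> C * (\<bar>f (w, I) - f (z, I)\<bar> + (norm (w - z))\<^sup>2) \<and>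
    norm (w - z) \<le> C * (\<bar>(w - z) \<bullet> clock f (z, I)\<bar> + \<bar>f (w, I) - f (z, I)\<bar> + (norm (w - z))\<^sup>2) \<and>
    norm (clock f (z, I)) \<le> C"
proof -
  let ?R = "{y. grad_z f y \<noteq> 0}" and ?P = "Z \<times> {0..\<delta>\<^sup>2}"
  let ?T = "slope_field f" and ?\<tau> = "clock f"
  let ?DT = "\<lambda>y. frechet_derivative (slope_field f) (at y)" and ?D\<tau> = "\<lambda>y. frechet_derivative (clock f) (at y)"
  have cP: "compact ?P" using Z by (intro compact_Times compact_Icc)
  have PR: "?P \<subseteq> ?R" using reg by auto
  have d2: "\<delta>\<^sup>2 \<le> 1" using \<delta> by (intro power_le_one) auto
  obtain r where r: "r \<ge> 0" "\<And>z (I::real). z \<in> Z \<Longrightarrow> I \<in> {0..1} \<Longrightarrow> (z, I) \<in> cball 0 r"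
    using slow_in_box[OF Z] by blast
  have Pr: "y \<in> cball 0 r" if "y \<in> ?P" for y using r(2)[of "fst y" "snd y"] that d2 by auto
  have oR: "open ?R" by (rule open_regular[OF f])
  have sT: "smooth_on UNIV ?T" by (rule smooth_slope_field[OF f])
  have s\<tau>: "smooth_on ?R ?\<tau>" by (rule smooth_clock[OF f])
  obtain L1 where L1: "L1 \<ge> 0" "\<And>y v. y \<in> cball 0 r \<Longrightarrow> norm (?DT y v) \<le> L1 * norm v"
    using smooth_on_derivative_bound[OF sT compact_cball, of 0 r] by auto
  obtain L2 where L2: "L2 \<ge> 0" "\<And>x y. closed_segment x y \<subseteq> cball 0 r \<Longrightarrow>
      norm (?T y - ?T x - ?DT x (y - x)) \<le> L2 * (norm (y - x))\<^sup>2"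
    using smooth_on_taylor_segment[OF sT compact_cball, of 0 r] by auto
  obtain L3 where L3: "L3 \<ge> 0" "\<And>x y. closed_segment x y \<subseteq> cball 0 r \<Longrightarrow>
      norm (f y - f x - frechet_derivative f (at x) (y - x)) \<le> L3 * (norm (y - x))\<^sup>2"
    using smooth_on_taylor_segment[OF f compact_cball, of 0 r] by auto
  obtain L4 where L4: "L4 \<ge> 0" "\<And>y v. y \<in> ?P \<Longrightarrow> norm (?D\<tau> y v) \<le> L4 * norm v"
    using smooth_on_derivative_bound[OF s\<tau> cP PR] by blast
  have bdd: "\<exists>L\<ge>0. \<forall>y\<in>?P. norm (h y) \<le> L" if "continuous_on ?P h" for h :: "_ \<Rightarrow> real^2"
  proof -
    have "compact (h ` ?P)" by (rule compact_continuous_image[OF that cP])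
    then show ?thesis by (rule compact_norm_bound) (meson imageI less_imp_le)
  qed
  obtain L5 where L5: "L5 \<ge> 0" "\<And>y. y \<in> ?P \<Longrightarrow> norm (?\<tau> y) \<le> L5"
    using bdd[of ?\<tau>] continuous_on_subset[OF smooth_on_continuous[OF s\<tau>] PR] by blast
  obtain L6 where L6: "L6 \<ge> 0" "\<And>y. y \<in> ?P \<Longrightarrow> norm (?T y) \<le> L6"
    using bdd[of ?T] continuous_on_subset[OF smooth_on_continuous[OF sT] subset_UNIV] by blast
  define M where "M = 1 + L1 + L2 + L3 + L4 + L5 + L6"
  have M: "M \<ge> 1" "L1 \<le> M" "L2 \<le> M" "L3 \<le> M" "L4 \<le> M" "L5 \<le> M" "L6 \<le> M" "M \<ge> 0"
    using L1(1) L2(1) L3(1) L4(1) L5(1) L6(1) unfolding M_def by auto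
  have "\<bar>(?T (w, I) - ?T (z, I)) \<bullet> ?\<tau> (z, I) + (w - z) \<bullet> ?D\<tau> (z, I) (?T (z, I), 0)\<bar>
        \<le> 3 * M ^ 4 * (\<bar>f (w, I) - f (z, I)\<bar> + (norm (w - z))\<^sup>2) \<and>
      norm (w - z) \<le> 3 * M ^ 4 * (\<bar>(w - z) \<bullet> ?\<tau> (z, I)\<bar> + \<bar>f (w, I) - f (z, I)\<bar> + (norm (w - z))\<^sup>2) \<and>
      norm (?\<tau> (z, I)) \<le> 3 * M ^ 4"
    if z: "z \<in> Z" and I: "I \<in> {0..\<delta>\<^sup>2}" and w: "w \<in> Z" for z I w
  proof -
    define y where "y = (z, I)"
    define d where "d = w - z"
    define T where "T = ?T y"
    define g where "g = grad_z f y"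
    define t where "t = ?\<tau> y"
    define e where "e = \<bar>f (w, I) - f y\<bar>"
    define DT where "DT v = ?DT y (v, 0)" for v
    define Dt where "Dt = ?D\<tau> y (T, 0)"
    define b where "b = (d \<bullet> g) / (norm g)\<^sup>2"
    have yP: "y \<in> ?P" "(w, I) \<in> ?P" using z I w unfolding y_def by auto
    have yR: "y \<in> ?R" using yP(1) PR by blast
    have seg: "closed_segment y (w, I) \<subseteq> cball 0 r"
      by (rule closed_segment_subset[OF Pr[OF yP(1)] Pr[OF yP(2)] convex_cball])
    have diff: "(w, I) - y = (d, 0)" unfolding y_def d_def by simp
    have g0: "g \<noteq> 0" using yR unfolding g_def by simp
    have nT: "norm T = norm g" unfolding T_def g_def slope_field_def by (rule norm_rot)
    have t: "t = (1 / (norm g)\<^sup>2) *\<^sub>R T"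
      unfolding t_def clock_def T_def[symmetric] by (simp add: dot_square_norm nT divide_inverse)
    have nt: "norm t * norm g = 1" unfolding t using g0 nT by (simp add: power2_eq_square)
    have tM: "norm t \<le> M" unfolding t_def using L5(2)[OF yP(1)] M by linarith
    have gM: "norm g \<le> M" unfolding nT[symmetric] T_def using L6(2)[OF yP(1)] M by linarith
    have lin: "linear DT"
    proof -
      have l: "linear (?DT y)" using smooth_on_has_derivative[OF sT] has_derivative_linear by blast
      show ?thesis
        unfolding DT_def
        by (intro linearI) (simp_all add: linear_add[OF l, symmetric] linear_scale[OF l, symmetric])
    qed
    have dec: "d = (d \<bullet> t) *\<^sub>R T + b *\<^sub>R g"
    proof -
      have "(norm g)\<^sup>2 *\<^sub>R d = (d \<bullet> T) *\<^sub>R T + (d \<bullet> g) *\<^sub>R g"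
        using rot_decomposition[of g d] unfolding T_def g_def slope_field_def .
      then have "(1 / (norm g)\<^sup>2) *\<^sub>R ((norm g)\<^sup>2 *\<^sub>R d) = (1 / (norm g)\<^sup>2) *\<^sub>R ((d \<bullet> T) *\<^sub>R T + (d \<bullet> g) *\<^sub>R g)"
        by simp
      then show ?thesis using g0 unfolding b_def t by (simp add: scaleR_add_right)
    qed
    \<comment> \<open>the derivative of \<open>T \<bullet> clock f = 1\<close> along \<open>T\<close>\<close>
    have shift: "DT T \<bullet> t + T \<bullet> Dt = 0"
    proof -
      have 1: "((\<lambda>x. ?T x \<bullet> ?\<tau> x) has_derivative (\<lambda>v. ?T y \<bullet> ?D\<tau> y v + ?DT y v \<bullet> ?\<tau> y)) (at y)"
        by (rule bounded_bilinear.FDERIV[OF bounded_bilinear_inner smooth_on_has_derivative[OF sT UNIV_I]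
              smooth_on_has_derivative[OF s\<tau> yR]])
      have "?T x \<bullet> ?\<tau> x = 1" if "x \<in> ?R" for x
      proof -
        have "?T x \<bullet> ?T x \<noteq> 0" using that norm_rot[of "grad_z f x"] unfolding slope_field_def by auto
        then show ?thesis unfolding clock_def by simp
      qed
      then have "((\<lambda>x. 1) has_derivative (\<lambda>v. ?T y \<bullet> ?D\<tau> y v + ?DT y v \<bullet> ?\<tau> y)) (at y)"
        by (rule has_derivative_transform_within_open[OF 1 oR yR])
      then have "(\<lambda>v. ?T y \<bullet> ?D\<tau> y v + ?DT y v \<bullet> ?\<tau> y) = (\<lambda>v. 0)"
        by (rule has_derivative_unique[OF _ has_derivative_const])
      from fun_cong[OF this, of "(T, 0)"] show ?thesis
        unfolding DT_def Dt_def T_def t_def by (simp add: add.commute)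
    qed
    have dg: "\<bar>d \<bullet> g\<bar> \<le> e + M * (norm d)\<^sup>2"
    proof -
      have "\<bar>f (w, I) - f y - d \<bullet> g\<bar> \<le> L3 * (norm d)\<^sup>2"
        using L3(2)[OF seg] unfolding diff frechet_grad_z[OF f] g_def
        by (simp add: norm_Pair inner_commute)
      moreover have "L3 * (norm d)\<^sup>2 \<le> M * (norm d)\<^sup>2" using M by (intro mult_right_mono) auto
      ultimately show ?thesis unfolding e_def by linarith
    qed
    have bg: "\<bar>b\<bar> * norm g \<le> M * (e + M * (norm d)\<^sup>2)"
    proof -
      have "\<bar>b\<bar> * norm g = norm t * \<bar>d \<bullet> g\<bar>"
        unfolding b_def using nt g0 by (simp add: field_simps power2_eq_square)
      also have "\<dots> \<le> M * (e + M * (norm d)\<^sup>2)" using tM dg M by (intro mult_mono) auto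
      finally show ?thesis .
    qed
    have DTv: "norm (DT v) \<le> M * norm v" for v
    proof -
      have "norm (DT v) \<le> L1 * norm v"
        using L1(2)[OF Pr[OF yP(1)], of "(v, 0)"] unfolding DT_def by (simp add: norm_Pair)
      also have "\<dots> \<le> M * norm v" using M by (intro mult_right_mono) auto
      finally show ?thesis .
    qed
    have Dt: "norm Dt \<le> M * M"
    proof -
      have "norm Dt \<le> L4 * norm T" using L4(2)[OF yP(1), of "(T, 0)"] unfolding Dt_def by (simp add: norm_Pair)
      also have "\<dots> \<le> M * M" using M gM nT by (intro mult_mono) auto
      finally show ?thesis .
    qed
    have nb: "\<bar>DT g \<bullet> t + g \<bullet> Dt\<bar> \<le> norm g * (2 * M\<^sup>2)"
    proof -
      have "\<bar>DT g \<bullet> t\<bar> \<le> norm (DT g) * norm t" by (rule Cauchy_Schwarz_ineq2)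
      also have "\<dots> \<le> (M * norm g) * M" using DTv tM M by (intro mult_mono) auto
      finally have "\<bar>DT g \<bullet> t\<bar> \<le> norm g * M\<^sup>2" by (simp add: power2_eq_square mult_ac)
      moreover have "\<bar>g \<bullet> Dt\<bar> \<le> norm g * norm Dt" by (rule Cauchy_Schwarz_ineq2)
      moreover have "norm g * norm Dt \<le> norm g * M\<^sup>2"
        using Dt by (intro mult_left_mono) (auto simp: power2_eq_square)
      ultimately show ?thesis by (simp add: algebra_simps)
    qed
    have rem: "\<bar>(?T (w, I) - T - DT d) \<bullet> t\<bar> \<le> M\<^sup>2 * (norm d)\<^sup>2"
    proof -
      have "norm (?T (w, I) - T - DT d) \<le> L2 * (norm d)\<^sup>2"
        using L2(2)[OF seg] unfolding diff T_def DT_def by (simp add: norm_Pair)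
      also have "\<dots> \<le> M * (norm d)\<^sup>2" using M by (intro mult_right_mono) auto
      finally have "norm (?T (w, I) - T - DT d) * norm t \<le> (M * (norm d)\<^sup>2) * M"
        using tM M by (intro mult_mono) auto
      then show ?thesis
        using Cauchy_Schwarz_ineq2[of "?T (w, I) - T - DT d" t] by (simp add: power2_eq_square mult_ac)
    qed
    have split: "DT d \<bullet> t + d \<bullet> Dt = b * (DT g \<bullet> t + g \<bullet> Dt)"
    proof -
      have "DT d = (d \<bullet> t) *\<^sub>R DT T + b *\<^sub>R DT g"
        using arg_cong[OF dec, of DT] by (simp only: linear_add[OF lin] linear_scale[OF lin])
      moreover have "d \<bullet> Dt = (d \<bullet> t) * (T \<bullet> Dt) + b * (g \<bullet> Dt)"
        using arg_cong[OF dec, of "\<lambda>v. v \<bullet> Dt"] by (simp only: inner_add_left inner_scaleR_left)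
      ultimately have "DT d \<bullet> t + d \<bullet> Dt = (d \<bullet> t) * (DT T \<bullet> t + T \<bullet> Dt) + b * (DT g \<bullet> t + g \<bullet> Dt)"
        by (simp add: inner_add_left algebra_simps)
      then show ?thesis using shift by simp
    qed
    have lin_part: "\<bar>DT d \<bullet> t + d \<bullet> Dt\<bar> \<le> 2 * M ^ 3 * (e + M * (norm d)\<^sup>2)"
    proof -
      have "\<bar>DT d \<bullet> t + d \<bullet> Dt\<bar> \<le> \<bar>b\<bar> * (norm g * (2 * M\<^sup>2))"
        unfolding split abs_mult by (rule mult_left_mono[OF nb abs_ge_zero])
      also have "\<dots> = (\<bar>b\<bar> * norm g) * (2 * M\<^sup>2)" by simp
      also have "\<dots> \<le> (M * (e + M * (norm d)\<^sup>2)) * (2 * M\<^sup>2)"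
        by (rule mult_right_mono[OF bg]) simp
      also have "\<dots> = 2 * M ^ 3 * (e + M * (norm d)\<^sup>2)" by (simp add: power2_eq_square power3_eq_cube)
      finally show ?thesis .
    qed
    have pw: "M \<le> M ^ 4" "M\<^sup>2 \<le> M ^ 4" "M ^ 3 \<le> M ^ 4" "1 \<le> M ^ 4"
      using M(1) power_increasing[of 1 4 M] power_increasing[of 2 4 M] power_increasing[of 3 4 M]
        one_le_power[of M 4] by auto
    have e0: "e \<ge> 0" unfolding e_def by simp
    have "\<bar>(?T (w, I) - T) \<bullet> t + d \<bullet> Dt\<bar> \<le> 3 * M ^ 4 * (e + (norm d)\<^sup>2)"
    proof -
      have "(?T (w, I) - T) \<bullet> t + d \<bullet> Dt = (?T (w, I) - T - DT d) \<bullet> t + (DT d \<bullet> t + d \<bullet> Dt)"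
        by (simp add: inner_diff_left)
      then have "\<bar>(?T (w, I) - T) \<bullet> t + d \<bullet> Dt\<bar> \<le> M\<^sup>2 * (norm d)\<^sup>2 + 2 * M ^ 3 * (e + M * (norm d)\<^sup>2)"
        using rem lin_part by linarith
      also have "\<dots> = 2 * M ^ 3 * e + (M\<^sup>2 + 2 * M ^ 4) * (norm d)\<^sup>2"
        by (simp add: algebra_simps eval_nat_numeral)
      also have "\<dots> \<le> 3 * M ^ 4 * e + 3 * M ^ 4 * (norm d)\<^sup>2"
        using pw e0 by (intro add_mono mult_right_mono) auto
      finally show ?thesis by (simp add: algebra_simps)
    qed
    moreover have "norm d \<le> 3 * M ^ 4 * (\<bar>d \<bullet> t\<bar> + e + (norm d)\<^sup>2)"
    proof -
      have "norm d \<le> \<bar>d \<bullet> t\<bar> * norm T + \<bar>b\<bar> * norm g"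
        by (subst dec) (rule order_trans[OF norm_triangle_ineq], simp)
      also have "\<dots> \<le> \<bar>d \<bullet> t\<bar> * M + M * (e + M * (norm d)\<^sup>2)"
        using bg gM nT by (intro add_mono mult_left_mono) auto
      also have "\<dots> = M * \<bar>d \<bullet> t\<bar> + M * e + M\<^sup>2 * (norm d)\<^sup>2"
        by (simp add: algebra_simps power2_eq_square)
      also have "\<dots> \<le> 3 * M ^ 4 * \<bar>d \<bullet> t\<bar> + 3 * M ^ 4 * e + 3 * M ^ 4 * (norm d)\<^sup>2"
        using pw e0 by (intro add_mono mult_right_mono) auto
      finally show ?thesis by (simp add: algebra_simps)
    qed
    moreover have "norm t \<le> 3 * M ^ 4" using tM pw by linarith
    ultimately show ?thesis unfolding T_def t_def Dt_def d_def e_def y_def by blast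
  qed
  moreover have "3 * M ^ 4 \<ge> 1" using one_le_power[OF M(1), of 4] by simp
  ultimately show ?thesis by blast
qed

text \<open>The time lag grows at most, up to a constant, to \<open>T * (\<kappa> * (1 + T) + \<mu>\<^sup>2)\<close> as long as the displacement is at
  most \<open>\<mu>\<close>. For \<open>T\<close> a fixed negative power of a small parameter, \<open>\<mu>\<close> a high power and \<open>\<kappa>\<close> a
  much higher power of it, this is far below \<open>\<mu>\<close>, and the bound \<open>\<mu>\<close> perpetuates itself.\<close>

lemma forced_sol_comparison:
  assumes f: "smooth_on UNIV f" and Z: "compact Z" and \<delta>: "0 < \<delta>" "\<delta> \<le> 1"
    and reg: "\<forall>z\<in>Z. \<forall>I\<in>{0..\<delta>\<^sup>2}. grad_z f (z, I) \<noteq> 0"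
  shows "\<exists>C\<ge>1. \<forall>\<sigma> \<kappa> \<mu> T w z. 0 \<le> T \<longrightarrow> 0 \<le> \<kappa> \<longrightarrow> 0 < \<mu> \<longrightarrow> C * \<mu> \<le> 1 \<longrightarrow>
    C * (\<kappa> * (1 + T)\<^sup>2 + T * \<mu>\<^sup>2) < \<mu> \<longrightarrow>
    forced_sol f (slab \<delta> Z) \<sigma> \<kappa> T w \<longrightarrow> forced_sol f (slab \<delta> Z) \<sigma> 0 T z \<longrightarrow> w 0 = z 0 \<longrightarrow>
    (\<forall>s\<in>{0..T}. norm (snd (w s) - snd (z s)) \<le> \<mu> \<and>
      (cmod (fst (w s) - fst (z s)))\<^sup>2 \<le> C * (T * (\<mu> + \<kappa> * (1 + T))))"
proof -
  let ?T = "slope_field f" and ?\<tau> = "clock f" and ?D\<tau> = "\<lambda>y. frechet_derivative (clock f) (at y)"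
  obtain CA where CA: "CA \<ge> 1" "\<And>\<sigma> \<kappa> T w. 0 \<le> T \<Longrightarrow> forced_sol f (slab \<delta> Z) \<sigma> \<kappa> T w \<Longrightarrow>
      \<bar>(cmod (fst (w T)))\<^sup>2 - (cmod (fst (w 0)))\<^sup>2\<bar> \<le> CA * \<kappa> * T \<and>
      \<bar>f (slow (w T)) - f (slow (w 0))\<bar> \<le> CA * \<kappa> * T"
    using forced_sol_drift[OF f Z \<delta>] by blast
  obtain CB where CB: "CB \<ge> 1" "\<And>z I w. z \<in> Z \<Longrightarrow> I \<in> {0..\<delta>\<^sup>2} \<Longrightarrow> w \<in> Z \<Longrightarrow>
      \<bar>(?T (w, I) - ?T (z, I)) \<bullet> ?\<tau> (z, I) + (w - z) \<bullet> ?D\<tau> (z, I) (?T (z, I), 0)\<bar>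
        \<le> CB * (\<bar>f (w, I) - f (z, I)\<bar> + (norm (w - z))\<^sup>2) \<and>
      norm (w - z) \<le> CB * (\<bar>(w - z) \<bullet> ?\<tau> (z, I)\<bar> + \<bar>f (w, I) - f (z, I)\<bar> + (norm (w - z))\<^sup>2) \<and>
      norm (?\<tau> (z, I)) \<le> CB"
    using time_lag_estimates[OF f Z \<delta> reg] by blast
  obtain r where r: "r \<ge> 0" "\<And>z (I::real). z \<in> Z \<Longrightarrow> I \<in> {0..1} \<Longrightarrow> (z, I) \<in> cball 0 r"
    using slow_in_box[OF Z] by blast
  \<comment> \<open>the velocity of \<open>z\<^sub>2\<close> in the model as a function of \<open>slow\<close>\<close>
  define V where "V = (\<lambda>y. snd y *\<^sub>R ?T y)"
  have sV: "smooth_on UNIV V"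
    unfolding V_def
    by (rule smooth_on_scaleR[OF open_UNIV smooth_on_linear[OF open_UNIV bounded_linear_snd]
          smooth_slope_field[OF f]])
  let ?g = "\<lambda>y. (V y, f y, freq f y)"
  have "lipschitz_on_balls ?g"
    by (intro smooth_imp_lipschitz_on_balls smooth_on_Pair open_UNIV sV f smooth_freq)
  then obtain L0 where L0: "\<And>x y. x \<in> cball 0 r \<Longrightarrow> y \<in> cball 0 r \<Longrightarrow> norm (?g y - ?g x) \<le> L0 * norm (y - x)"
    unfolding lipschitz_on_balls_def by meson
  define L where "L = max L0 0"
  have L: "L \<ge> 0" unfolding L_def by simp
  have lip: "norm (V y - V x) \<le> L * norm (y - x)" "\<bar>f y - f x\<bar> \<le> L * norm (y - x)"
      "\<bar>freq f y - freq f x\<bar> \<le> L * norm (y - x)"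
    if "x \<in> cball 0 r" "y \<in> cball 0 r" for x y
  proof -
    have "L0 * norm (y - x) \<le> L * norm (y - x)" unfolding L_def by (intro mult_right_mono) auto
    then have "norm (?g y - ?g x) \<le> L * norm (y - x)" by (rule order_trans[OF L0[OF that]])
    moreover have "norm (V y - V x) \<le> norm (?g y - ?g x)" "norm (f y - f x) \<le> norm (?g y - ?g x)"
        "norm (freq f y - freq f x) \<le> norm (?g y - ?g x)"
      using norm_fst_snd_le[of "?g y - ?g x"] norm_fst_snd_le[of "snd (?g y - ?g x)"] by auto
    ultimately show "norm (V y - V x) \<le> L * norm (y - x)" "\<bar>f y - f x\<bar> \<le> L * norm (y - x)"
        "\<bar>freq f y - freq f x\<bar> \<le> L * norm (y - x)" by auto
  qed
  define c1 where "c1 = CB * ((1 + 2 * L) * CA)"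
  have CBc1: "CB * CA \<le> c1" "CB \<le> c1" "c1 \<ge> 1"
  proof -
    have "1 * CA \<le> (1 + 2 * L) * CA" using L CA(1) by (intro mult_right_mono) auto
    then have "CB * CA \<le> CB * ((1 + 2 * L) * CA)" using CB(1) by (intro mult_left_mono) auto
    then show "CB * CA \<le> c1" unfolding c1_def .
    moreover have "CB * 1 \<le> CB * CA" using CA(1) CB(1) by (intro mult_left_mono) auto
    ultimately show "CB \<le> c1" by simp
    then show "c1 \<ge> 1" using CB(1) by simp
  qed
  define C where "C = 2 * CB * c1 + 8 * (L + 1) * CA"
  have C: "C \<ge> 1" "2 * CB * c1 \<le> C" "8 * (L + 1) * CA \<le> C" "2 * CB \<le> C"
  proof -
    have 1: "0 \<le> 8 * (L + 1) * CA" using L CA by simp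
    have 2: "2 * CB * 1 \<le> 2 * CB * c1" using CB CBc1 by (intro mult_left_mono) auto
    have 3: "0 \<le> 2 * CB * c1" using CB CBc1 by simp
    show "2 * CB * c1 \<le> C" "8 * (L + 1) * CA \<le> C" "2 * CB \<le> C" using 1 2 3 unfolding C_def by linarith+
    then show "C \<ge> 1" using CB(1) by linarith
  qed
  have "norm (snd (w s) - snd (z s)) \<le> \<mu> \<and>
      (cmod (fst (w s) - fst (z s)))\<^sup>2 \<le> C * (T * (\<mu> + \<kappa> * (1 + T)))"
    if T: "0 \<le> T" and \<kappa>: "0 \<le> \<kappa>" and \<mu>: "0 < \<mu>" "C * \<mu> \<le> 1" "C * (\<kappa> * (1 + T)\<^sup>2 + T * \<mu>\<^sup>2) < \<mu>"
      and w: "forced_sol f (slab \<delta> Z) \<sigma> \<kappa> T w" and z: "forced_sol f (slab \<delta> Z) \<sigma> 0 T z"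
      and eq: "w 0 = z 0" and s: "s \<in> {0..T}" for \<sigma> \<kappa> \<mu> T w z s
  proof -
    have \<sigma>: "\<bar>\<sigma>\<bar> = 1" using w unfolding forced_sol_def by simp
    obtain \<rho> where \<rho>: "\<And>s. s \<in> {0..T} \<Longrightarrow> w s \<in> slab \<delta> Z" "\<And>s. s \<in> {0..T} \<Longrightarrow> norm (\<rho> s) \<le> \<kappa>"
       "\<And>s. s \<in> {0..T} \<Longrightarrow>
          (w has_vector_derivative \<sigma> *\<^sub>R model_field f (w s) + \<rho> s) (at s within {0..T})"
      using forced_solD[OF w] by blast
    have zZ: "z s \<in> slab \<delta> Z" if "s \<in> {0..T}" for s using z that unfolding forced_sol_def by blast
    have z': "(z has_vector_derivative \<sigma> *\<^sub>R model_field f (z s)) (at s within {0..T})"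
      if "s \<in> {0..T}" for s
      using z that unfolding forced_sol_def by fastforce
    define I0 where "I0 = (cmod (fst (z 0)))\<^sup>2"
    define y where "y s = (snd (z s), I0)" for s
    define d where "d s = snd (w s) - snd (z s)" for s
    have T0: "0 \<in> {0..T}" using T by simp
    have I0: "I0 \<in> {0..\<delta>\<^sup>2}" "I0 \<in> {0..1}" unfolding I0_def by (rule slab_slow[OF zZ[OF T0] \<delta>])+
    have slow_z: "slow (z s) = y s" "f (y s) = f (y 0)" if "s \<in> {0..T}" for s
    proof -
      have "0 \<le> s" "s \<le> T" using that by auto
      have a: "\<bar>(cmod (fst (z s)))\<^sup>2 - (cmod (fst (z 0)))\<^sup>2\<bar> \<le> CA * 0 * s"
          "\<bar>f (slow (z s)) - f (slow (z 0))\<bar> \<le> CA * 0 * s"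
        using CA(2)[OF \<open>0 \<le> s\<close> forced_sol_restrict[OF z \<open>s \<le> T\<close>]] by blast+
      then show "slow (z s) = y s" unfolding slow_def y_def I0_def by simp
      moreover have "slow (z 0) = y 0" unfolding slow_def y_def I0_def by simp
      ultimately show "f (y s) = f (y 0)" using a(2) by simp
    qed
    have drift: "\<bar>(cmod (fst (w s)))\<^sup>2 - I0\<bar> \<le> CA * \<kappa> * T" "\<bar>f (slow (w s)) - f (y 0)\<bar> \<le> CA * \<kappa> * T"
      if "s \<in> {0..T}" for s
    proof -
      have "0 \<le> s" "s \<le> T" using that by auto
      have "CA * \<kappa> * s \<le> CA * \<kappa> * T" using \<open>s \<le> T\<close> CA(1) \<kappa> by (intro mult_left_mono) auto
      then show "\<bar>(cmod (fst (w s)))\<^sup>2 - I0\<bar> \<le> CA * \<kappa> * T" "\<bar>f (slow (w s)) - f (y 0)\<bar> \<le> CA * \<kappa> * T"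
        using CA(2)[OF \<open>0 \<le> s\<close> forced_sol_restrict[OF w \<open>s \<le> T\<close>]] slow_z(1)[OF T0]
        unfolding eq I0_def by auto
    qed
    have wZ: "snd (w s) \<in> Z" and zZ': "snd (z s) \<in> Z" if "s \<in> {0..T}" for s
      using slab_slow(3)[OF \<rho>(1)[OF that] \<delta>] slab_slow(3)[OF zZ[OF that] \<delta>] .
    have box: "slow (w s) \<in> cball 0 r" "(snd (w s), I0) \<in> cball 0 r" "y s \<in> cball 0 r" if "s \<in> {0..T}" for s
      unfolding slow_def y_def
      by (intro r(2) wZ zZ' I0(2) that slab_slow(2)[OF \<rho>(1)[OF that] \<delta>])+
    have near: "norm (slow (w s) - (snd (w s), I0)) \<le> CA * \<kappa> * T" if "s \<in> {0..T}" for s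
      using drift(1)[OF that] by (simp add: slow_def norm_Pair)
    have CAT: "0 \<le> CA * \<kappa> * T" using CA \<kappa> T by simp
    have e: "\<bar>f (snd (w s), I0) - f (y s)\<bar> \<le> (1 + L) * (CA * \<kappa> * T)" if "s \<in> {0..T}" for s
    proof -
      have "\<bar>f (slow (w s)) - f (snd (w s), I0)\<bar> \<le> L * (CA * \<kappa> * T)"
        using lip(2)[OF box(2,1)[OF that]] mult_left_mono[OF near[OF that] L] by linarith
      then show ?thesis using drift(2)[OF that] slow_z(2)[OF that] by (simp add: algebra_simps)
    qed
    \<comment> \<open>freezing \<open>I\<close> at its initial value in the equation of \<open>w\<close> costs another force \<open>\<rho>'\<close>\<close>
    define \<rho>' where "\<rho>' s = \<sigma> *\<^sub>R (V (slow (w s)) - V (snd (w s), I0)) + snd (\<rho> s)" for s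
    have \<rho>': "norm (\<rho>' s) \<le> L * (CA * \<kappa> * T) + \<kappa>" if "s \<in> {0..T}" for s
    proof -
      have "norm (V (slow (w s)) - V (snd (w s), I0)) \<le> L * (CA * \<kappa> * T)"
        using lip(1)[OF box(2,1)[OF that]] mult_left_mono[OF near[OF that] L] by linarith
      moreover have "norm (snd (\<rho> s)) \<le> \<kappa>" using norm_fst_snd_le(2) \<rho>(2)[OF that] order_trans by blast
      ultimately show ?thesis
        unfolding \<rho>'_def using \<sigma> norm_triangle_ineq[of "\<sigma> *\<^sub>R (V (slow (w s)) - V (snd (w s), I0))" "snd (\<rho> s)"]
        by simp
    qed
    have field_V: "snd (model_field f x) = V (slow x)" for x
      by (simp add: model_field_def V_def slope_field_def)
    have dz: "((\<lambda>s. snd (z s)) has_vector_derivative \<sigma> *\<^sub>R I0 *\<^sub>R ?T (y s)) (at s within {0..T})"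
      if "s \<in> {0..T}" for s
      using bounded_linear.has_vector_derivative[OF bounded_linear_snd z'[OF that]]
      by (simp add: field_V slow_z[OF that] V_def) (simp add: y_def)
    have dw: "((\<lambda>s. snd (w s)) has_vector_derivative \<sigma> *\<^sub>R I0 *\<^sub>R ?T (snd (w s), I0) + \<rho>' s) (at s within {0..T})"
      if "s \<in> {0..T}" for s
      using bounded_linear.has_vector_derivative[OF bounded_linear_snd \<rho>(3)[OF that]]
      by (simp add: field_V \<rho>'_def V_def algebra_simps)
    have dd: "(d has_vector_derivative (\<sigma> * I0) *\<^sub>R (?T (snd (w s), I0) - ?T (y s)) + \<rho>' s) (at s within {0..T})"
      if "s \<in> {0..T}" for s
      using has_vector_derivative_diff[OF dw[OF that] dz[OF that]] unfolding d_def[abs_def]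
      by (simp add: algebra_simps)
    have s\<tau>: "(?\<tau> has_derivative ?D\<tau> (y s)) (at (y s))" if "s \<in> {0..T}" for s
      by (rule smooth_on_has_derivative[OF smooth_clock[OF f]])
        (use bspec[OF bspec[OF reg zZ'[OF that]] I0(1)] in \<open>simp add: y_def\<close>)
    have dy: "(y has_vector_derivative (\<sigma> *\<^sub>R I0 *\<^sub>R ?T (y s), 0)) (at s within {0..T})" if "s \<in> {0..T}" for s
      unfolding y_def[abs_def]
      using has_vector_derivative_Pair[OF dz[OF that] has_vector_derivative_const] by (simp add: y_def)
    have d\<tau>: "((\<lambda>s. ?\<tau> (y s)) has_vector_derivative (\<sigma> * I0) *\<^sub>R ?D\<tau> (y s) (?T (y s), 0)) (at s within {0..T})"
      if "s \<in> {0..T}" for s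
    proof -
      have "linear (?D\<tau> (y s))" using s\<tau>[OF that] has_derivative_linear by blast
      from linear_scale[OF this, of "\<sigma> * I0" "(?T (y s), 0)"] show ?thesis
        using has_vector_derivative_compose_at[OF s\<tau>[OF that] dy[OF that]] by simp
    qed
    define \<alpha> where "\<alpha> s = d s \<bullet> ?\<tau> (y s)" for s
    define E where "E s = (?T (snd (w s), I0) - ?T (y s)) \<bullet> ?\<tau> (y s) + d s \<bullet> ?D\<tau> (y s) (?T (y s), 0)" for s
    have d\<alpha>: "(\<alpha> has_vector_derivative \<sigma> * I0 * E s + \<rho>' s \<bullet> ?\<tau> (y s)) (at s within {0..T})"
      if "s \<in> {0..T}" for s
      using bounded_bilinear.has_vector_derivative[OF bounded_bilinear_inner dd[OF that] d\<tau>[OF that]]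
      unfolding \<alpha>_def[abs_def] E_def by (simp add: inner_add_left algebra_simps)
    have lag: "\<bar>E s\<bar> \<le> CB * (\<bar>f (snd (w s), I0) - f (y s)\<bar> + (norm (d s))\<^sup>2) \<and>
        norm (d s) \<le> CB * (\<bar>\<alpha> s\<bar> + \<bar>f (snd (w s), I0) - f (y s)\<bar> + (norm (d s))\<^sup>2) \<and>
        norm (?\<tau> (y s)) \<le> CB" if "s \<in> {0..T}" for s
      using CB(2)[OF zZ'[OF that] I0(1) wZ[OF that]] unfolding E_def \<alpha>_def y_def d_def .
    have small: "norm (d t) < \<mu>" if t: "t \<in> {0..T}" and ih: "\<forall>s\<in>{0..t}. norm (d s) \<le> \<mu>" for t
    proof -
      have st: "s \<in> {0..T}" if "s \<in> {0..t}" for s using that t by auto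
      have "\<bar>\<alpha> t - \<alpha> 0\<bar> \<le> (c1 * (\<kappa> * (1 + T) + \<mu>\<^sup>2)) * t"
      proof (rule real_mvt_increment)
        show "0 \<le> t" using t by simp
        fix s assume s: "s \<in> {0..t}"
        show "(\<alpha> has_vector_derivative \<sigma> * I0 * E s + \<rho>' s \<bullet> ?\<tau> (y s)) (at s within {0..t})"
          using has_vector_derivative_within_subset[OF d\<alpha>[OF st[OF s]]] t by simp
        have "(norm (d s))\<^sup>2 \<le> \<mu>\<^sup>2" using ih s by (intro power_mono) auto
        then have "\<bar>f (snd (w s), I0) - f (y s)\<bar> + (norm (d s))\<^sup>2 \<le> (1 + L) * (CA * \<kappa> * T) + \<mu>\<^sup>2"
          using e[OF st[OF s]] by linarith
        then have "CB * (\<bar>f (snd (w s), I0) - f (y s)\<bar> + (norm (d s))\<^sup>2) \<le> CB * ((1 + L) * (CA * \<kappa> * T) + \<mu>\<^sup>2)"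
          using CB(1) by (intro mult_left_mono) auto
        then have Es: "\<bar>E s\<bar> \<le> CB * ((1 + L) * (CA * \<kappa> * T) + \<mu>\<^sup>2)"
          using lag[OF st[OF s]] by linarith
        have "\<bar>\<sigma> * I0 * E s\<bar> \<le> \<bar>E s\<bar>"
          using \<sigma> I0(2) by (simp add: abs_mult mult_left_le_one_le)
        moreover have "\<bar>\<rho>' s \<bullet> ?\<tau> (y s)\<bar> \<le> (L * (CA * \<kappa> * T) + \<kappa>) * CB"
          using lag[OF st[OF s]] \<rho>'[OF st[OF s]] CAT L \<kappa>
          by (intro order_trans[OF Cauchy_Schwarz_ineq2] mult_mono) auto
        ultimately have "\<bar>\<sigma> * I0 * E s + \<rho>' s \<bullet> ?\<tau> (y s)\<bar>
            \<le> CB * ((1 + L) * (CA * \<kappa> * T) + \<mu>\<^sup>2) + (L * (CA * \<kappa> * T) + \<kappa>) * CB"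
          using Es by linarith
        also have "\<dots> = CB * ((1 + 2 * L) * CA * (\<kappa> * T)) + CB * \<kappa> + CB * \<mu>\<^sup>2"
          by (simp add: algebra_simps)
        also have "\<dots> \<le> c1 * (\<kappa> * T) + c1 * \<kappa> + c1 * \<mu>\<^sup>2"
          using CBc1 \<kappa> unfolding c1_def by (intro add_mono mult_right_mono) (auto simp: mult.assoc)
        also have "\<dots> = c1 * (\<kappa> * (1 + T) + \<mu>\<^sup>2)" by (simp add: algebra_simps)
        finally show "\<bar>\<sigma> * I0 * E s + \<rho>' s \<bullet> ?\<tau> (y s)\<bar> \<le> c1 * (\<kappa> * (1 + T) + \<mu>\<^sup>2)" .
      qed
      moreover have "\<alpha> 0 = 0" unfolding \<alpha>_def d_def eq by simp
      moreover have "(c1 * (\<kappa> * (1 + T) + \<mu>\<^sup>2)) * t \<le> (c1 * (\<kappa> * (1 + T) + \<mu>\<^sup>2)) * T"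
        using t CBc1(3) \<kappa> T by (intro mult_left_mono) auto
      ultimately have \<alpha>t: "\<bar>\<alpha> t\<bar> \<le> (c1 * (\<kappa> * (1 + T) + \<mu>\<^sup>2)) * T" by linarith
      have et: "\<bar>f (snd (w t), I0) - f (y t)\<bar> \<le> c1 * (\<kappa> * (1 + T))"
      proof -
        have "(1 + L) * CA \<le> (1 + 2 * L) * CA" using L CA(1) by (intro mult_right_mono) auto
        also have "1 * \<dots> \<le> CB * \<dots>" using CB(1) L CA(1) by (intro mult_right_mono) auto
        finally have "(1 + L) * CA \<le> c1" unfolding c1_def by simp
        then have "((1 + L) * CA) * (\<kappa> * T) \<le> c1 * (\<kappa> * (1 + T))"
          using \<kappa> T CBc1(3) by (intro mult_mono) auto
        then show ?thesis using e[OF t] by (simp add: mult_ac)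
      qed
      have dt: "norm (d t) \<le> \<mu>" using ih t by auto
      have "(norm (d t))\<^sup>2 \<le> \<mu> * norm (d t)"
        unfolding power2_eq_square using dt by (intro mult_right_mono) auto
      then have "\<bar>\<alpha> t\<bar> + \<bar>f (snd (w t), I0) - f (y t)\<bar> + (norm (d t))\<^sup>2
          \<le> (c1 * (\<kappa> * (1 + T) + \<mu>\<^sup>2)) * T + c1 * (\<kappa> * (1 + T)) + \<mu> * norm (d t)"
        using \<alpha>t et by linarith
      also have "\<dots> = c1 * (\<kappa> * (1 + T)\<^sup>2 + T * \<mu>\<^sup>2) + \<mu> * norm (d t)"
        by (simp add: algebra_simps power2_eq_square)
      finally have "CB * (\<bar>\<alpha> t\<bar> + \<bar>f (snd (w t), I0) - f (y t)\<bar> + (norm (d t))\<^sup>2)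
          \<le> CB * (c1 * (\<kappa> * (1 + T)\<^sup>2 + T * \<mu>\<^sup>2) + \<mu> * norm (d t))"
        using CB(1) by (intro mult_left_mono) auto
      then have 1: "norm (d t) \<le> CB * c1 * (\<kappa> * (1 + T)\<^sup>2 + T * \<mu>\<^sup>2) + (CB * \<mu>) * norm (d t)"
        using lag[OF t] by (simp add: algebra_simps)
      have "2 * CB * \<mu> \<le> C * \<mu>" using C(4) \<mu>(1) by (intro mult_right_mono) auto
      then have "(CB * \<mu>) * norm (d t) \<le> (1 / 2) * norm (d t)"
        using \<mu>(2) by (intro mult_right_mono) auto
      then have "norm (d t) \<le> 2 * CB * c1 * (\<kappa> * (1 + T)\<^sup>2 + T * \<mu>\<^sup>2)" using 1 by linarith
      also have "\<dots> \<le> C * (\<kappa> * (1 + T)\<^sup>2 + T * \<mu>\<^sup>2)"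
        using C(2) \<kappa> T by (intro mult_right_mono) auto
      finally show ?thesis using \<mu>(3) by linarith
    qed
    have dcont: "continuous_on {0..T} d"
      unfolding d_def[abs_def]
      by (intro continuous_intros forced_sol_continuous[OF w] forced_sol_continuous[OF z])
    have dle: "\<forall>s\<in>{0..T}. d s \<in> cball 0 \<mu>"
    proof (rule curve_confined[OF dcont _ closed_cball open_ball ball_subset_cball])
      show "d 0 \<in> cball 0 \<mu>" using eq \<mu>(1) unfolding d_def by simp
      show "d t \<in> ball 0 \<mu>" if "t \<in> {0..T}" "\<forall>s\<in>{0..t}. d s \<in> cball 0 \<mu>" for t
        using small[OF that(1)] that(2) by simp
    qed
    define x where "x s = fst (w s) - fst (z s)" for s
    define x' where "x' s = \<sigma> *\<^sub>R fst (model_field f (w s)) + fst (\<rho> s) - \<sigma> *\<^sub>R fst (model_field f (z s))" for s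
    have dx: "(x has_vector_derivative x' s) (at s within {0..T})" if "s \<in> {0..T}" for s
      using has_vector_derivative_diff[OF bounded_linear.has_vector_derivative[OF bounded_linear_fst \<rho>(3)[OF that]]
          bounded_linear.has_vector_derivative[OF bounded_linear_fst z'[OF that]]]
      unfolding x_def[abs_def] x'_def by simp
    have "\<bar>x s \<bullet> x s - x 0 \<bullet> x 0\<bar> \<le> (8 * (L + 1) * CA * (\<mu> + \<kappa> * (1 + T))) * s"
    proof (rule real_mvt_increment)
      show "0 \<le> s" using s by simp
      fix t assume "t \<in> {0..s}"
      then have t: "t \<in> {0..T}" using s by auto
      show "((\<lambda>s. x s \<bullet> x s) has_vector_derivative x t \<bullet> x' t + x' t \<bullet> x t) (at t within {0..s})"
        using has_vector_derivative_within_subset[OF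
            bounded_bilinear.has_vector_derivative[OF bounded_bilinear_inner dx[OF t] dx[OF t]]] s by simp
      \<comment> \<open>the common rotation does not change the distance\<close>
      define q where "q = (freq f (slow (w t)) - freq f (y t)) *\<^sub>R (\<sigma> *\<^sub>R (- 2 * \<i> * fst (w t))) + fst (\<rho> t)"
      have rotation: "x t \<bullet> (complex_of_real c * (\<i> * x t)) = 0" for c
        by (simp add: inner_complex_def algebra_simps)
      have "x' t = complex_of_real (- 2 * \<sigma> * freq f (y t)) * (\<i> * x t) + q"
        unfolding x'_def model_field_def q_def x_def slow_z(1)[OF t]
        by (simp add: scaleR_conv_of_real algebra_simps)
      then have xx': "x t \<bullet> x' t = x t \<bullet> q" using rotation by (simp only: inner_add_right)
      have le1: "cmod (fst (w t)) \<le> 1" "cmod (fst (z t)) \<le> 1"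
        using slab_slow(4)[OF \<rho>(1)[OF t] \<delta>] slab_slow(4)[OF zZ[OF t] \<delta>] .
      have "norm (slow (w t) - y t) \<le> norm (slow (w t) - (snd (w t), I0)) + norm ((snd (w t), I0) - y t)"
        using norm_triangle_ineq[of "slow (w t) - (snd (w t), I0)" "(snd (w t), I0) - y t"] by simp
      also have "\<dots> \<le> CA * \<kappa> * T + \<mu>"
        using near[OF t] dle t by (intro add_mono) (auto simp: y_def d_def norm_Pair)
      finally have "L * norm (slow (w t) - y t) \<le> L * (CA * \<kappa> * T + \<mu>)" using L by (rule mult_left_mono)
      then have fr: "\<bar>freq f (slow (w t)) - freq f (y t)\<bar> \<le> L * (CA * \<kappa> * T + \<mu>)"
        using lip(3)[OF box(3,1)[OF t]] by linarith
      have "norm q \<le> \<bar>freq f (slow (w t)) - freq f (y t)\<bar> * (2 * cmod (fst (w t))) + norm (fst (\<rho> t))"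
        unfolding q_def using \<sigma> by (intro order_trans[OF norm_triangle_ineq]) (simp add: norm_mult abs_mult)
      also have "\<dots> \<le> (L * (CA * \<kappa> * T + \<mu>)) * (2 * 1) + \<kappa>"
        using fr le1 order_trans[OF norm_fst_snd_le(1) \<rho>(2)[OF t]] L CAT \<mu>(1)
        by (intro add_mono mult_mono) auto
      also have "\<dots> \<le> 2 * (L + 1) * CA * (\<mu> + \<kappa> * (1 + T))"
      proof -
        have "L * \<mu> \<le> ((L + 1) * CA) * \<mu>"
        proof (rule mult_right_mono)
          have "L \<le> (L + 1) * 1" by simp
          also have "\<dots> \<le> (L + 1) * CA" using CA(1) L by (intro mult_left_mono) auto
          finally show "L \<le> (L + 1) * CA" .
        qed (use \<mu> in simp)
        moreover have "L * (CA * \<kappa> * T) \<le> ((L + 1) * CA) * (\<kappa> * T)"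
          using mult_right_mono[of L "L + 1" "CA * \<kappa> * T"] CAT by (simp add: mult_ac)
        moreover have "1 * \<kappa> \<le> ((L + 1) * CA) * \<kappa>"
        proof (rule mult_right_mono)
          show "1 \<le> (L + 1) * CA" using mult_mono[of 1 "L + 1" 1 CA] L CA(1) by simp
        qed (use \<kappa> in simp)
        ultimately show ?thesis using \<kappa> by (simp add: algebra_simps)
      qed
      finally have nq: "norm q \<le> 2 * (L + 1) * CA * (\<mu> + \<kappa> * (1 + T))" .
      have "norm (x t) \<le> 2" unfolding x_def using le1 norm_triangle_ineq4[of "fst (w t)" "fst (z t)"] by linarith
      then have "norm (x t) * norm q \<le> 2 * (2 * (L + 1) * CA * (\<mu> + \<kappa> * (1 + T)))"
        using nq by (intro mult_mono) auto
      then have xq: "\<bar>x t \<bullet> q\<bar> \<le> 4 * (L + 1) * CA * (\<mu> + \<kappa> * (1 + T))"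
        using Cauchy_Schwarz_ineq2[of "x t" q] by linarith
      have "x t \<bullet> x' t + x' t \<bullet> x t = 2 * (x t \<bullet> q)" using xx' by (simp add: inner_commute)
      then have "\<bar>x t \<bullet> x' t + x' t \<bullet> x t\<bar> = 2 * \<bar>x t \<bullet> q\<bar>" by (simp add: abs_mult)
      also have "\<dots> \<le> 2 * (4 * (L + 1) * CA * (\<mu> + \<kappa> * (1 + T)))" using xq by (rule mult_left_mono) simp
      also have "\<dots> = 8 * (L + 1) * CA * (\<mu> + \<kappa> * (1 + T))" by simp
      finally show "\<bar>x t \<bullet> x' t + x' t \<bullet> x t\<bar> \<le> 8 * (L + 1) * CA * (\<mu> + \<kappa> * (1 + T))" .
    qed
    also have "\<dots> \<le> (C * (\<mu> + \<kappa> * (1 + T))) * T"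
      using s C \<mu>(1) \<kappa> T by (intro mult_mono mult_right_mono) auto
    finally have "(cmod (x s))\<^sup>2 \<le> C * (T * (\<mu> + \<kappa> * (1 + T)))"
      unfolding power2_norm_eq_inner by (simp add: x_def eq mult_ac)
    then show ?thesis using dle s unfolding d_def x_def by auto
  qed
  then show ?thesis using C(1) by (intro exI[of _ C]) blast
qed

section \<open>The normal form transports the flows to the model\<close>

locale magnetic_normal_form =
  fixes A :: "real^2 \<Rightarrow> real^2" and S :: "model set" and \<Phi> :: "model \<Rightarrow> phase"
    and f :: "(real^2) \<times> real \<Rightarrow> real"
  assumes A_smooth: "smooth_on UNIV A" and nf: "normal_form A S \<Phi> f"
begin

abbreviation \<Psi> :: "phase \<Rightarrow> model" where "\<Psi> \<equiv> inv_into S \<Phi>"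

text \<open>The map \<open>\<phi>\<close> of the normal form.\<close>

definition base :: "real^2 \<Rightarrow> real^2" where "base q = snd (\<Psi> (q, A q))"

abbreviation H :: "phase \<Rightarrow> real" where "H \<equiv> mag_ham A"
abbreviation K :: "phase \<Rightarrow> real" where "K \<equiv> normal_ham S \<Phi> f"
abbreviation B :: "real^2 \<Rightarrow> real" where "B \<equiv> mag_field A"
abbreviation U :: "phase set" where "U \<equiv> \<Phi> ` S"

definition remainder :: "model \<Rightarrow> real" where "remainder w = H (\<Phi> w) - model_ham f w"

lemma open_S: "open S" and open_U: "open U" and \<Phi>_inj: "inj_on \<Phi> S"
  and \<Phi>_smooth: "smooth_on S \<Phi>" and \<Psi>_smooth: "smooth_on U \<Psi>"
  and f_smooth: "smooth_on UNIV f" and symplectic: "symplectic_on S \<Phi>"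
  using nf unfolding normal_form_def diffeo_on_def bij_betw_def by blast+

lemma \<Psi>_\<Phi>: "z \<in> S \<Longrightarrow> \<Psi> (\<Phi> z) = z"
  using \<Phi>_inj by (rule inv_into_f_f)

lemma \<Phi>_\<Psi>: "x \<in> U \<Longrightarrow> \<Phi> (\<Psi> x) = x" and \<Psi>_in: "x \<in> U \<Longrightarrow> \<Psi> x \<in> S"
  by (rule f_inv_into_f, assumption) (rule inv_into_into)

lemma zero_energy: "(q, A q) \<in> U" "\<Psi> (q, A q) = (0, base q)" "f (base q, 0) = \<bar>B q\<bar>"
proof -
  have "(q, A q) \<in> U \<and> fst (\<Psi> (q, A q)) = 0 \<and> f (base q, 0) = \<bar>B q\<bar>"
    using nf unfolding normal_form_def base_def Let_def by blast
  then show "(q, A q) \<in> U" "f (base q, 0) = \<bar>B q\<bar>" "\<Psi> (q, A q) = (0, base q)"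
    by (auto simp: base_def prod_eq_iff)
qed

text \<open>Since \<open>\<Phi>\<close> maps \<open>{z\<^sub>1 = 0}\<close> onto \<open>{H = 0}\<close>, which is the graph of \<open>A\<close>, the map \<open>base\<close> reaches the
  whole slice \<open>z\<^sub>1 = 0\<close> of \<open>S\<close>. So a subset of the slice is compact when it corresponds to a compact
  set of points \<open>q\<close>.\<close>

lemma base_onto:
  assumes "(0, z) \<in> S" obtains q where "z = base q"
proof -
  have "\<Phi> (0, z) \<in> {x. H x = 0}"
    using nf assms unfolding normal_form_def by (metis (mono_tags, lifting) fst_conv imageI mem_Collect_eq)
  then have "snd (\<Phi> (0, z)) = A (fst (\<Phi> (0, z)))" by (simp add: mag_ham_def)
  then have "\<Phi> (0, z) = (fst (\<Phi> (0, z)), A (fst (\<Phi> (0, z))))" by (metis prod.collapse)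
  then have "(0, z) = \<Psi> (fst (\<Phi> (0, z)), A (fst (\<Phi> (0, z))))" using \<Psi>_\<Phi>[OF assms] by metis
  then show ?thesis using that zero_energy(2) by simp
qed

lemma base_in: "(0, base q) \<in> S"
  using \<Psi>_in[OF zero_energy(1)[of q]] by (simp only: zero_energy(2))

lemma graph_smooth: "smooth_on UNIV (\<lambda>q. (q, A q))"
  by (rule smooth_on_Pair[OF open_UNIV smooth_on_linear[OF open_UNIV bounded_linear_ident] A_smooth])

lemma base_smooth: "smooth_on UNIV base"
proof -
  have "smooth_on UNIV (\<lambda>q. \<Psi> (q, A q))"
    by (rule smooth_on_compose[OF open_UNIV open_U _ \<Psi>_smooth graph_smooth]) (use zero_energy(1) in blast)
  then have "smooth_on UNIV (\<lambda>q. snd (\<Psi> (q, A q)))"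
    by (rule smooth_on_linear_comp[OF open_UNIV bounded_linear_snd])
  then show ?thesis unfolding base_def[abs_def] .
qed

abbreviation D\<Phi> :: "model \<Rightarrow> model \<Rightarrow> phase" where "D\<Phi> w \<equiv> frechet_derivative \<Phi> (at w)"
abbreviation D\<Psi> :: "phase \<Rightarrow> phase \<Rightarrow> model" where "D\<Psi> x \<equiv> frechet_derivative \<Psi> (at x)"

lemma derivative_inverses:
  assumes w: "w \<in> S"
  shows "D\<Psi> (\<Phi> w) (D\<Phi> w v) = v" and "D\<Phi> w (D\<Psi> (\<Phi> w) u) = u"
proof -
  have x: "\<Phi> w \<in> U" using w by simp
  have 1: "(\<Phi> has_derivative D\<Phi> w) (at w)" by (rule smooth_on_has_derivative[OF \<Phi>_smooth w])
  have 2: "(\<Psi> has_derivative D\<Psi> (\<Phi> w)) (at (\<Phi> w))" by (rule smooth_on_has_derivative[OF \<Psi>_smooth x])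
  have "((\<lambda>z. z) has_derivative (\<lambda>v. D\<Psi> (\<Phi> w) (D\<Phi> w v))) (at w)"
    by (rule has_derivative_transform_within_open[OF has_derivative_compose[OF 1 2] open_S w \<Psi>_\<Phi>])
  from has_derivative_unique[OF this has_derivative_ident] show "D\<Psi> (\<Phi> w) (D\<Phi> w v) = v" by metis
  have 3: "(\<Phi> has_derivative D\<Phi> w) (at (\<Psi> (\<Phi> w)))" unfolding \<Psi>_\<Phi>[OF w] by (rule 1)
  have "((\<lambda>z. z) has_derivative (\<lambda>u. D\<Phi> w (D\<Psi> (\<Phi> w) u))) (at (\<Phi> w))"
    by (rule has_derivative_transform_within_open[OF has_derivative_compose[OF 2 3] open_U x \<Phi>_\<Psi>])
  from has_derivative_unique[OF this has_derivative_ident] show "D\<Phi> w (D\<Psi> (\<Phi> w) u) = u" by metis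
qed

lemma omega_pull:
  "w \<in> S \<Longrightarrow> omega_phase (D\<Phi> w u) (D\<Phi> w v) = omega_model u v"
  using symplectic unfolding symplectic_on_def by blast

lemma normal_field:
  assumes w: "w \<in> S"
  shows "ham_field K (\<Phi> w) = D\<Phi> w (model_field f w)"
proof (rule omega_phase_nondegenerate)
  fix u
  have x: "\<Phi> w \<in> U" using w by simp
  have m: "(model_ham f has_derivative (\<lambda>v. - omega_model (model_field f w) v)) (at (\<Psi> (\<Phi> w)))"
    unfolding \<Psi>_\<Phi>[OF w] by (rule model_ham_has_derivative[OF f_smooth])
  have "(K has_derivative (\<lambda>u. - omega_model (model_field f w) (D\<Psi> (\<Phi> w) u))) (at (\<Phi> w))"
    unfolding normal_ham_def[abs_def]
    by (rule has_derivative_compose[OF smooth_on_has_derivative[OF \<Psi>_smooth x] m])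
  from omega_ham_field[OF this]
  have "omega_phase (ham_field K (\<Phi> w)) u = omega_model (model_field f w) (D\<Psi> (\<Phi> w) u)"
    by simp
  also have "\<dots> = omega_phase (D\<Phi> w (model_field f w)) (D\<Phi> w (D\<Psi> (\<Phi> w) u))"
    by (rule omega_pull[OF w, symmetric])
  finally show "omega_phase (ham_field K (\<Phi> w)) u = omega_phase (D\<Phi> w (model_field f w)) u"
    by (simp only: derivative_inverses(2)[OF w])
qed

lemma remainder_smooth: "smooth_on S remainder"
proof -
  have "smooth_on S (\<lambda>w. H (\<Phi> w))"
    by (rule smooth_on_compose[OF open_S open_UNIV _ smooth_mag_ham[OF A_smooth] \<Phi>_smooth]) simp
  then show ?thesis
    unfolding remainder_def[abs_def]
    by (rule smooth_on_diff[OF open_S _ smooth_on_subset[OF subset_UNIV smooth_model_ham[OF f_smooth]]])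
qed

text \<open>Both fields are given by the same symplectic form, so their difference represents the
  derivative of the remainder.\<close>

lemma pulled_back_field:
  assumes w: "w \<in> S" and c: "\<And>v. \<bar>frechet_derivative remainder (at w) v\<bar> \<le> c * norm v"
  shows "norm (D\<Psi> (\<Phi> w) (ham_field H (\<Phi> w)) - model_field f w) \<le> c"
proof (rule norm_le_omega_model)
  fix v
  let ?H = H and ?Y = "D\<Psi> (\<Phi> w) (ham_field H (\<Phi> w))"
  let ?DH = "frechet_derivative ?H (at (\<Phi> w))"
  have H: "(?H has_derivative ?DH) (at (\<Phi> w))"
    by (rule smooth_on_has_derivative[OF smooth_mag_ham[OF A_smooth] UNIV_I])
  have "(remainder has_derivative (\<lambda>v. ?DH (D\<Phi> w v) - - omega_model (model_field f w) v)) (at w)"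
    unfolding remainder_def[abs_def]
    by (rule has_derivative_diff[OF has_derivative_compose[OF smooth_on_has_derivative[OF \<Phi>_smooth w] H]
          model_ham_has_derivative[OF f_smooth]])
  from fun_cong[OF frechet_derivative_at[OF this], of v]
  have R: "frechet_derivative remainder (at w) v = ?DH (D\<Phi> w v) + omega_model (model_field f w) v" by simp
  have "omega_model ?Y v = omega_phase (D\<Phi> w ?Y) (D\<Phi> w v)" by (rule omega_pull[OF w, symmetric])
  also have "\<dots> = omega_phase (ham_field ?H (\<Phi> w)) (D\<Phi> w v)"
    by (simp only: derivative_inverses(2)[OF w])
  also have "\<dots> = - ?DH (D\<Phi> w v)" by (rule omega_ham_field[OF H])
  finally show "\<bar>omega_model (?Y - model_field f w) v\<bar> \<le> c * norm v"
    using c[of v] R by (simp add: omega_model_diff)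
qed

lemma pulled_back_field_flat:
  assumes D: "compact D" "D \<subseteq> S" and k: "k \<ge> 1"
  shows "\<exists>C\<ge>0. \<forall>w\<in>D. norm (D\<Psi> (\<Phi> w) (ham_field H (\<Phi> w)) - model_field f w)
    \<le> C * cmod (fst w) ^ k"
proof -
  have "remainder \<in> O[nhds z](\<lambda>w. cmod (fst w) ^ (2 * k))" if "z \<in> S" "fst z = 0" for z
    using nf that unfolding normal_form_def remainder_def[abs_def] by blast
  then obtain C where C: "C \<ge> 0"
      "\<And>w v. w \<in> D \<Longrightarrow> \<bar>frechet_derivative remainder (at w) v\<bar> \<le> C * cmod (fst w) ^ k * norm v"
    using derivative_flat_on_compact[OF remainder_smooth open_S D k] by blast
  show ?thesis
    using C(1) pulled_back_field[OF subsetD[OF D(2)] C(2)] by blast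
qed

section \<open>The confining region\<close>

text \<open>The part of the slice \<open>z\<^sub>1 = 0\<close> of \<open>S\<close> over which \<open>B\<close> is within \<open>\<eta>\<close> of \<open>J\<close>, if \<open>B\<close> is positive.\<close>

definition zone :: "real set \<Rightarrow> real \<Rightarrow> (real^2) set" where
  "zone J \<eta> = {z. (0, z) \<in> S \<and> infdist (f (z, 0)) J \<le> \<eta>}"

definition inner_zone :: "real set \<Rightarrow> real \<Rightarrow> (real^2) set" where
  "inner_zone J \<eta> = {z. (0, z) \<in> S \<and> infdist (f (z, 0)) J < \<eta>}"

lemma f_slice_smooth: "smooth_on UNIV (\<lambda>z. f (z, 0))"
  by (rule smooth_on_compose[OF open_UNIV open_UNIV _ f_smooth
        smooth_on_Pair[OF open_UNIV smooth_on_linear[OF open_UNIV bounded_linear_ident] smooth_on_const[OF open_UNIV]]])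
    simp

lemma open_inner_zone: "open (inner_zone J \<eta>)"
proof -
  have "continuous_on UNIV (\<lambda>z. (0::complex, z::real^2))" by (intro continuous_intros)
  then have "open {z. (0, z) \<in> S}"
    using open_S by (simp add: continuous_on_open_vimage vimage_def)
  moreover have "open {z. infdist (f (z, 0)) J < \<eta>}"
    by (intro open_Collect_less continuous_on_infdist smooth_on_continuous[OF f_slice_smooth] continuous_on_const)
  moreover have "inner_zone J \<eta> = {z. (0, z) \<in> S} \<inter> {z. infdist (f (z, 0)) J < \<eta>}"
    unfolding inner_zone_def by auto
  ultimately show ?thesis by (simp add: open_Int)
qed

lemma open_inner_slab: "open {w::model. cmod (fst w) < d \<and> snd w \<in> inner_zone J \<eta>}"
proof -
  have "open {w::model. cmod (fst w) < d}" by (intro open_Collect_less continuous_intros)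
  moreover have "continuous_on UNIV (snd :: model \<Rightarrow> real^2)" by (intro continuous_intros)
  then have "open {w::model. snd w \<in> inner_zone J \<eta>}"
    using open_inner_zone[of J \<eta>] by (simp add: continuous_on_open_vimage vimage_def)
  moreover have "{w::model. cmod (fst w) < d \<and> snd w \<in> inner_zone J \<eta>} =
      {w. cmod (fst w) < d} \<inter> {w. snd w \<in> inner_zone J \<eta>}" by auto
  ultimately show ?thesis by (simp add: open_Int)
qed

lemma compact_slab: "compact Z \<Longrightarrow> compact (slab d Z)"
proof -
  assume "compact Z"
  then have "compact (cball (0::complex) d \<times> Z)" by (intro compact_Times compact_cball)
  moreover have "slab d Z = cball 0 d \<times> Z" by (auto simp: slab_def)
  ultimately show ?thesis by simp
qed

lemma mag_field_eq: "(\<And>q. B q > 0) \<Longrightarrow> B = (\<lambda>q. f (base q, 0))"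
  by (rule ext) (simp add: zero_energy(3) abs_of_pos)

text \<open>\<open>B\<close> is the composition of \<open>f (\<cdot>, 0)\<close> with \<open>base\<close>.\<close>

lemma gradient_nonzero:
  assumes pos: "\<And>q. B q > 0" and B': "frechet_derivative B (at q) \<noteq> (\<lambda>v. 0)"
  shows "grad_z f (base q, 0) \<noteq> 0"
proof
  assume 0: "grad_z f (base q, 0) = 0"
  have b: "((\<lambda>q. (base q, 0::real)) has_derivative (\<lambda>v. (frechet_derivative base (at q) v, 0))) (at q)"
    by (rule has_derivative_Pair[OF smooth_on_has_derivative[OF base_smooth UNIV_I] has_derivative_const])
  have "(B has_derivative (\<lambda>v. frechet_derivative f (at (base q, 0)) (frechet_derivative base (at q) v, 0))) (at q)"
    unfolding mag_field_eq[OF pos]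
    by (rule has_derivative_compose[OF b smooth_on_has_derivative[OF f_smooth UNIV_I]])
  then have "(B has_derivative (\<lambda>v. 0)) (at q)"
    unfolding frechet_grad_z[OF f_smooth] 0 by simp
  then show False using B' frechet_derivative_at by metis
qed

text \<open>The zone is the image under \<open>base\<close> of the set where \<open>B\<close> is close to \<open>J\<close>. That set is bounded,
  because far out \<open>B\<close> is at least \<open>C\<close> and \<open>J\<close> lies below \<open>C0 < C\<close>. The critical points of \<open>f (\<cdot>, I)\<close>
  are kept out by compactness: the distance from \<open>f (\<cdot>, 0)\<close> to \<open>J\<close>, the number \<open>I\<close> and the gradient
  never vanish together, so their sum has a positive minimum \<open>m\<close>, and where the first two are at
  most \<open>m / 3\<close> the gradient is not zero.\<close>

lemma confining_region:
  assumes pos: "\<And>q. B q > 0" and conf: "\<And>q. norm q \<ge> M \<Longrightarrow> B q \<ge> C"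
    and C0: "C0 < C" and J: "closed J" "J \<noteq> {}" "J \<subseteq> {0<..<C0}"
    and B': "\<And>q. B q \<in> J \<Longrightarrow> frechet_derivative B (at q) \<noteq> (\<lambda>v. 0)"
  shows "\<exists>\<eta> \<delta>. \<eta> > 0 \<and> 0 < \<delta> \<and> \<delta> \<le> 1 \<and> compact (zone J \<eta>) \<and> slab \<delta> (zone J \<eta>) \<subseteq> S \<and>
    (\<forall>z\<in>zone J \<eta>. \<forall>I\<in>{0..\<delta>\<^sup>2}. grad_z f (z, I) \<noteq> 0)"
proof -
  define \<eta>0 where "\<eta>0 = (C - C0) / 2"
  have \<eta>0: "\<eta>0 > 0" unfolding \<eta>0_def using C0 by simp
  have contB: "continuous_on UNIV B"
    unfolding mag_field_eq[OF pos]
    by (rule continuous_on_compose2[OF smooth_on_continuous[OF f_slice_smooth] smooth_on_continuous[OF base_smooth]]) simp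
  have comp: "compact (zone J \<eta>)" if "\<eta> \<le> \<eta>0" for \<eta>
  proof -
    let ?Q = "{q. infdist (B q) J \<le> \<eta>}"
    have "closed ?Q"
      by (intro closed_Collect_le continuous_on_infdist contB continuous_on_const)
    moreover have "?Q \<subseteq> ball 0 M"
    proof
      fix q assume q: "q \<in> ?Q"
      obtain j where j: "j \<in> J" "infdist (B q) J = dist (B q) j"
        using infdist_attains_inf[OF J(1,2)] by blast
      have "j < C0" using J(3) j(1) by auto
      then have "B q < C" using q j(2) that C0 unfolding \<eta>0_def dist_real_def by (auto simp: field_simps)
      then have "\<not> M \<le> norm q" using conf[of q] by (metis not_le)
      then show "q \<in> ball 0 M" by simp
    qed
    then have "bounded ?Q" using bounded_ball bounded_subset by blast
    ultimately have "compact ?Q" by (simp add: compact_eq_bounded_closed)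
    then have "compact (base ` ?Q)"
      using continuous_on_subset[OF smooth_on_continuous[OF base_smooth] subset_UNIV] by (intro compact_continuous_image)
    moreover have "zone J \<eta> = base ` ?Q"
    proof (intro equalityI subsetI)
      fix z assume z: "z \<in> zone J \<eta>"
      then obtain q where "z = base q" using base_onto unfolding zone_def by blast
      then show "z \<in> base ` ?Q" using z mag_field_eq[OF pos] unfolding zone_def by (auto simp: image_iff)
    next
      fix z assume "z \<in> base ` ?Q"
      then show "z \<in> zone J \<eta>" using base_in unfolding zone_def mag_field_eq[OF pos] by auto
    qed
    ultimately show ?thesis by simp
  qed
  let ?P = "zone J \<eta>0 \<times> {0..1::real}"
  define h where "h y = infdist (f (fst y, 0)) J + snd y + norm (grad_z f y)" for y
  have P: "compact ?P" using comp[of \<eta>0] by (intro compact_Times compact_Icc) auto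
  have f0: "continuous_on UNIV (\<lambda>y::(real^2) \<times> real. f (fst y, 0))"
    by (rule continuous_on_compose2[OF smooth_on_continuous[OF f_slice_smooth] continuous_on_fst[OF continuous_on_id]]) simp
  have conth: "continuous_on ?P h"
    unfolding h_def
    by (rule continuous_on_subset[OF _ subset_UNIV])
      (intro continuous_on_add continuous_on_infdist continuous_on_norm f0 continuous_on_snd
        continuous_on_id smooth_on_continuous[OF smooth_grad_z[OF f_smooth]])
  have hpos: "h y > 0" if y: "y \<in> ?P" for y
  proof -
    have nn: "infdist (f (fst y, 0)) J \<ge> 0" "snd y \<ge> 0" "norm (grad_z f y) \<ge> 0"
      using y by (auto simp: infdist_nonneg)
    moreover have "\<not> (infdist (f (fst y, 0)) J = 0 \<and> snd y = 0 \<and> norm (grad_z f y) = 0)"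
    proof
      assume 0: "infdist (f (fst y, 0)) J = 0 \<and> snd y = 0 \<and> norm (grad_z f y) = 0"
      have "(0, fst y) \<in> S" using y unfolding zone_def by auto
      then obtain q where q: "fst y = base q" by (rule base_onto)
      have "f (fst y, 0) \<in> J" using 0 J(1,2) in_closed_iff_infdist_zero by blast
      then have "B q \<in> J" unfolding mag_field_eq[OF pos] q .
      from gradient_nonzero[OF pos B'[OF this]] show False
        using 0 q by (metis norm_eq_zero prod.collapse)
    qed
    ultimately show ?thesis unfolding h_def by linarith
  qed
  obtain m where m: "m > 0" "\<And>y. y \<in> ?P \<Longrightarrow> m \<le> h y"
  proof (cases "?P = {}")
    case True
    then show ?thesis using that[of 1] by auto
  next
    case False
    then obtain y0 where "y0 \<in> ?P" "\<forall>y\<in>?P. h y0 \<le> h y"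
      using continuous_attains_inf[OF P False conth] by blast
    then show ?thesis using that[of "h y0"] hpos by blast
  qed
  have "compact ({0::complex} \<times> zone J \<eta>0)" using comp[of \<eta>0] by (intro compact_Times) auto
  moreover have "{0::complex} \<times> zone J \<eta>0 \<subseteq> S" unfolding zone_def by auto
  ultimately obtain e where e: "e > 0" "(\<Union>x\<in>{0::complex} \<times> zone J \<eta>0. cball x e) \<subseteq> S"
    using compact_subset_open_imp_cball_epsilon_subset[OF _ open_S] by metis
  define \<eta> where "\<eta> = min \<eta>0 (m / 3)"
  define \<delta> where "\<delta> = min 1 (min e (m / 3))"
  have \<delta>: "0 < \<delta>" "\<delta> \<le> 1" "\<delta> \<le> e" "\<delta> \<le> m / 3" unfolding \<delta>_def using e(1) m(1) by auto
  have sub: "zone J \<eta> \<subseteq> zone J \<eta>0" unfolding zone_def \<eta>_def by auto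
  show ?thesis
  proof (rule exI[of _ \<eta>], rule exI[of _ \<delta>], intro conjI ballI)
    show "\<eta> > 0" unfolding \<eta>_def using \<eta>0 m(1) by simp
    show "0 < \<delta>" "\<delta> \<le> 1" by (fact \<delta>)+
    show "compact (zone J \<eta>)" by (rule comp) (simp add: \<eta>_def)
    show "slab \<delta> (zone J \<eta>) \<subseteq> S"
    proof
      fix w assume w: "w \<in> slab \<delta> (zone J \<eta>)"
      then have "snd w \<in> zone J \<eta>0" "cmod (fst w) \<le> e" using sub \<delta>(3) unfolding slab_def by auto
      then have "w \<in> cball (0, snd w) e" by (cases w) (simp add: dist_Pair_Pair dist_norm)
      then show "w \<in> S" using e(2) \<open>snd w \<in> zone J \<eta>0\<close> by blast
    qed
    fix z and I :: real assume z: "z \<in> zone J \<eta>" and I: "I \<in> {0..\<delta>\<^sup>2}"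
    have "\<delta>\<^sup>2 \<le> \<delta>" using \<delta> by (simp add: power2_eq_square mult_left_le)
    then have I': "0 \<le> I" "I \<le> \<delta>" using I by auto
    then have "(z, I) \<in> ?P" using z sub \<delta>(2) by auto
    then have "m \<le> infdist (f (z, 0)) J + I + norm (grad_z f (z, I))" using m(2) unfolding h_def by fastforce
    moreover have "infdist (f (z, 0)) J \<le> m / 3" using z unfolding zone_def \<eta>_def by auto
    ultimately have "norm (grad_z f (z, I)) \<ge> m / 3" using I' \<delta>(4) by linarith
    then show "grad_z f (z, I) \<noteq> 0" using m(1) by auto
  qed
qed

end

section \<open>Trajectories in forward time\<close>

definition time_dir :: "real \<Rightarrow> real" where "time_dir t = (if t < 0 then - 1 else 1)"

lemma time_dir_facts: "\<bar>time_dir t\<bar> = 1" "time_dir t * time_dir t = 1" "time_dir t * \<bar>t\<bar> = t"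
    "time_dir t * t = \<bar>t\<bar>"
  by (auto simp: time_dir_def)

lemma time_dir_segment: "(\<lambda>s. time_dir t * s) ` {0..\<bar>t\<bar>} = closed_segment 0 t"
    "(\<lambda>s. time_dir t * s) ` closed_segment 0 t = {0..\<bar>t\<bar>}"
  by (auto simp: time_dir_def closed_segment_eq_real_ivl image_iff)

lemma has_vector_derivative_scale_time:
  assumes "(g has_vector_derivative v) (at (c * s) within (\<lambda>s. c * s) ` X)"
  shows "((\<lambda>s. g (c * s)) has_vector_derivative c *\<^sub>R v) (at s within X)"
proof -
  have "((\<lambda>s. c * s) has_vector_derivative c) (at s within X)"
    unfolding has_real_derivative_iff_has_vector_derivative[symmetric]
    by (auto intro!: derivative_eq_intros)
  from vector_diff_chain_within[OF this assms] show ?thesis by (simp add: o_def)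
qed

text \<open>A trajectory in negative time is a trajectory of the reversed field in positive time. All
  later estimates are insensitive to this sign.\<close>

lemma flow_rel_forward:
  "flow_rel D H t x y \<longleftrightarrow> (\<exists>u. u 0 = x \<and> u \<bar>t\<bar> = y \<and> (\<forall>s\<in>{0..\<bar>t\<bar>}. u s \<in> D) \<and>
     ode_sol (\<lambda>x. time_dir t *\<^sub>R ham_field H x) u \<bar>t\<bar>)"
proof
  let ?c = "time_dir t"
  assume "flow_rel D H t x y"
  then obtain g where g: "g 0 = x" "g t = y" and g': "\<And>s. s \<in> closed_segment 0 t \<Longrightarrow> g s \<in> D \<and>
      (g has_vector_derivative ham_field H (g s)) (at s within closed_segment 0 t)"
    unfolding flow_rel_def by blast
  have seg: "?c * s \<in> closed_segment 0 t" if "s \<in> {0..\<bar>t\<bar>}" for s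
    using that time_dir_segment(1) by blast
  have "ode_sol (\<lambda>x. ?c *\<^sub>R ham_field H x) (\<lambda>s. g (?c * s)) \<bar>t\<bar>"
    unfolding ode_sol_def
  proof
    fix s assume "s \<in> {0..\<bar>t\<bar>}"
    from g'[OF seg[OF this]]
    show "((\<lambda>s. g (?c * s)) has_vector_derivative ?c *\<^sub>R ham_field H (g (?c * s))) (at s within {0..\<bar>t\<bar>})"
      by (intro has_vector_derivative_scale_time) (simp add: time_dir_segment)
  qed
  moreover have "\<forall>s\<in>{0..\<bar>t\<bar>}. g (?c * s) \<in> D" using g' seg by blast
  ultimately show "\<exists>u. u 0 = x \<and> u \<bar>t\<bar> = y \<and> (\<forall>s\<in>{0..\<bar>t\<bar>}. u s \<in> D) \<and>
     ode_sol (\<lambda>x. ?c *\<^sub>R ham_field H x) u \<bar>t\<bar>"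
    using g by (intro exI[of _ "\<lambda>s. g (?c * s)"]) (simp add: time_dir_facts)
next
  let ?c = "time_dir t"
  assume "\<exists>u. u 0 = x \<and> u \<bar>t\<bar> = y \<and> (\<forall>s\<in>{0..\<bar>t\<bar>}. u s \<in> D) \<and>
     ode_sol (\<lambda>x. ?c *\<^sub>R ham_field H x) u \<bar>t\<bar>"
  then obtain u where u: "u 0 = x" "u \<bar>t\<bar> = y" "\<And>s. s \<in> {0..\<bar>t\<bar>} \<Longrightarrow> u s \<in> D"
     "\<And>s. s \<in> {0..\<bar>t\<bar>} \<Longrightarrow> (u has_vector_derivative ?c *\<^sub>R ham_field H (u s)) (at s within {0..\<bar>t\<bar>})"
    unfolding ode_sol_def by blast
  have seg: "?c * s \<in> {0..\<bar>t\<bar>}" if "s \<in> closed_segment 0 t" for s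
    using that time_dir_segment(2) by blast
  have "((\<lambda>s. u (?c * s)) has_vector_derivative ham_field H (u (?c * s))) (at s within closed_segment 0 t)"
    if "s \<in> closed_segment 0 t" for s
    using has_vector_derivative_scale_time[of u "?c *\<^sub>R ham_field H (u (?c * s))" ?c s "closed_segment 0 t"]
      u(4)[OF seg[OF that]] by (simp add: time_dir_segment time_dir_facts)
  then show "flow_rel D H t x y"
    unfolding flow_rel_def using u seg
    by (intro exI[of _ "\<lambda>s. u (?c * s)"]) (simp add: time_dir_facts)
qed

lemma eventually_small_multiple:
  "e > 0 \<Longrightarrow> \<forall>\<^sub>F d::real in at_right 0. c * d < e"
proof -
  assume "e > 0"
  have "((\<lambda>d. c * d) \<longlongrightarrow> c * 0) (at_right 0)" by (intro tendsto_intros)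
  then show ?thesis using order_tendstoD(2) \<open>e > 0\<close> by fastforce
qed

context magnetic_normal_form
begin

lemma lipschitz_scaled_ham_field: "lipschitz_on_balls (\<lambda>x. c *\<^sub>R ham_field H x)"
  by (rule smooth_imp_lipschitz_on_balls[OF smooth_on_linear_comp[OF open_UNIV
        bounded_linear_scaleR_right smooth_ham_field[OF smooth_mag_ham[OF A_smooth]]]])

lemma lipschitz_scaled_model_field: "lipschitz_on_balls (\<lambda>z. c *\<^sub>R model_field f z)"
  by (rule smooth_imp_lipschitz_on_balls[OF smooth_on_linear_comp[OF open_UNIV
        bounded_linear_scaleR_right smooth_model_field[OF f_smooth]]])

lemma magnetic_flow_unique:
  assumes "flow_rel UNIV H t x y" "flow_rel UNIV H t x y'"
  shows "y = y'"
proof -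
  obtain u v where "u 0 = x" "u \<bar>t\<bar> = y" "ode_sol (\<lambda>x. time_dir t *\<^sub>R ham_field H x) u \<bar>t\<bar>"
    "v 0 = x" "v \<bar>t\<bar> = y'" "ode_sol (\<lambda>x. time_dir t *\<^sub>R ham_field H x) v \<bar>t\<bar>"
    using assms unfolding flow_rel_forward by blast
  then show ?thesis using ode_sol_unique[OF lipschitz_scaled_ham_field] abs_ge_zero by metis
qed

lemma \<Psi>_derivative_in_U:
  assumes "u s \<in> U" "(u has_vector_derivative v) (at s within X)"
  shows "((\<lambda>s. \<Psi> (u s)) has_vector_derivative D\<Psi> (u s) v) (at s within X)"
  by (rule has_vector_derivative_compose_at[OF smooth_on_has_derivative[OF \<Psi>_smooth assms(1)] assms(2)])

lemma linear_D\<Psi>: "x \<in> U \<Longrightarrow> linear (D\<Psi> x)"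
  using smooth_on_has_derivative[OF \<Psi>_smooth] has_derivative_linear by blast

lemma normal_flow_in_model:
  assumes u: "\<forall>s\<in>{0..T}. u s \<in> U" "ode_sol (\<lambda>x. c *\<^sub>R ham_field K x) u T"
  shows "ode_sol (\<lambda>z. c *\<^sub>R model_field f z) (\<lambda>s. \<Psi> (u s)) T"
  unfolding ode_sol_def
proof
  fix s assume s: "s \<in> {0..T}"
  then have U: "u s \<in> U" using u(1) by blast
  have "D\<Psi> (u s) (c *\<^sub>R ham_field K (u s)) = c *\<^sub>R D\<Psi> (u s) (ham_field K (u s))"
    by (rule linear_scale[OF linear_D\<Psi>[OF U]])
  also have "D\<Psi> (u s) (ham_field K (u s)) = model_field f (\<Psi> (u s))"
    using normal_field[OF \<Psi>_in[OF U]] derivative_inverses(1)[OF \<Psi>_in[OF U]] \<Phi>_\<Psi>[OF U] by simp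
  finally have e: "D\<Psi> (u s) (c *\<^sub>R ham_field K (u s)) = c *\<^sub>R model_field f (\<Psi> (u s))" .
  have "(u has_vector_derivative c *\<^sub>R ham_field K (u s)) (at s within {0..T})"
    using u(2) s unfolding ode_sol_def by blast
  from \<Psi>_derivative_in_U[OF U this]
  show "((\<lambda>s. \<Psi> (u s)) has_vector_derivative c *\<^sub>R model_field f (\<Psi> (u s))) (at s within {0..T})"
    unfolding e .
qed

lemma normal_flow_unique:
  assumes "flow_rel U K t x y" "flow_rel U K t x y'"
  shows "y = y'"
proof -
  let ?V = "\<lambda>x. time_dir t *\<^sub>R ham_field K x"
  obtain u v where u: "u 0 = x" "u \<bar>t\<bar> = y" "\<forall>s\<in>{0..\<bar>t\<bar>}. u s \<in> U" "ode_sol ?V u \<bar>t\<bar>"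
    and v: "v 0 = x" "v \<bar>t\<bar> = y'" "\<forall>s\<in>{0..\<bar>t\<bar>}. v s \<in> U" "ode_sol ?V v \<bar>t\<bar>"
    using assms unfolding flow_rel_forward by blast
  have "\<Psi> (u \<bar>t\<bar>) = \<Psi> (v \<bar>t\<bar>)"
    by (rule ode_sol_unique[OF lipschitz_scaled_model_field normal_flow_in_model[OF u(3,4)]
          normal_flow_in_model[OF v(3,4)]]) (simp_all add: u v)
  moreover have "y \<in> U" "y' \<in> U" using u(2,3) v(2,3) by auto
  ultimately show ?thesis using \<Phi>_\<Psi> u(2) v(2) by metis
qed

lemma normal_flow_from_model:
  assumes w: "\<forall>s\<in>{0..\<bar>t\<bar>}. w s \<in> S" "ode_sol (\<lambda>z. time_dir t *\<^sub>R model_field f z) w \<bar>t\<bar>"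
  shows "flow_rel U K t (\<Phi> (w 0)) (\<Phi> (w \<bar>t\<bar>))"
proof -
  have "ode_sol (\<lambda>x. time_dir t *\<^sub>R ham_field K x) (\<lambda>s. \<Phi> (w s)) \<bar>t\<bar>"
    unfolding ode_sol_def
  proof
    fix s assume s: "s \<in> {0..\<bar>t\<bar>}"
    then have S: "w s \<in> S" using w(1) by blast
    have d: "(\<Phi> has_derivative D\<Phi> (w s)) (at (w s))" by (rule smooth_on_has_derivative[OF \<Phi>_smooth S])
    have "D\<Phi> (w s) (time_dir t *\<^sub>R model_field f (w s)) = time_dir t *\<^sub>R ham_field K (\<Phi> (w s))"
      unfolding normal_field[OF S] by (rule linear_scale[OF has_derivative_linear[OF d]])
    moreover have "(w has_vector_derivative time_dir t *\<^sub>R model_field f (w s)) (at s within {0..\<bar>t\<bar>})"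
      using w(2) s unfolding ode_sol_def by blast
    ultimately show "((\<lambda>s. \<Phi> (w s)) has_vector_derivative time_dir t *\<^sub>R ham_field K (\<Phi> (w s)))
        (at s within {0..\<bar>t\<bar>})"
      using has_vector_derivative_compose_at[of \<Phi> "D\<Phi> (w s)" w s, OF d] by metis
  qed
  then show ?thesis
    unfolding flow_rel_forward using w(1) by (intro exI[of _ "\<lambda>s. \<Phi> (w s)"]) auto
qed

definition flows_within :: "real \<Rightarrow> phase \<Rightarrow> real \<Rightarrow> bool" where
  "flows_within t x e \<longleftrightarrow> flow_defined UNIV H t x \<and> flow_defined U K t x \<and>
     norm (ham_flow UNIV H t x - ham_flow U K t x) \<le> e"

lemma flows_withinI:
  assumes "flow_rel UNIV H t x y" "flow_rel U K t x y'" "norm (y - y') \<le> e"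
  shows "flows_within t x e"
proof -
  have "ham_flow UNIV H t x = y" "ham_flow U K t x = y'"
    unfolding ham_flow_def using assms(1,2) magnetic_flow_unique normal_flow_unique by blast+
  then have "norm (ham_flow UNIV H t x - ham_flow U K t x) \<le> e" using assms(3) by simp
  with assms(1,2) show ?thesis unfolding flows_within_def flow_defined_def by blast
qed

text \<open>Seen in the model, the magnetic flow is the flow of the normal form with a forcing term, whose
  size is that of the difference of the two fields.\<close>

lemma magnetic_flow_in_model:
  assumes u: "\<forall>s\<in>{0..T}. u s \<in> \<Phi> ` D" "ode_sol (\<lambda>x. c *\<^sub>R ham_field H x) u T"
    and D: "D \<subseteq> S" and c: "\<bar>c\<bar> = 1"
    and near: "\<And>w. w \<in> D \<Longrightarrow> norm (D\<Psi> (\<Phi> w) (ham_field H (\<Phi> w)) - model_field f w) \<le> \<kappa>"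
  shows "forced_sol f D c \<kappa> T (\<lambda>s. \<Psi> (u s))"
  unfolding forced_sol_def
proof (intro conjI ballI c)
  fix s assume s: "s \<in> {0..T}"
  then obtain w where w: "w \<in> D" "u s = \<Phi> w" using u(1) by blast
  have wS: "w \<in> S" and U: "u s \<in> U" using w D by blast+
  have \<Psi>u: "\<Psi> (u s) = w" using \<Psi>_\<Phi>[OF wS] w(2) by simp
  then show "\<Psi> (u s) \<in> D" using w(1) by simp
  let ?Y = "D\<Psi> (\<Phi> w) (ham_field H (\<Phi> w))"
  have "(u has_vector_derivative c *\<^sub>R ham_field H (u s)) (at s within {0..T})"
    using u(2) s unfolding ode_sol_def by blast
  note deriv = \<Psi>_derivative_in_U[OF U this]
  have "D\<Psi> (u s) (c *\<^sub>R ham_field H (u s)) = c *\<^sub>R D\<Psi> (u s) (ham_field H (u s))"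
    by (rule linear_scale[OF linear_D\<Psi>[OF U]])
  then have "((\<lambda>s. \<Psi> (u s)) has_vector_derivative c *\<^sub>R ?Y) (at s within {0..T})"
    using deriv unfolding w(2) by simp
  moreover have "c *\<^sub>R ?Y = c *\<^sub>R model_field f w + c *\<^sub>R (?Y - model_field f w)"
    by (simp add: scaleR_diff_right)
  moreover have "norm (c *\<^sub>R (?Y - model_field f w)) \<le> \<kappa>" using near[OF w(1)] c by simp
  ultimately show "\<exists>\<rho>. norm \<rho> \<le> \<kappa> \<and>
      ((\<lambda>s. \<Psi> (u s)) has_vector_derivative c *\<^sub>R model_field f (\<Psi> (u s)) + \<rho>) (at s within {0..T})"
    unfolding \<Psi>u by (intro exI[of _ "c *\<^sub>R (?Y - model_field f w)"]) simp
qed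

end

section \<open>Comparison of the two flows\<close>

lemma norm_zero_Pair: "norm (0::real^2, x::real) = \<bar>x\<bar>"
  by (simp add: norm_Pair)

context magnetic_normal_form
begin

text \<open>The boundary of the slab consists of points where \<open>|z\<^sub>1| = d\<close> and points where the distance from
  \<open>f (z\<^sub>2, 0)\<close> to \<open>J\<close> is \<open>\<eta>\<close>; the nearly conserved quantities forbid both. The term in \<open>d\<^sup>2\<close> accounts
  for the difference between \<open>f (z\<^sub>2, 0)\<close> and the nearly conserved \<open>f (z\<^sub>2, |z\<^sub>1|\<^sup>2)\<close>.\<close>

lemma forced_sol_confined:
  assumes Z: "compact (zone J \<eta>)" and \<delta>: "0 < \<delta>" "\<delta> \<le> 1"
  shows "\<exists>C\<ge>1. \<forall>\<sigma> \<kappa> T w d j. 0 \<le> T \<longrightarrow> d \<le> \<delta> \<longrightarrow> 0 < d \<longrightarrow> forced_sol f (slab d (zone J \<eta>)) \<sigma> \<kappa> T w \<longrightarrow>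
    (cmod (fst (w 0)))\<^sup>2 + C * \<kappa> * T < d\<^sup>2 \<longrightarrow> j \<in> J \<longrightarrow>
    C * d\<^sup>2 + C * \<kappa> * T + \<bar>f (slow (w 0)) - j\<bar> < \<eta> \<longrightarrow>
    w T \<in> {w. cmod (fst w) < d \<and> snd w \<in> inner_zone J \<eta>}"
proof -
  obtain C1 where C1: "C1 \<ge> 1" "\<And>\<sigma> \<kappa> T w. 0 \<le> T \<Longrightarrow> forced_sol f (slab \<delta> (zone J \<eta>)) \<sigma> \<kappa> T w \<Longrightarrow>
      \<bar>(cmod (fst (w T)))\<^sup>2 - (cmod (fst (w 0)))\<^sup>2\<bar> \<le> C1 * \<kappa> * T \<and>
      \<bar>f (slow (w T)) - f (slow (w 0))\<bar> \<le> C1 * \<kappa> * T"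
    using forced_sol_drift[OF f_smooth Z \<delta>] by blast
  obtain r where r: "r \<ge> 0" "\<And>z (I::real). z \<in> zone J \<eta> \<Longrightarrow> I \<in> {0..1} \<Longrightarrow> (z, I) \<in> cball 0 r"
    using slow_in_box[OF Z] by blast
  obtain L0 where L0: "\<And>x y. x \<in> cball 0 r \<Longrightarrow> y \<in> cball 0 r \<Longrightarrow> norm (f x - f y) \<le> L0 * norm (x - y)"
    using smooth_imp_lipschitz_on_balls[OF f_smooth] unfolding lipschitz_on_balls_def by meson
  define L where "L = max L0 0"
  have L: "L \<ge> 0" "L0 \<le> L" unfolding L_def by simp_all
  have "w T \<in> {w. cmod (fst w) < d \<and> snd w \<in> inner_zone J \<eta>}"
    if T: "0 \<le> T" and d: "d \<le> \<delta>" "0 < d" and w: "forced_sol f (slab d (zone J \<eta>)) \<sigma> \<kappa> T w"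
      and small: "(cmod (fst (w 0)))\<^sup>2 + (C1 + L) * \<kappa> * T < d\<^sup>2" and j: "j \<in> J"
      and near: "(C1 + L) * d\<^sup>2 + (C1 + L) * \<kappa> * T + \<bar>f (slow (w 0)) - j\<bar> < \<eta>" for \<sigma> \<kappa> T w d j
  proof -
    have sub: "slab d (zone J \<eta>) \<subseteq> slab \<delta> (zone J \<eta>)" using d unfolding slab_def by auto
    have w\<delta>: "forced_sol f (slab \<delta> (zone J \<eta>)) \<sigma> \<kappa> T w"
      using w sub unfolding forced_sol_def by blast
    have in_d: "w T \<in> slab d (zone J \<eta>)" using w T unfolding forced_sol_def by simp
    have "\<exists>\<rho>::model. norm \<rho> \<le> \<kappa>"
      using w T unfolding forced_sol_def by (meson atLeastAtMost_iff order.refl)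
    then have \<kappa>: "\<kappa> \<ge> 0" using norm_ge_zero order_trans by blast
    have C1L: "C1 * \<kappa> * T \<le> (C1 + L) * \<kappa> * T" using L(1) \<kappa> T by (intro mult_right_mono) auto
    have drift: "(cmod (fst (w T)))\<^sup>2 \<le> (cmod (fst (w 0)))\<^sup>2 + C1 * \<kappa> * T"
        "\<bar>f (slow (w T)) - f (slow (w 0))\<bar> \<le> C1 * \<kappa> * T"
      using C1(2)[OF T w\<delta>] by auto
    have "(cmod (fst (w T)))\<^sup>2 < d\<^sup>2" using drift(1) small C1L by linarith
    then have lt: "cmod (fst (w T)) < d" by (rule power2_less_imp_less) (use d in simp)
    have zZ: "snd (w T) \<in> zone J \<eta>" using in_d unfolding slab_def by simp
    have I: "(cmod (fst (w T)))\<^sup>2 \<in> {0..1}" using in_d sub by (intro slab_slow(2)[OF _ \<delta>]) auto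
    have "(snd (w T), 0::real) \<in> cball 0 r" by (rule r(2)[OF zZ]) simp
    moreover have "slow (w T) \<in> cball 0 r" unfolding slow_def by (rule r(2)[OF zZ I])
    ultimately have fL: "norm (f (snd (w T), 0) - f (slow (w T))) \<le> L0 * norm ((snd (w T), 0) - slow (w T))"
      by (rule L0)
    have "norm ((snd (w T), 0) - slow (w T)) = norm (0::real^2, (cmod (fst (w T)))\<^sup>2)"
      by (simp add: slow_def norm_Pair)
    also have "\<dots> = (cmod (fst (w T)))\<^sup>2" unfolding norm_zero_Pair by simp
    finally have "\<bar>f (snd (w T), 0) - f (slow (w T))\<bar> \<le> L0 * (cmod (fst (w T)))\<^sup>2"
      using fL by simp
    also have "\<dots> \<le> L * (cmod (fst (w T)))\<^sup>2" using L(2) by (intro mult_right_mono) auto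
    also have "\<dots> \<le> L * d\<^sup>2" using lt L(1) by (intro mult_left_mono power_mono) auto
    also have "\<dots> \<le> (C1 + L) * d\<^sup>2" using C1(1) by (intro mult_right_mono) auto
    finally have "\<bar>f (snd (w T), 0) - j\<bar> < \<eta>" using drift(2) C1L near by linarith
    then have "infdist (f (snd (w T), 0)) J < \<eta>"
      using infdist_le[OF j, of "f (snd (w T), 0)"] unfolding dist_real_def by linarith
    then show ?thesis using lt zZ unfolding inner_zone_def zone_def by simp
  qed
  then show ?thesis using C1(1) L(1) by (intro exI[of _ "C1 + L"]) auto
qed

text \<open>The parameter \<open>d\<close> is the half-width of the slab in the direction of \<open>z\<^sub>1\<close>, and \<open>c0\<close> is chosen
  such that the starting points have \<open>|z\<^sub>1| \<le> d / 2\<close>. For times \<open>T \<le> b / d\<^sup>n\<close> the displacement of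
  \<open>z\<^sub>2\<close> is kept below \<open>\<mu> = d\<^sup>l\<close> under a force \<open>\<kappa>\<close> of order \<open>d\<^sup>m\<close>. The exponents make \<open>T \<mu>\<^sup>2\<close> and
  \<open>\<kappa> (1 + T)\<^sup>2\<close> smaller than \<open>\<mu>\<close> by a factor \<open>d\<close>, which absorbs all constants, and make the
  displacement of \<open>z\<^sub>1\<close>, of order \<open>sqrt (T \<mu>)\<close>, at most of order \<open>d\<^sup>k\<^sup>+\<^sup>1\<close>.\<close>

lemma flows_close:
  assumes J: "closed J"
    and region: "\<eta> > 0" "0 < \<delta>" "\<delta> \<le> 1" "compact (zone J \<eta>)" "slab \<delta> (zone J \<eta>) \<subseteq> S"
      "\<forall>z\<in>zone J \<eta>. \<forall>I\<in>{0..\<delta>\<^sup>2}. grad_z f (z, I) \<noteq> 0"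
    and pos: "\<And>q. B q > 0"
  shows "\<exists>c0>0. \<forall>b\<ge>0. \<forall>n k. \<exists>c. \<forall>\<^sub>F d in at_right 0. \<forall>q p t.
    B q \<in> J \<and> c0 * norm (p - A q) \<le> d \<and> \<bar>t\<bar> \<le> b / d ^ n \<longrightarrow>
    flows_within t (q, p) (c * d ^ k)"
proof -
  let ?Z = "zone J \<eta>" and ?D = "slab \<delta> (zone J \<eta>)"
  have cD: "compact ?D" by (rule compact_slab[OF region(4)])
  have zone0: "z \<in> zone J 0 \<longleftrightarrow> (0, z) \<in> S \<and> infdist (f (z, 0)) J = 0" for z
    unfolding zone_def using infdist_nonneg[of "f (z, 0)" J] by auto
  have sub0: "zone J 0 \<subseteq> inner_zone J \<eta>" using region(1) zone0 unfolding inner_zone_def by auto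
  have subZ: "inner_zone J \<eta> \<subseteq> ?Z" unfolding inner_zone_def zone_def by auto
  have comp0: "compact (zone J 0)"
  proof -
    have "closed {z. infdist (f (z, 0)) J \<le> 0}"
      by (intro closed_Collect_le continuous_on_infdist smooth_on_continuous[OF f_slice_smooth] continuous_on_const)
    moreover have "zone J 0 = ?Z \<inter> {z. infdist (f (z, 0)) J \<le> 0}"
      unfolding zone_def using region(1) by auto
    ultimately show ?thesis using region(4) by (simp add: compact_Int_closed)
  qed
  have base0: "base q \<in> zone J 0" if "B q \<in> J" for q
    using that base_in unfolding zone0 mag_field_eq[OF pos] by (simp add: in_closed_iff_infdist_zero)
  define G where "G = \<Phi> ` ({0} \<times> zone J 0)"
  have GS: "{0} \<times> zone J 0 \<subseteq> S" using zone0 by auto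
  have G: "compact G" "G \<subseteq> U"
    unfolding G_def using GS comp0
    by (auto intro!: compact_continuous_image compact_Times
        continuous_on_subset[OF smooth_on_continuous[OF \<Phi>_smooth] GS])
  have inG: "(q, A q) \<in> G" if "B q \<in> J" for q
  proof -
    have "\<Phi> (0, base q) = (q, A q)" using \<Phi>_\<Psi>[OF zero_energy(1)[of q]] by (simp only: zero_energy(2))
    moreover have "(0, base q) \<in> {0} \<times> zone J 0" using base0[OF that] by simp
    ultimately show ?thesis unfolding G_def by (metis imageI)
  qed
  obtain e1 L1 where L1: "e1 > 0" "L1 \<ge> 0" "\<And>x y. x \<in> G \<Longrightarrow> norm (y - x) \<le> e1 \<Longrightarrow>
      y \<in> U \<and> norm (\<Psi> y - \<Psi> x) \<le> L1 * norm (y - x)"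
    using smooth_on_lipschitz_near_compact[OF \<Psi>_smooth open_U G] by blast
  have g: "smooth_on U (\<lambda>x. f (slow (\<Psi> x)))"
    by (rule smooth_on_compose[OF open_U open_UNIV _ f_smooth
          smooth_on_compose[OF open_U open_UNIV _ smooth_slow \<Psi>_smooth]]) simp_all
  obtain e2 L2 where L2: "e2 > 0" "L2 \<ge> 0" "\<And>x y. x \<in> G \<Longrightarrow> norm (y - x) \<le> e2 \<Longrightarrow>
      y \<in> U \<and> norm (f (slow (\<Psi> y)) - f (slow (\<Psi> x))) \<le> L2 * norm (y - x)"
    using smooth_on_lipschitz_near_compact[OF g open_U G] by blast
  obtain e3 L3 where L3: "e3 > 0" "L3 \<ge> 0" "\<And>x y. x \<in> ?D \<Longrightarrow> norm (y - x) \<le> e3 \<Longrightarrow>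
      y \<in> S \<and> norm (\<Phi> y - \<Phi> x) \<le> L3 * norm (y - x)"
    using smooth_on_lipschitz_near_compact[OF \<Phi>_smooth open_S cD region(5)] by blast
  obtain e4 where e4: "e4 > 0" "(\<Union>x\<in>zone J 0. cball x e4) \<subseteq> inner_zone J \<eta>"
    using compact_subset_open_imp_cball_epsilon_subset[OF comp0 open_inner_zone sub0] by auto
  obtain CD where CD: "CD \<ge> 1" "\<And>\<sigma> \<kappa> T w d j. 0 \<le> T \<Longrightarrow> d \<le> \<delta> \<Longrightarrow> 0 < d \<Longrightarrow>
      forced_sol f (slab d ?Z) \<sigma> \<kappa> T w \<Longrightarrow>
      (cmod (fst (w 0)))\<^sup>2 + CD * \<kappa> * T < d\<^sup>2 \<Longrightarrow> j \<in> J \<Longrightarrow>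
      CD * d\<^sup>2 + CD * \<kappa> * T + \<bar>f (slow (w 0)) - j\<bar> < \<eta> \<Longrightarrow>
      w T \<in> {w. cmod (fst w) < d \<and> snd w \<in> inner_zone J \<eta>}"
    using forced_sol_confined[OF region(4,2,3)] by blast
  obtain CC where CC: "CC \<ge> 1 \<and> (\<forall>\<sigma> \<kappa> \<mu> T w z. 0 \<le> T \<longrightarrow> 0 \<le> \<kappa> \<longrightarrow> 0 < \<mu> \<longrightarrow> CC * \<mu> \<le> 1 \<longrightarrow>
    CC * (\<kappa> * (1 + T)\<^sup>2 + T * \<mu>\<^sup>2) < \<mu> \<longrightarrow>
    forced_sol f ?D \<sigma> \<kappa> T w \<longrightarrow> forced_sol f ?D \<sigma> 0 T z \<longrightarrow> w 0 = z 0 \<longrightarrow>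
    (\<forall>s\<in>{0..T}. norm (snd (w s) - snd (z s)) \<le> \<mu> \<and>
      (cmod (fst (w s) - fst (z s)))\<^sup>2 \<le> CC * (T * (\<mu> + \<kappa> * (1 + T)))))"
    using forced_sol_comparison[OF f_smooth region(4,2,3,6)] by (rule exE)
  note CC = conjunct1[OF CC] conjunct2[OF CC, rule_format]
  define c0 where "c0 = 2 * L1 + L2 + 1"
  have c0: "c0 > 0" "2 * L1 \<le> c0" "L2 \<le> c0" "1 \<le> c0" unfolding c0_def using L1(2) L2(2) by auto
  have "\<exists>c. \<forall>\<^sub>F d in at_right 0. \<forall>q p t.
    B q \<in> J \<and> c0 * norm (p - A q) \<le> d \<and> \<bar>t\<bar> \<le> b / d ^ n \<longrightarrow>
    flows_within t (q, p) (c * d ^ k)"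
    if b: "b \<ge> 0" for b :: real and n k
  proof -
    define l where "l = n + 2 * k + 2"
    define m where "m = 2 * n + l + 1"
    have m1: "m \<ge> 1" unfolding m_def by simp
    obtain CF where CF: "CF \<ge> 0" "\<And>w. w \<in> ?D \<Longrightarrow>
        norm (D\<Psi> (\<Phi> w) (ham_field H (\<Phi> w)) - model_field f w) \<le> CF * cmod (fst w) ^ m"
      using pulled_back_field_flat[OF cD region(5) m1] by blast
    define K1 where "K1 = CD * CF * b"
    define K2 where "K2 = CC * b * (1 + CF * (1 + b))"
    define K3 where "K3 = CC * (CF * (1 + b)\<^sup>2 + b)"
    have K: "K1 \<ge> 0" "K2 \<ge> 0" "K3 \<ge> 0" unfolding K1_def K2_def K3_def using CD(1) CC(1) CF(1) b by auto
    have close: "flows_within t (q, p) (L3 * (1 + sqrt K2) * d ^ k)"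
      if d0: "d > 0" and d: "1 * d < 1" "1 * d < \<delta>" "1 * d < e1" "1 * d < e2" "1 * d < e4"
          "K1 * d < 1 / 2" "(CD + K1 + 1) * d < \<eta>" "CC * d < 1" "K3 * d < 1" "(1 + sqrt K2) * d < e3"
        and q: "B q \<in> J" and p: "c0 * norm (p - A q) \<le> d" and t: "\<bar>t\<bar> \<le> b / d ^ n"
      for d q p t
    proof -
      define \<sigma> where "\<sigma> = time_dir t"
      define T where "T = \<bar>t\<bar>"
      define \<kappa> where "\<kappa> = CF * d ^ m"
      define w0 where "w0 = \<Psi> (q, p)"
      have \<sigma>: "\<bar>\<sigma>\<bar> = 1" unfolding \<sigma>_def by (rule time_dir_facts)
      have T: "0 \<le> T" unfolding T_def by simp
      have \<kappa>: "0 \<le> \<kappa>" unfolding \<kappa>_def using CF(1) d0 by simp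
      have dpow: "d ^ i \<le> d ^ j" if "j \<le> i" for i j using that d0 d(1) by (intro power_decreasing) auto
      have dm: "d ^ m = d ^ n * d ^ (n + l + 1)" "d ^ m = (d ^ n)\<^sup>2 * d ^ (l + 1)"
        and dl: "(d ^ l)\<^sup>2 = d ^ n * d ^ (2 * k + 2 + l)" "d ^ l = d ^ n * (d ^ (k + 1))\<^sup>2"
        unfolding power_mult[symmetric] power_add[symmetric]
        by (rule arg_cong[of _ _ "power d"], simp add: m_def l_def)+
      have Tn: "T * d ^ n \<le> b" using t d0 unfolding T_def by (simp add: pos_le_divide_eq)
      have T1n: "(1 + T) * d ^ n \<le> 1 + b" using Tn dpow[of 0 n] by (simp add: distrib_right)
      have nv: "norm ((q, p) - (q, A q)) = norm (p - A q)" by (simp add: norm_Pair)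
      have v: "norm (p - A q) \<le> d" "2 * (L1 * norm (p - A q)) \<le> d" "L2 * norm (p - A q) \<le> d"
        using mult_right_mono[OF c0(4), of "norm (p - A q)"] mult_right_mono[OF c0(2), of "norm (p - A q)"]
          mult_right_mono[OF c0(3), of "norm (p - A q)"] p by auto
      have U: "(q, p) \<in> U" and w0: "norm (w0 - (0, base q)) \<le> L1 * norm (p - A q)"
        using L1(3)[OF inG[OF q], of "(q, p)"] v(1) d(3) unfolding nv w0_def zero_energy(2) by auto
      have f0: "\<bar>f (slow w0) - B q\<bar> \<le> d"
        using L2(3)[OF inG[OF q], of "(q, p)"] v(1,3) d(4)
        unfolding nv w0_def zero_energy(2) mag_field_eq[OF pos] by (auto simp: slow_def)
      have w01: "cmod (fst w0) \<le> d / 2" and w02: "norm (snd w0 - base q) \<le> d / 2"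
        using norm_fst_snd_le[of "w0 - (0, base q)"] w0 v(2) by auto
      have "snd w0 \<in> inner_zone J \<eta>"
        using e4(2) base0[OF q] w02 d(5) d0 by (force simp: dist_norm norm_minus_commute)
      define D where "D = slab d ?Z"
      define D' where "D' = {w. cmod (fst w) < d \<and> snd w \<in> inner_zone J \<eta>}"
      have "D \<subseteq> ?D" "D' \<subseteq> D" using d(2) subZ unfolding D_def D'_def slab_def by auto
      moreover have "compact D" "open D'"
        unfolding D_def D'_def by (rule compact_slab[OF region(4)], rule open_inner_slab)
      ultimately have D: "D \<subseteq> ?D" "D' \<subseteq> D" "compact D" "open D'" by blast+
      have DS: "D \<subseteq> S" using D(1) region(5) by blast
      have w0D: "w0 \<in> D" using D(2) w01 d0 \<open>snd w0 \<in> inner_zone J \<eta>\<close> unfolding D'_def by auto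
      have \<Phi>w0: "\<Phi> w0 = (q, p)" unfolding w0_def by (rule \<Phi>_\<Psi>[OF U])
      \<comment> \<open>the drift is of order \<open>d\<^sup>3\<close>, negligible against the margins \<open>d\<^sup>2 - (d / 2)\<^sup>2\<close> and \<open>\<eta>\<close>\<close>
      have \<kappa>T: "CD * \<kappa> * T \<le> K1 * d * d\<^sup>2"
      proof -
        have "CD * \<kappa> * T = (CD * CF) * (T * d ^ n) * d ^ (n + l + 1)"
          unfolding \<kappa>_def dm(1) by (simp only: mult_ac)
        also have "\<dots> \<le> (CD * CF) * b * d ^ 3"
          using Tn CD(1) CF(1) d0 b T dpow[of 3 "n + l + 1"]
          by (intro mult_mono mult_left_mono) (auto simp: l_def)
        finally show ?thesis unfolding K1_def by (simp add: power2_eq_square power3_eq_cube mult_ac)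
      qed
      have d2: "d\<^sup>2 \<le> d" using dpow[of 1 2] by simp
      have K1d: "K1 * d * d\<^sup>2 \<le> (1 / 2) * d\<^sup>2" using d(6) by (intro mult_right_mono) auto
      have c1: "(cmod (fst w0))\<^sup>2 + CD * \<kappa> * T < d\<^sup>2"
      proof -
        have "(cmod (fst w0))\<^sup>2 \<le> (d / 2)\<^sup>2" using w01 by (intro power_mono) auto
        also have "(d / 2)\<^sup>2 = (1 / 4) * d\<^sup>2" by (simp add: power2_eq_square)
        finally show ?thesis using \<kappa>T K1d zero_less_power[OF d0, of 2] by linarith
      qed
      have c2: "CD * d\<^sup>2 + CD * \<kappa> * T + \<bar>f (slow w0) - B q\<bar> < \<eta>"
      proof -
        have "CD * d\<^sup>2 \<le> CD * d" using d2 CD(1) by (intro mult_left_mono) auto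
        moreover have "K1 * d * d\<^sup>2 \<le> K1 * d * 1"
          using K(1) d0 d(1) by (intro mult_left_mono power_le_one) auto
        ultimately show ?thesis using f0 d(7) \<kappa>T by (simp add: distrib_right)
      qed
      have conf: "w s \<in> D'"
        if w: "forced_sol f D \<sigma> \<kappa>' s w" "0 \<le> \<kappa>'" "\<kappa>' \<le> \<kappa>" "w 0 = w0" and s: "0 \<le> s" "s \<le> T" for w \<kappa>' s
      proof -
        have "CD * \<kappa>' * s \<le> CD * \<kappa> * T" using w(2,3) s CD(1) \<kappa> by (intro mult_mono) auto
        then show ?thesis
          using CD(2)[OF s(1) _ d0 w(1)[unfolded D_def] _ q] c1 c2 d(2) unfolding w(4) D'_def by simp
      qed
      have forced0: "forced_sol f D \<sigma> 0 s w"
        if "ode_sol (\<lambda>z. \<sigma> *\<^sub>R model_field f z) w s" "\<forall>r\<in>{0..s}. w r \<in> D" for w s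
        unfolding forced_sol_def
        using that \<sigma> unfolding ode_sol_def by (auto intro!: exI[of _ 0])
      obtain z where z: "z 0 = w0" "ode_sol (\<lambda>z. \<sigma> *\<^sub>R model_field f z) z T" "\<forall>s\<in>{0..T}. z s \<in> D"
        using confined_ode_sol[OF lipschitz_scaled_model_field T D(3,4,2) w0D] conf[OF forced0] \<kappa>
        by (metis atLeastAtMost_iff order.refl)
      have near: "norm (D\<Psi> (\<Phi> w) (ham_field H (\<Phi> w)) - model_field f w) \<le> \<kappa>" if "w \<in> D" for w
      proof -
        have "cmod (fst w) \<le> d" using that unfolding D_def slab_def by simp
        then have "CF * cmod (fst w) ^ m \<le> \<kappa>" unfolding \<kappa>_def using CF(1) by (intro mult_left_mono power_mono) auto
        then show ?thesis using CF(2)[of w] that D(1) by force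
      qed
      have "open (\<Phi> ` D')"
      proof -
        have "\<Phi> ` D' = U \<inter> \<Psi> -` D'"
          using D(2) DS \<Psi>_\<Phi> \<Phi>_\<Psi> by (auto simp: image_iff)
        then show ?thesis
          using continuous_open_preimage[OF smooth_on_continuous[OF \<Psi>_smooth] open_U D(4)] by simp
      qed
      moreover have "compact (\<Phi> ` D)"
        by (rule compact_continuous_image[OF continuous_on_subset[OF smooth_on_continuous[OF \<Phi>_smooth] DS] D(3)])
      moreover have "\<Phi> ` D' \<subseteq> \<Phi> ` D" using D(2) by blast
      moreover have "(q, p) \<in> \<Phi> ` D" using w0D \<Phi>w0 by (metis imageI)
      moreover have "u s \<in> \<Phi> ` D'"
        if u: "u 0 = (q, p)" "s \<in> {0..T}" "ode_sol (\<lambda>x. \<sigma> *\<^sub>R ham_field H x) u s" "\<forall>r\<in>{0..s}. u r \<in> \<Phi> ` D"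
        for u s
      proof -
        have fs: "forced_sol f D \<sigma> \<kappa> s (\<lambda>r. \<Psi> (u r))"
          by (rule magnetic_flow_in_model[OF u(4,3) DS \<sigma> near])
        have "\<Psi> (u s) \<in> D'"
          by (rule conf[OF fs \<kappa> order.refl]) (use u(1,2) w0_def in auto)
        moreover have "u s \<in> \<Phi> ` D" using u(2,4) by simp
        then have "u s \<in> U" using DS by blast
        ultimately show ?thesis using \<Phi>_\<Psi> by (metis imageI)
      qed
      ultimately obtain u where u: "u 0 = (q, p)" "ode_sol (\<lambda>x. \<sigma> *\<^sub>R ham_field H x) u T"
          "\<forall>s\<in>{0..T}. u s \<in> \<Phi> ` D"
        using confined_ode_sol[OF lipschitz_scaled_ham_field T, of "\<Phi> ` D" "\<Phi> ` D'" "(q, p)" \<sigma>] by blast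
      have rel_H: "flow_rel UNIV H t (q, p) (u T)"
        unfolding flow_rel_forward using u unfolding T_def \<sigma>_def by blast
      have zS: "\<forall>s\<in>{0..T}. z s \<in> S" using z(3) DS by blast
      have rel_K: "flow_rel U K t (q, p) (\<Phi> (z T))"
        using normal_flow_from_model[of t z] zS z(1,2) \<Phi>w0 unfolding T_def \<sigma>_def by simp
      define w where "w s = \<Psi> (u s)" for s
      have wD: "forced_sol f ?D \<sigma> \<kappa> T w" and zD: "forced_sol f ?D \<sigma> 0 T z"
        using magnetic_flow_in_model[OF u(3,2) DS \<sigma> near] forced0[OF z(2,3)] D(1)
        unfolding w_def forced_sol_def by blast+
      have w0z: "w 0 = z 0" unfolding w_def z(1) w0_def u(1) by simp
      define \<mu> where "\<mu> = d ^ l"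
      have \<mu>: "0 < \<mu>" "\<mu> \<le> d" unfolding \<mu>_def using d0 dpow[of 1 l] by (auto simp: l_def)
      have \<mu>1: "CC * \<mu> \<le> 1" using mult_left_mono[OF \<mu>(2), of CC] CC(1) d(8) by linarith
      have \<mu>2: "CC * (\<kappa> * (1 + T)\<^sup>2 + T * \<mu>\<^sup>2) < \<mu>"
      proof -
        have "\<kappa> * (1 + T)\<^sup>2 = CF * ((1 + T) * d ^ n)\<^sup>2 * d ^ (l + 1)"
          unfolding \<kappa>_def dm(2) power_mult_distrib by (simp only: mult_ac)
        also have "\<dots> \<le> CF * (1 + b)\<^sup>2 * d ^ (l + 1)"
          using T1n CF(1) d0 T by (intro mult_right_mono mult_left_mono power_mono) auto
        finally have 1: "\<kappa> * (1 + T)\<^sup>2 \<le> CF * (1 + b)\<^sup>2 * d ^ (l + 1)" .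
        have "T * \<mu>\<^sup>2 = (T * d ^ n) * d ^ (2 * k + 2 + l)"
          unfolding \<mu>_def dl(1) by (simp only: mult_ac)
        also have "\<dots> \<le> b * d ^ (l + 1)"
          using Tn d0 b T by (intro mult_mono dpow) auto
        finally have "\<kappa> * (1 + T)\<^sup>2 + T * \<mu>\<^sup>2 \<le> (CF * (1 + b)\<^sup>2 + b) * d ^ (l + 1)"
          using 1 by (simp add: distrib_right)
        then have "CC * (\<kappa> * (1 + T)\<^sup>2 + T * \<mu>\<^sup>2) \<le> CC * ((CF * (1 + b)\<^sup>2 + b) * d ^ (l + 1))"
          using CC(1) by (intro mult_left_mono) auto
        also have "\<dots> = (K3 * d) * \<mu>" unfolding K3_def \<mu>_def by (simp add: mult_ac)
        also have "\<dots> < 1 * \<mu>" using d(9) \<mu>(1) by (rule mult_strict_right_mono)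
        finally show ?thesis by simp
      qed
      have TT: "T \<in> {0..T}" using T by simp
      from CC(2)[OF T \<kappa> \<mu>(1) \<mu>1 \<mu>2 wD zD w0z TT]
      have diff: "norm (snd (w T) - snd (z T)) \<le> \<mu>"
          "(cmod (fst (w T) - fst (z T)))\<^sup>2 \<le> CC * (T * (\<mu> + \<kappa> * (1 + T)))" by auto
      have "CC * (T * (\<mu> + \<kappa> * (1 + T))) \<le> K2 * (d ^ (k + 1))\<^sup>2"
      proof -
        have "\<kappa> * (1 + T) = CF * ((1 + T) * d ^ n) * d ^ (n + l + 1)"
          unfolding \<kappa>_def dm(1) by (simp only: mult_ac)
        also have "\<dots> \<le> CF * (1 + b) * d ^ l"
          using T1n CF(1) d0 T b by (intro mult_mono mult_left_mono dpow) auto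
        finally have "\<mu> + \<kappa> * (1 + T) \<le> (1 + CF * (1 + b)) * d ^ l"
          unfolding \<mu>_def by (simp add: distrib_right)
        then have "T * (\<mu> + \<kappa> * (1 + T)) \<le> T * ((1 + CF * (1 + b)) * d ^ l)"
          using T by (rule mult_left_mono)
        also have "\<dots> = (T * d ^ n) * ((1 + CF * (1 + b)) * (d ^ (k + 1))\<^sup>2)"
          unfolding dl(2) by (simp only: mult_ac)
        also have "\<dots> \<le> b * ((1 + CF * (1 + b)) * (d ^ (k + 1))\<^sup>2)"
          using Tn CF(1) b by (intro mult_right_mono) auto
        finally have "CC * (T * (\<mu> + \<kappa> * (1 + T))) \<le> CC * (b * ((1 + CF * (1 + b)) * (d ^ (k + 1))\<^sup>2))"
          using CC(1) by (intro mult_left_mono) auto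
        then show ?thesis unfolding K2_def by (simp add: mult_ac)
      qed
      with diff(2) have "(cmod (fst (w T) - fst (z T)))\<^sup>2 \<le> (sqrt K2 * d ^ (k + 1))\<^sup>2"
        using K(2) by (simp add: power_mult_distrib)
      then have "cmod (fst (w T) - fst (z T)) \<le> sqrt K2 * d ^ (k + 1)"
        by (rule power2_le_imp_le) (use K(2) d0 in auto)
      moreover have "\<mu> \<le> d ^ (k + 1)" unfolding \<mu>_def l_def by (rule dpow) simp
      moreover have "norm (w T - z T) \<le> cmod (fst (w T - z T)) + norm (snd (w T - z T))"
        by (cases "w T - z T") (simp add: norm_Pair_le)
      ultimately have wz: "norm (w T - z T) \<le> (1 + sqrt K2) * d ^ (k + 1)"
        using diff(1) by (simp add: distrib_right)
      have "(1 + sqrt K2) * d ^ (k + 1) \<le> (1 + sqrt K2) * d"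
        using dpow[of 1 "k + 1"] K(2) by (intro mult_left_mono) auto
      then have "norm (w T - z T) \<le> e3" using wz d(10) by linarith
      moreover have "z T \<in> ?D" using z(3) TT D(1) by blast
      ultimately have "norm (\<Phi> (w T) - \<Phi> (z T)) \<le> L3 * norm (w T - z T)" using L3(3) by blast
      also have "\<dots> \<le> L3 * ((1 + sqrt K2) * d ^ k)"
      proof (rule mult_left_mono[OF order_trans[OF wz] L3(2)])
        show "(1 + sqrt K2) * d ^ (k + 1) \<le> (1 + sqrt K2) * d ^ k"
          using dpow[of k "k + 1"] K(2) by (intro mult_left_mono) auto
      qed
      finally have "norm (\<Phi> (w T) - \<Phi> (z T)) \<le> L3 * (1 + sqrt K2) * d ^ k" by (simp add: mult_ac)
      moreover have "\<Phi> (w T) = u T" unfolding w_def using u(3) TT DS by (intro \<Phi>_\<Psi>) blast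
      ultimately have "norm (u T - \<Phi> (z T)) \<le> L3 * (1 + sqrt K2) * d ^ k" by simp
      with rel_H rel_K show ?thesis by (rule flows_withinI)
    qed
    show ?thesis
    proof (intro exI[of _ "L3 * (1 + sqrt K2)"])
      note ev = eventually_small_multiple
      have h: "(1::real) / 2 > 0" "(1::real) > 0" by simp_all
      have "\<forall>\<^sub>F d::real in at_right 0. d > 0" by (simp add: eventually_at_right_less)
      then show "\<forall>\<^sub>F d in at_right 0. \<forall>q p t.
          B q \<in> J \<and> c0 * norm (p - A q) \<le> d \<and> \<bar>t\<bar> \<le> b / d ^ n \<longrightarrow>
          flows_within t (q, p) (L3 * (1 + sqrt K2) * d ^ k)"
        using ev[OF h(2), of 1] ev[OF region(2), of 1] ev[OF L1(1), of 1] ev[OF L2(1), of 1] ev[OF e4(1), of 1]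
          ev[OF h(1), of K1] ev[OF region(1), of "CD + K1 + 1"] ev[OF h(2), of CC] ev[OF h(2), of K3]
          ev[OF L3(1), of "1 + sqrt K2"]
      proof eventually_elim
        case (elim d)
        then show ?case using close[of d] by blast
      qed
    qed
  qed
  then show ?thesis using c0(1) by blast
qed

end

theorem theorem1p3:
  fixes A :: "real^2 \<Rightarrow> real^2" and C M C0 :: real and J :: "real set"
    and S :: "model set" and \<Phi> :: "model \<Rightarrow> phase" and f :: "(real^2) \<times> real \<Rightarrow> real"
    and a b N :: real
  defines "H \<equiv> mag_ham A" and "B \<equiv> mag_field A" and "K \<equiv> normal_ham S \<Phi> f"
  assumes "smooth_on UNIV A"
    and "\<And>q. B q > 0"
    and "C > 0" and "M > 0" and "\<And>q. norm q \<ge> M \<Longrightarrow> B q \<ge> C"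
    and "C0 < C"
    and "closed J" and "is_interval J" and "J \<subseteq> {0<..<C0}"
    and "\<And>q. B q \<in> J \<Longrightarrow> frechet_derivative B (at q) \<noteq> (\<lambda>v. 0)"
    and "normal_form A S \<Phi> f"
    and "N > 0" and "a > 0" and "b > 0"
  shows "(\<forall>\<^sub>F \<epsilon> in at_right 0. \<forall>q p t.
            B q \<in> J \<and> H (q, p) \<le> a * \<epsilon> \<and> \<bar>t\<bar> \<le> b * \<epsilon> powr (- N) \<longrightarrow>
              flow_defined UNIV H t (q, p) \<and> flow_defined (\<Phi> ` S) K t (q, p)) \<and>
         (\<forall>k::nat. \<exists>c. \<forall>\<^sub>F \<epsilon> in at_right 0. \<forall>q p t.
            B q \<in> J \<and> H (q, p) \<le> a * \<epsilon> \<and> \<bar>t\<bar> \<le> b * \<epsilon> powr (- N) \<longrightarrow>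
              norm (ham_flow UNIV H t (q, p) - ham_flow (\<Phi> ` S) K t (q, p)) \<le> c * \<epsilon> ^ k)"
proof (cases "J = {}")
  case True
  then show ?thesis by simp
next
  case False
  interpret nf: magnetic_normal_form A S \<Phi> f
    by unfold_locales fact+
  have pos: "\<And>q. mag_field A q > 0" and conf: "\<And>q. norm q \<ge> M \<Longrightarrow> mag_field A q \<ge> C"
    and B': "\<And>q. mag_field A q \<in> J \<Longrightarrow> frechet_derivative (mag_field A) (at q) \<noteq> (\<lambda>v. 0)"
    using assms(5,8,13) unfolding B_def by auto
  obtain \<eta> \<delta> where region: "\<eta> > 0" "0 < \<delta>" "\<delta> \<le> 1" "compact (nf.zone J \<eta>)" "slab \<delta> (nf.zone J \<eta>) \<subseteq> S"
      "\<forall>z\<in>nf.zone J \<eta>. \<forall>I\<in>{0..\<delta>\<^sup>2}. grad_z f (z, I) \<noteq> 0"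
    using nf.confining_region[OF pos conf \<open>C0 < C\<close> \<open>closed J\<close> False \<open>J \<subseteq> {0<..<C0}\<close> B'] by blast
  have "\<exists>c0>0. \<forall>b\<ge>0. \<forall>n k. \<exists>c. \<forall>\<^sub>F d in at_right 0. \<forall>q p t.
      mag_field A q \<in> J \<and> c0 * norm (p - A q) \<le> d \<and> \<bar>t\<bar> \<le> b / d ^ n \<longrightarrow>
      nf.flows_within t (q, p) (c * d ^ k)"
    by (rule nf.flows_close[OF \<open>closed J\<close> region pos])
  then obtain c0 where c0_all: "c0 > 0 \<and> (\<forall>b\<ge>0. \<forall>n k. \<exists>c. \<forall>\<^sub>F d in at_right 0. \<forall>q p t.
      mag_field A q \<in> J \<and> c0 * norm (p - A q) \<le> d \<and> \<bar>t\<bar> \<le> b / d ^ n \<longrightarrow>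
      nf.flows_within t (q, p) (c * d ^ k))"
    by (rule exE)
  note c0 = conjunct1[OF c0_all] conjunct2[OF c0_all]
  define n where "n = nat \<lceil>N\<rceil>"
  have nN: "N \<le> real n" unfolding n_def by linarith
  have rel: "\<exists>c. \<forall>\<^sub>F \<epsilon> in at_right 0. \<forall>q p t.
      B q \<in> J \<and> H (q, p) \<le> a * \<epsilon> \<and> \<bar>t\<bar> \<le> b * \<epsilon> powr (- N) \<longrightarrow> nf.flows_within t (q, p) (c * \<epsilon> ^ k)"
    for k
  proof -
    \<comment> \<open>The comparison runs on the scale of \<open>z\<^sub>1\<close>, hence of \<open>p - A q\<close>, which is \<open>sqrt \<epsilon>\<close>;
      powers of \<open>\<epsilon>\<close> become even powers of that scale.\<close>
    define r where "r = c0 * sqrt a"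
    have r: "r > 0" unfolding r_def using c0(1) \<open>a > 0\<close> by simp
    have "b * r ^ (2 * n) \<ge> 0" using \<open>b > 0\<close> r by simp
    then obtain c where c: "\<forall>\<^sub>F d in at_right 0. \<forall>q p t.
        mag_field A q \<in> J \<and> c0 * norm (p - A q) \<le> d \<and> \<bar>t\<bar> \<le> b * r ^ (2 * n) / d ^ (2 * n) \<longrightarrow>
        nf.flows_within t (q, p) (c * d ^ (2 * k))"
      using c0(2) by meson
    have "((\<lambda>\<epsilon>. r * sqrt \<epsilon>) \<longlongrightarrow> r * sqrt 0) (at_right 0)" by (intro tendsto_intros)
    moreover have pe: "\<forall>\<^sub>F \<epsilon>::real in at_right 0. \<epsilon> > 0" by (simp add: eventually_at_right_less)
    then have "\<forall>\<^sub>F \<epsilon> in at_right 0. r * sqrt \<epsilon> \<in> {0<..} \<and> r * sqrt \<epsilon> \<noteq> 0"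
      by eventually_elim (use r in simp)
    ultimately have lim: "filterlim (\<lambda>\<epsilon>. r * sqrt \<epsilon>) (at_right 0) (at_right 0)"
      unfolding filterlim_at by simp
    have "\<forall>\<^sub>F \<epsilon>::real in at_right 0. 1 * \<epsilon> < 1" by (rule eventually_small_multiple) simp
    with pe eventually_compose_filterlim[OF c lim]
    have "\<forall>\<^sub>F \<epsilon> in at_right 0. \<forall>q p t. B q \<in> J \<and> H (q, p) \<le> a * \<epsilon> \<and> \<bar>t\<bar> \<le> b * \<epsilon> powr (- N) \<longrightarrow>
      nf.flows_within t (q, p) ((c * r ^ (2 * k)) * \<epsilon> ^ k)"
    proof eventually_elim
      case (elim \<epsilon>)
      have sq: "sqrt \<epsilon> ^ (2 * i) = \<epsilon> ^ i" for i using elim(1) by (simp add: power_mult)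
      show ?case
      proof (intro allI impI)
        fix q p t assume as: "B q \<in> J \<and> H (q, p) \<le> a * \<epsilon> \<and> \<bar>t\<bar> \<le> b * \<epsilon> powr (- N)"
        have "(norm (p - A q))\<^sup>2 \<le> a * \<epsilon>" using as unfolding H_def mag_ham_def by simp
        then have "norm (p - A q) \<le> sqrt a * sqrt \<epsilon>" by (simp add: real_le_rsqrt real_sqrt_mult[symmetric])
        then have 1: "c0 * norm (p - A q) \<le> r * sqrt \<epsilon>"
          using mult_left_mono[of _ _ c0] c0(1) unfolding r_def by (simp add: mult.assoc)
        have "\<epsilon> powr (- N) \<le> \<epsilon> powr (- real n)" using nN elim(1,3) by (intro powr_mono') auto
        also have "\<epsilon> powr (- real n) = 1 / \<epsilon> ^ n"
          using elim(1) by (simp add: powr_minus powr_realpow divide_inverse)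
        finally have "b * \<epsilon> powr (- N) \<le> b * (1 / \<epsilon> ^ n)" using \<open>b > 0\<close> by (intro mult_left_mono) auto
        moreover have "b * r ^ (2 * n) / (r * sqrt \<epsilon>) ^ (2 * n) = b * (1 / \<epsilon> ^ n)"
          using r by (simp add: power_mult_distrib sq)
        ultimately have 2: "\<bar>t\<bar> \<le> b * r ^ (2 * n) / (r * sqrt \<epsilon>) ^ (2 * n)" using as by linarith
        have 3: "c * (r * sqrt \<epsilon>) ^ (2 * k) = (c * r ^ (2 * k)) * \<epsilon> ^ k"
          by (simp add: power_mult_distrib sq)
        show "nf.flows_within t (q, p) ((c * r ^ (2 * k)) * \<epsilon> ^ k)"
          using elim(2) as 1 2 unfolding 3 B_def by blast
      qed
    qed
    then show ?thesis by blast
  qed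
  show ?thesis
  proof (intro conjI allI)
    obtain c where "\<forall>\<^sub>F \<epsilon> in at_right 0. \<forall>q p t. B q \<in> J \<and> H (q, p) \<le> a * \<epsilon> \<and> \<bar>t\<bar> \<le> b * \<epsilon> powr (- N) \<longrightarrow>
        nf.flows_within t (q, p) (c * \<epsilon> ^ 0)"
      using rel[of 0] by blast
    then show "\<forall>\<^sub>F \<epsilon> in at_right 0. \<forall>q p t.
        B q \<in> J \<and> H (q, p) \<le> a * \<epsilon> \<and> \<bar>t\<bar> \<le> b * \<epsilon> powr (- N) \<longrightarrow>
        flow_defined UNIV H t (q, p) \<and> flow_defined (\<Phi> ` S) K t (q, p)"
      unfolding nf.flows_within_def H_def K_def by eventually_elim blast
  next
    fix k
    obtain c where "\<forall>\<^sub>F \<epsilon> in at_right 0. \<forall>q p t. B q \<in> J \<and> H (q, p) \<le> a * \<epsilon> \<and> \<bar>t\<bar> \<le> b * \<epsilon> powr (- N) \<longrightarrow>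
        nf.flows_within t (q, p) (c * \<epsilon> ^ k)"
      using rel[of k] by blast
    then have "\<forall>\<^sub>F \<epsilon> in at_right 0. \<forall>q p t.
        B q \<in> J \<and> H (q, p) \<le> a * \<epsilon> \<and> \<bar>t\<bar> \<le> b * \<epsilon> powr (- N) \<longrightarrow>
        norm (ham_flow UNIV H t (q, p) - ham_flow (\<Phi> ` S) K t (q, p)) \<le> c * \<epsilon> ^ k"
      unfolding nf.flows_within_def H_def K_def by eventually_elim blast
    then show "\<exists>c. \<forall>\<^sub>F \<epsilon> in at_right 0. \<forall>q p t.
        B q \<in> J \<and> H (q, p) \<le> a * \<epsilon> \<and> \<bar>t\<bar> \<le> b * \<epsilon> powr (- N) \<longrightarrow>
        norm (ham_flow UNIV H t (q, p) - ham_flow (\<Phi> ` S) K t (q, p)) \<le> c * \<epsilon> ^ k"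
      by blast
  qed
qed

end
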